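(* Let $p\in C^1(\mathbb{R}^n_+)$ with $1<p(x)<\infty$, and define, for $t,s\ge0$, $$p_\lambda(t)=\inf_{y\in\mathbb{R}^n_+:\,y_n\le t}\min\{1,p(y)-1\},\quad p_\Lambda(t)=\sup_{y\in\mathbb{R}^n_+:\,y_n\le t}\max\{1,p(y)-1\},$$ $$\|Dp\|_{\infty,t}=\sup_{y\in\mathbb{R}^n_+:\,|y|\ge t}|Dp(y)|,\qquad \Phi(t,s)=\|Dp\|_{\infty,t}\,s|\log s| ,$$ and assume that $p_\lambda,p_\Lambda$ take values in $(0,\infty)$ and that $\Phi$ is real-valued and continuous. Let $u$ be $p(x)$-subharmonic in $\mathbb{R}^n_+$ satisfying $$\limsup_{x\to y}u(x)\le0\quad\text{for all }y\in\partial\mathbb{R}^n_+.$$ Then there is a degenerate elliptic $F:\mathbb{R}^n\times\mathbb{R}\times\mathbb{R}^n\times\mathbb{S}^n\to\mathbb{R}$ such that $u$ is a viscosity subsolution of $F(x,u,Du,D^2u)=0$ in $\mathbb{R}^n_+$, where $F$ satisfies $$-F(x,0,q,X)\le\Phi(|x|,|q|)+\Lambda(x_n)\mathrm{Tr}(X^+)-\lambda(x_n)\mathrm{Tr}(X^-)$$ with $\Phi(t,s)=\|Dp\|_{\infty,t}\,s|\log s|$ and $\lambda=p_\lambda$, $\Lambda=p_\Lambda$, and $\Phi\ge0$ satisfies $\int_0^\epsilon\frac{ds}{\Phi(t,s)}=\infty$ for all $\epsilon,t>0$ (with $1/0=\infty$). Moreover, let $\gamma:(0,\infty)\to(0,\infty)$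 be nondecreasing with $$\frac{p_\Lambda(R)}{\|Dp\|_{\infty,R}}\exp\left(\int_0^R\frac{\|Dp\|_{\infty,s}}{p_\lambda(s)}\,ds\right)\precsim\gamma(R),$$ and for $\nu>0$ let $\check u(x)=\int_0^{x_n}f_\nu(s)\,ds$, where $$f_\nu(t)=\nu^{\exp\left(\int_0^t\frac{\|Dp\|_{\infty,s}}{p_\lambda(s)}ds\right)}\ \text{ if } 0<\nu\le1,\qquad f_\nu(t)=\nu^{\exp\left(-\int_0^t\frac{\|Dp\|_{\infty,s}}{p_\lambda(s)}ds\right)}\ \text{ if }\nu>1.$$ Then: - If $u\ge\check u$ at some point of the $x_n$-axis in $\mathbb{R}^n_+$ for some $\nu\in(0,1]$, then $$\liminf_{R\to\infty}\frac{M'(R)}{\nu^{\exp\left(\int_0^R\frac{\|Dp\|_{\infty,s}}{p_\lambda(s)}ds\right)}}>0.$$ - If $u\ge\check u$ at some point of the $x_n$-axis in $\mathbb{R}^n_+$ for some $\nu>1$, then $$\liminf_{R\to\infty}\frac{M(R)}{R}>0.$$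
   Context: Notation: $\mathbb{R}^n_+=\{x\in\mathbb{R}^n:x_n>0\}$, $n\ge1$; $\mathbb{S}^n$ is the set of symmetric $n\times n$ matrices with the positive semidefinite ordering. For $X\in\mathbb{S}^n$ write $X=X^+-X^-$ with $X^\pm\ge0$, $X^+X^-=0$. $s|\log s|$ is taken to be $0$ at $s=0$. A function $u\in W^{1,p(x)}_{loc}(\Omega)$ is a weak subsolution of $\nabla\cdot(|Du|^{p(x)-2}Du)=0$ if $\int_\Omega|Du|^{p(x)-2}Du\cdot D\psi\,dx\le0$ for all nonnegative $\psi\in C_0^\infty(\Omega)$. An upper semicontinuous weak subsolution is called $p(x)$-subharmonic. Degenerate ellipticity: $F(x,u,q,X)\ge F(x,v,q,Y)$ whenever $u\ge v$ and $X\le Y$. Viscosity subsolution in $\Omega$: an upper semicontinuous $u:\Omega\to\mathbb{R}$ such that whenever $\varphi\in C^2(\Omega)$ and $u-\varphi$ has a local maximum at $x_0\in\Omega$, then $F(x_0,u(x_0),D\varphi(x_0),D^2\varphi(x_0))\le0$. $D(R)=\{x\in\mathbb{R}^n_+:\sum_{i=1}^{n-1}x_i^2+(x_n+\gamma(R))^2<(R+\gamma(R))^2\}$, $M(R)=\sup_{\partial D(R)}u$ (with $u(y):=\limsup_{x\to y}u(x)$ for $y\in\partial\mathbb{R}^n_+$), $M'(R)=\liminf_{h\to0^+}\frac{M(R)-M(R-h)}{h}$. $A\precsim B$ means that there is a constant $c>0$ with $A\le cB$; in the condition on $\gamma$ a quotient with $\|Dp\|_{\infty,R}=0$ is read as 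$\infty$.
   Formalization: p(x)-subharmonic also requires u(x) = ess limsup of u at x (else p=2, u=0 except u=1 at one point is a counterexample); p_λ, p_Λ in (0,∞) is required only for t>0, as at t=0 the index set is empty. *)

theory Defs
  imports "HOL-Analysis.Analysis" "HOL-Probability.Essential_Supremum"
begin

text \<open>
  Euclidean space is \<^typ>\<open>real ^ 'n\<close>. Since the index type carries no order, the index \<open>k\<close> of the
  distinguished (``last'') coordinate is a parameter.
\<close>

definition half_space :: "'n::finite \<Rightarrow> (real ^ 'n) set"
  where "half_space k = {x. 0 < x $ k}"

definition partial :: "'n::finite \<Rightarrow> (real ^ 'n \<Rightarrow> real) \<Rightarrow> real ^ 'n \<Rightarrow> real"
  where "partial i f x = frechet_derivative f (at x) (axis i 1)"

definition grad :: "(real ^ 'n::finite \<Rightarrow> real) \<Rightarrow> real ^ 'n \<Rightarrow> real ^ 'n"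
  where "grad f x = (\<chi> i. partial i f x)"

definition hess :: "(real ^ 'n::finite \<Rightarrow> real) \<Rightarrow> real ^ 'n \<Rightarrow> real ^ 'n ^ 'n"
  where "hess f x = (\<chi> i j. partial j (partial i f) x)"

text \<open>\<open>C_on m \<Omega> f\<close> says \<open>f \<in> C\<^sup>m(\<Omega>)\<close>; it is meant for open \<open>\<Omega>\<close>, as derivatives are taken at
  interior points.\<close>

primrec C_on :: "nat \<Rightarrow> (real ^ 'n::finite) set \<Rightarrow> (real ^ 'n \<Rightarrow> real) \<Rightarrow> bool" where
  "C_on 0 \<Omega> f \<longleftrightarrow> continuous_on \<Omega> f"
| "C_on (Suc m) \<Omega> f \<longleftrightarrow> (\<forall>x\<in>\<Omega>. f differentiable (at x)) \<and> (\<forall>i. C_on m \<Omega> (partial i f))"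

definition test_function :: "(real ^ 'n::finite) set \<Rightarrow> (real ^ 'n \<Rightarrow> real) \<Rightarrow> bool"
  where "test_function \<Omega> \<psi> \<longleftrightarrow>
    (\<forall>m. C_on m UNIV \<psi>) \<and> compact (closure {x. \<psi> x \<noteq> 0}) \<and> closure {x. \<psi> x \<noteq> 0} \<subseteq> \<Omega>"

definition usc_on :: "(real ^ 'n::finite) set \<Rightarrow> (real ^ 'n \<Rightarrow> real) \<Rightarrow> bool"
  where "usc_on \<Omega> u \<longleftrightarrow> (\<forall>a. openin (top_of_set \<Omega>) {x \<in> \<Omega>. u x < a})"

definition Lp_var ::
  "(real ^ 'n::finite) set \<Rightarrow> (real ^ 'n \<Rightarrow> real) \<Rightarrow> (real ^ 'n \<Rightarrow> 'b::euclidean_space) \<Rightarrow> bool"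
  where "Lp_var K p f \<longleftrightarrow>
    f \<in> borel_measurable (lebesgue_on K) \<and>
    (\<exists>c>0. (\<integral>\<^sup>+ x. ennreal (norm (f x /\<^sub>R c) powr p x) \<partial>lebesgue_on K) < \<infinity>)"

definition Lp_var_loc ::
  "(real ^ 'n::finite) set \<Rightarrow> (real ^ 'n \<Rightarrow> real) \<Rightarrow> (real ^ 'n \<Rightarrow> 'b::euclidean_space) \<Rightarrow> bool"
  where "Lp_var_loc \<Omega> p f \<longleftrightarrow> (\<forall>K. compact K \<and> K \<subseteq> \<Omega> \<longrightarrow> Lp_var K p f)"

definition weak_gradient ::
  "(real ^ 'n::finite) set \<Rightarrow> (real ^ 'n \<Rightarrow> real) \<Rightarrow> (real ^ 'n \<Rightarrow> real ^ 'n) \<Rightarrow> bool"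
  where "weak_gradient \<Omega> u V \<longleftrightarrow>
    (\<forall>K. compact K \<and> K \<subseteq> \<Omega> \<longrightarrow> u absolutely_integrable_on K \<and> V absolutely_integrable_on K) \<and>
    (\<forall>\<psi> i. test_function \<Omega> \<psi> \<longrightarrow>
      (LINT x:\<Omega>|lebesgue. u x * partial i \<psi> x) = - (LINT x:\<Omega>|lebesgue. V x $ i * \<psi> x))"

text \<open>\<open>W1p_loc \<Omega> p u V\<close>: \<open>u\<close> is in the local Sobolev space with exponent \<open>p(x)\<close>, with weak
  gradient \<open>V\<close> (which is unique almost everywhere).\<close>

definition W1p_loc ::
  "(real ^ 'n::finite) set \<Rightarrow> (real ^ 'n \<Rightarrow> real) \<Rightarrow> (real ^ 'n \<Rightarrow> real) \<Rightarrow> (real ^ 'n \<Rightarrow> real ^ 'n) \<Rightarrow> bool"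
  where "W1p_loc \<Omega> p u V \<longleftrightarrow> Lp_var_loc \<Omega> p u \<and> Lp_var_loc \<Omega> p V \<and> weak_gradient \<Omega> u V"

text \<open>Where \<open>V x = 0\<close> the vector \<open>|V|\<^bsup>p-2\<^esup>V\<close> below is \<open>0\<close>, also for \<open>p x < 2\<close>.\<close>

definition weak_subsolution ::
  "(real ^ 'n::finite) set \<Rightarrow> (real ^ 'n \<Rightarrow> real) \<Rightarrow> (real ^ 'n \<Rightarrow> real) \<Rightarrow> bool"
  where "weak_subsolution \<Omega> p u \<longleftrightarrow>
    (\<exists>V. W1p_loc \<Omega> p u V \<and>
      (\<forall>\<psi>. test_function \<Omega> \<psi> \<and> (\<forall>x. 0 \<le> \<psi> x) \<longrightarrow>
        (LINT x:\<Omega>|lebesgue. ((norm (V x) powr (p x - 2)) *\<^sub>R V x) \<bullet> grad \<psi> x) \<le> 0))"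

definition ess_limsup :: "(real ^ 'n::finite) set \<Rightarrow> (real ^ 'n \<Rightarrow> real) \<Rightarrow> real ^ 'n \<Rightarrow> ereal"
  where "ess_limsup \<Omega> u x =
    (INF r\<in>{0<..}. esssup (lebesgue_on (\<Omega> \<inter> ball x r)) (\<lambda>y. ereal (u y)))"

text \<open>
  Weak subsolutions are only determined almost everywhere, so a weak subsolution stays one, and stays
  upper semicontinuous, when its value at a single point is raised. Pointwise statements such as the
  viscosity inequality or \<open>u x \<ge> c\<close> are therefore meaningful only for the canonical representative
  \<open>u(x) = ess limsup u(y)\<close> as \<open>y \<rightarrow> x\<close>, which is required by the last conjunct.
\<close>

definition px_subharmonic ::
  "(real ^ 'n::finite) set \<Rightarrow> (real ^ 'n \<Rightarrow> real) \<Rightarrow> (real ^ 'n \<Rightarrow> real) \<Rightarrow> bool"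
  where "px_subharmonic \<Omega> p u \<longleftrightarrow>
    weak_subsolution \<Omega> p u \<and> usc_on \<Omega> u \<and> (\<forall>x\<in>\<Omega>. ereal (u x) = ess_limsup \<Omega> u x)"

definition sym_mat :: "real ^ 'n ^ 'n \<Rightarrow> bool"
  where "sym_mat X \<longleftrightarrow> transpose X = X"

definition psd :: "real ^ 'n ^ 'n::finite \<Rightarrow> bool"
  where "psd X \<longleftrightarrow> sym_mat X \<and> (\<forall>v. 0 \<le> v \<bullet> (X *v v))"

text \<open>\<open>P = X\<^sup>+\<close> and \<open>N = X\<^sup>-\<close>; such \<open>P\<close> and \<open>N\<close> exist and are unique for symmetric \<open>X\<close>.\<close>

definition pos_neg_parts :: "real ^ 'n ^ 'n::finite \<Rightarrow> real ^ 'n ^ 'n \<Rightarrow> real ^ 'n ^ 'n \<Rightarrow> bool"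
  where "pos_neg_parts X P N \<longleftrightarrow> psd P \<and> psd N \<and> X = P - N \<and> P ** N = 0"

text \<open>An operator \<open>F\<close> takes its matrix argument in all of \<^typ>\<open>real ^ 'n ^ 'n\<close>, but only its values
  at symmetric matrices are ever used.\<close>

definition degenerate_elliptic ::
  "(real ^ 'n::finite \<Rightarrow> real \<Rightarrow> real ^ 'n \<Rightarrow> real ^ 'n ^ 'n \<Rightarrow> real) \<Rightarrow> bool"
  where "degenerate_elliptic F \<longleftrightarrow>
    (\<forall>x u v q X Y. sym_mat X \<and> sym_mat Y \<and> u \<ge> v \<and> psd (Y - X) \<longrightarrow> F x u q X \<ge> F x v q Y)"

definition viscosity_subsolution ::
  "(real ^ 'n::finite \<Rightarrow> real \<Rightarrow> real ^ 'n \<Rightarrow> real ^ 'n ^ 'n \<Rightarrow> real) \<Rightarrow> (real ^ 'n) set \<Rightarrow>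
    (real ^ 'n \<Rightarrow> real) \<Rightarrow> bool"
  where "viscosity_subsolution F \<Omega> u \<longleftrightarrow>
    usc_on \<Omega> u \<and>
    (\<forall>\<phi> x0. C_on 2 \<Omega> \<phi> \<and> x0 \<in> \<Omega> \<and>
       (\<forall>\<^sub>F x in at x0 within \<Omega>. u x - \<phi> x \<le> u x0 - \<phi> x0) \<longrightarrow>
       F x0 (u x0) (grad \<phi> x0) (hess \<phi> x0) \<le> 0)"

text \<open>
  These quantities are extended reals, so that finiteness is an explicit hypothesis. For \<open>t \<le> 0\<close> the
  index set of \<open>p_lam\<close> and \<open>p_Lam\<close> is empty and their values are \<open>\<plusminus>\<infinity>\<close>. A positive extended real
  divided by \<open>0\<close> is \<open>\<infinity>\<close>.
\<close>

definition p_lam :: "'n::finite \<Rightarrow> (real ^ 'n \<Rightarrow> real) \<Rightarrow> real \<Rightarrow> ereal"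
  where "p_lam k p t = (INF y\<in>{y \<in> half_space k. y $ k \<le> t}. ereal (min 1 (p y - 1)))"

definition p_Lam :: "'n::finite \<Rightarrow> (real ^ 'n \<Rightarrow> real) \<Rightarrow> real \<Rightarrow> ereal"
  where "p_Lam k p t = (SUP y\<in>{y \<in> half_space k. y $ k \<le> t}. ereal (max 1 (p y - 1)))"

definition Dp_norm :: "'n::finite \<Rightarrow> (real ^ 'n \<Rightarrow> real) \<Rightarrow> real \<Rightarrow> ereal"
  where "Dp_norm k p t = (SUP y\<in>{y \<in> half_space k. t \<le> norm y}. ereal (norm (grad p y)))"

definition Phi :: "'n::finite \<Rightarrow> (real ^ 'n \<Rightarrow> real) \<Rightarrow> real \<Rightarrow> real \<Rightarrow> ereal"
  where "Phi k p t s = Dp_norm k p t * ereal (s * \<bar>ln s\<bar>)"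

definition Dp_int :: "'n::finite \<Rightarrow> (real ^ 'n \<Rightarrow> real) \<Rightarrow> real \<Rightarrow> real"
  where "Dp_int k p R = integral {0..R} (\<lambda>s. real_of_ereal (Dp_norm k p s / p_lam k p s))"

definition f_nu :: "'n::finite \<Rightarrow> (real ^ 'n \<Rightarrow> real) \<Rightarrow> real \<Rightarrow> real \<Rightarrow> real"
  where "f_nu k p \<nu> t =
    (if \<nu> \<le> 1 then \<nu> powr exp (Dp_int k p t) else \<nu> powr exp (- Dp_int k p t))"

definition u_check :: "'n::finite \<Rightarrow> (real ^ 'n \<Rightarrow> real) \<Rightarrow> real \<Rightarrow> real ^ 'n \<Rightarrow> real"
  where "u_check k p \<nu> x = integral {0..x $ k} (f_nu k p \<nu>)"

definition Dom :: "'n::finite \<Rightarrow> (real \<Rightarrow> real) \<Rightarrow> real \<Rightarrow> (real ^ 'n) set"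
  where "Dom k \<gamma> R =
    {x \<in> half_space k. (\<Sum>i\<in>UNIV - {k}. (x $ i)\<^sup>2) + (x $ k + \<gamma> R)\<^sup>2 < (R + \<gamma> R)\<^sup>2}"

definition ext_closure :: "'n::finite \<Rightarrow> (real ^ 'n \<Rightarrow> real) \<Rightarrow> real ^ 'n \<Rightarrow> ereal"
  where "ext_closure k u y =
    (if y \<in> half_space k then ereal (u y)
     else Limsup (at y within half_space k) (\<lambda>x. ereal (u x)))"

definition M_max :: "'n::finite \<Rightarrow> (real \<Rightarrow> real) \<Rightarrow> (real ^ 'n \<Rightarrow> real) \<Rightarrow> real \<Rightarrow> ereal"
  where "M_max k \<gamma> u R = (SUP y\<in>frontier (Dom k \<gamma> R). ext_closure k u y)"

definition M_deriv :: "'n::finite \<Rightarrow> (real \<Rightarrow> real) \<Rightarrow> (real ^ 'n \<Rightarrow> real) \<Rightarrow> real \<Rightarrow> ereal"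
  where "M_deriv k \<gamma> u R =
    Liminf (at_right 0) (\<lambda>h. (M_max k \<gamma> u R - M_max k \<gamma> u (R - h)) / ereal h)"

end

theory Submission
  imports Defs
begin

text \<open>
  The operator is \<open>F(x, q, X) = - (\<parallel>Dp\<parallel> |q| |ln |q|| + sup (Tr X + (p(x) - 2) e \<bullet> X e))\<close>, the supremum being
  over the unit ball; for \<open>e = q / |q|\<close> the second summand is the second order part of the \<open>p(x)\<close>-Laplacian
  in nondivergence form, and the supremum takes care of critical points.

  Let \<open>\<phi>\<close> touch \<open>u\<close> from above at \<open>x\<^sub>0\<close> and violate the viscosity inequality. After replacing \<open>\<phi>\<close> by a
  quartic polynomial that touches strictly, the regularised fields \<open>(|D\<phi>|\<^sup>2 + \<delta>\<^sup>2)\<^bsup>(p-2)/2\<^esup> D\<phi>\<close> have nonpositive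
  divergence near \<open>x\<^sub>0\<close> uniformly in \<open>\<delta>\<close>, even if \<open>D\<phi>(x\<^sub>0) = 0\<close> and \<open>p < 2\<close>. Both this and the weak inequality
  for \<open>u\<close> are tested with \<open>h(u\<^sub>\<epsilon> - \<phi>)\<close>, where \<open>u\<^sub>\<epsilon>\<close> is a mollification and \<open>h(t) = exp (-1/t)\<close> for \<open>t > 0\<close>, \<open>h = 0\<close> otherwise.
  As \<open>p\<close> is Lipschitz, hence log-Hoelder continuous, \<open>|Du\<^sub>\<epsilon>|\<^bsup>p\<^esup>\<close> is controlled by \<open>1 + |Du|\<^bsup>p\<^esup> * \<eta>\<^sub>\<epsilon>\<close> and one may let
  \<open>\<epsilon> \<rightarrow> 0\<close>. Strict monotonicity of the field gives \<open>Du = D\<phi>\<close> almost everywhere on \<open>{u > \<phi>}\<close>, so \<open>h(u - \<phi>)\<close> has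
  vanishing gradient and compact support, whence \<open>u \<le> \<phi>\<close> almost everywhere, contradicting the choice of the
  representative of \<open>u\<close>.

  For the growth estimates fix \<open>R\<close> and put \<open>r = |x + \<gamma>(R) e| - \<gamma>(R)\<close> with \<open>e\<close> the unit vector of the distinguished
  axis, so that \<open>D(R) = {r < R}\<close>. Let \<open>I\<close> be the integral of \<open>\<parallel>Dp\<parallel> / p\<^sub>\<lambda>\<close> and \<open>\<delta> = C exp (- I(R))\<close>. The function \<open>V(r)\<close>
  with \<open>V(0) = 0\<close> and \<open>ln V' = \<delta> + exp I (ln \<nu> - \<delta>)\<close> is a strict supersolution in \<open>D(R)\<close> by the assumption on \<open>\<gamma>\<close>,
  it lies below the comparison function of the theorem, and \<open>V'(R) \<ge> exp (-C) f\<^sub>\<nu>(R)\<close>. Comparison first yields \<open>M(R) > V(R)\<close>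
  and then \<open>u \<le> V + M(R) - V(R)\<close> in \<open>D(R)\<close>, hence \<open>M(R) - M(R-h) \<ge> V(R) - V(R-h) \<ge> h V'(R)\<close>. The case \<open>\<nu> > 1\<close>
  follows from the case \<open>\<nu> = 1\<close>.
\<close>

section \<open>Smooth functions and bump functions\<close>

text \<open>Two obstacles shape the first half: \<open>u\<close> is a Sobolev function while the
  weak inequality admits only smooth test functions, and for p < 2 the flux of the touching function
  is singular at critical points. Since \<open>h\<close> vanishes on nonpositive numbers, strict
  touching alone localises the truncation, without cutoff terms. The mollification is removed before
  the regularisation, because integration by parts needs the regularised flux. In the second half
  the barrier parameter \<delta> buys strictness. The equation for V' absorbs the first order term
  exactly and leaves a slack D \<delta>, which has to pay for the curvature of the spheres r =
  const, at most of size n \<open>Lam R\<close> / \<gamma>(R). By the hypothesis on \<gamma> this is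
  of order D(R) exp(-I(R)), which dictates the size of \<delta>. As exp(I(R)) \<delta> = C, the
  price is a factor exp(-C) that does not depend on R. The variable r replaces the distinguished
  coordinate because its sublevel sets in the half-space are bounded.\<close>

lemma partial_eq:
  assumes "(f has_derivative f') (at x)"
  shows "partial i f x = f' (axis i 1)"
  using frechet_derivative_at[OF assms] by (simp add: partial_def)

lemma has_derivative_grad:
  fixes f :: "real^'n::finite \<Rightarrow> real"
  assumes "f differentiable (at x)"
  shows "(f has_derivative (\<lambda>h. grad f x \<bullet> h)) (at x)"
proof -
  let ?D = "frechet_derivative f (at x)"
  have D: "(f has_derivative ?D) (at x)" using assms frechet_derivative_works by blast
  interpret D: linear ?D using D has_derivative_linear by blast
  have "?D h = grad f x \<bullet> h" for h
  proof -
    have "?D h = ?D (\<Sum>i\<in>UNIV. h $ i *\<^sub>R axis i 1)"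
      by (simp add: basis_expansion[of h, unfolded scalar_mult_eq_scaleR])
    also have "\<dots> = grad f x \<bullet> h"
      by (simp add: D.sum D.scaleR grad_def partial_def inner_vec_def mult.commute)
    finally show ?thesis .
  qed
  then have "?D = (\<lambda>h. grad f x \<bullet> h)" by blast
  with D show ?thesis by simp
qed

lemma grad_eq:
  fixes f :: "real^'n::finite \<Rightarrow> real"
  assumes "(f has_derivative (\<lambda>h. G \<bullet> h)) (at x)"
  shows "grad f x = G"
  by (simp add: grad_def vec_eq_iff partial_eq[OF assms] inner_axis)

lemma partial_cong_open:
  assumes "open A" "x \<in> A" "\<And>y. y \<in> A \<Longrightarrow> f y = g y"
  shows "partial i f x = partial i g x"
proof -
  have "(f has_derivative D) (at x) = (g has_derivative D) (at x)" for D
    using has_derivative_transform_within_open[OF _ assms(1,2)] assms(3) by metis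
  then show ?thesis by (simp add: partial_def frechet_derivative_def)
qed

lemma grad_nth [simp]: "grad f x $ i = partial i f x"
  by (simp add: grad_def)

lemma partial_add:
  fixes f :: "real^'n::finite \<Rightarrow> real"
  assumes "f differentiable (at x)" "g differentiable (at x)"
  shows "partial i (\<lambda>x. f x + g x) x = partial i f x + partial i g x"
  by (subst partial_eq[OF has_derivative_add[OF has_derivative_grad[OF assms(1)] has_derivative_grad[OF assms(2)]]])
    (simp add: inner_axis)

lemma partial_mult:
  fixes f :: "real^'n::finite \<Rightarrow> real"
  assumes "f differentiable (at x)" "g differentiable (at x)"
  shows "partial i (\<lambda>x. f x * g x) x = partial i f x * g x + f x * partial i g x"
  by (subst partial_eq[OF has_derivative_mult[OF has_derivative_grad[OF assms(1)] has_derivative_grad[OF assms(2)]]])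
    (simp add: inner_axis)

lemma partial_const: "partial i (\<lambda>x. c) x = 0"
  by (subst partial_eq[OF has_derivative_const]) simp

definition smooth :: "(real^'n::finite \<Rightarrow> real) \<Rightarrow> bool"
  where "smooth f \<longleftrightarrow> (\<forall>m. C_on m UNIV f)"

lemma smooth_differentiable: "smooth f \<Longrightarrow> f differentiable (at x)"
  unfolding smooth_def using C_on.simps(2)[of 0 UNIV f] by blast

lemma smooth_partial: "smooth f \<Longrightarrow> smooth (partial i f)"
  unfolding smooth_def using C_on.simps(2)[of _ UNIV f] by blast

lemma smooth_cont: "smooth f \<Longrightarrow> continuous_on S f"
  unfolding smooth_def using C_on.simps(1)[of UNIV f] continuous_on_subset by blast

text \<open>The induction on the order runs over the whole family \<open>S\<close> at once. To prove
  smoothness it thus suffices to exhibit a family of differentiable functions that contains its own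
  partial derivatives; no formula for higher derivatives is needed.\<close>

lemma smooth_coinduct:
  assumes "f \<in> S"
    and diff: "\<And>f x. f \<in> S \<Longrightarrow> f differentiable (at x)"
    and part: "\<And>f i. f \<in> S \<Longrightarrow> partial i f \<in> S"
  shows "smooth f"
proof -
  have "\<forall>f\<in>S. C_on m UNIV f" for m
  proof (induction m)
    case 0
    then show ?case
      using diff by (auto intro!: continuous_at_imp_continuous_on differentiable_imp_continuous_within)
  qed (use diff part in auto)
  then show ?thesis using \<open>f \<in> S\<close> by (auto simp: smooth_def)
qed

text \<open>Product and chain rules lead out of a set of generators, but not out of the sums and
  products that it generates. This closure is the family fed into
  \<open>smooth_coinduct\<close>.\<close>

inductive_set fun_algebra :: "(real^'n::finite \<Rightarrow> real) set \<Rightarrow> (real^'n \<Rightarrow> real) set" for G where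
  base: "g \<in> G \<Longrightarrow> g \<in> fun_algebra G"
| add: "f \<in> fun_algebra G \<Longrightarrow> g \<in> fun_algebra G \<Longrightarrow> (\<lambda>x. f x + g x) \<in> fun_algebra G"
| mult: "f \<in> fun_algebra G \<Longrightarrow> g \<in> fun_algebra G \<Longrightarrow> (\<lambda>x. f x * g x) \<in> fun_algebra G"

text \<open>Closure under \<open>partial\<close> has to be checked on generators only, and their
  derivatives may be any elements of the algebra; the product rule does the rest.\<close>

lemma smooth_fun_algebra:
  assumes "f \<in> fun_algebra G"
    and diff: "\<And>g x. g \<in> G \<Longrightarrow> g differentiable (at x)"
    and part: "\<And>g i. g \<in> G \<Longrightarrow> partial i g \<in> fun_algebra G"
  shows "smooth f"
proof -
  have D: "g differentiable (at x)" if "g \<in> fun_algebra G" for g x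
    using that by induction (auto simp: diff)
  have "partial i g \<in> fun_algebra G" if "g \<in> fun_algebra G" for g i
    using that
  proof induction
    case (add f g)
    have "partial i (\<lambda>x. f x + g x) = (\<lambda>x. partial i f x + partial i g x)"
      using add D by (intro ext partial_add) auto
    then show ?case using add fun_algebra.add by simp
  next
    case (mult f g)
    have "partial i (\<lambda>x. f x * g x) = (\<lambda>x. partial i f x * g x + f x * partial i g x)"
      using mult D by (intro ext partial_mult) auto
    moreover have "(\<lambda>x. partial i f x * g x + f x * partial i g x) \<in> fun_algebra G"
      by (intro fun_algebra.add fun_algebra.mult mult)
    ultimately show ?case by simp
  qed (rule part)
  with D show ?thesis using smooth_coinduct[OF assms(1)] by blast
qed

lemma smooth_fun_algebra_smooth: "f \<in> fun_algebra (Collect smooth) \<Longrightarrow> smooth f"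
  by (erule smooth_fun_algebra) (auto intro: smooth_differentiable fun_algebra.base smooth_partial)

section \<open>Algebraic operations on smooth functions\<close>

lemma smooth_add: "smooth f \<Longrightarrow> smooth g \<Longrightarrow> smooth (\<lambda>x. f x + g x)"
  and smooth_mult: "smooth f \<Longrightarrow> smooth g \<Longrightarrow> smooth (\<lambda>x. f x * g x)"
  by (auto intro!: smooth_fun_algebra_smooth intro: fun_algebra.intros)

lemma smooth_const: "smooth (\<lambda>x. c)"
proof (rule smooth_coinduct[of _ "range (\<lambda>c x. c)"])
  show "partial i f \<in> range (\<lambda>c x. c)" if "f \<in> range (\<lambda>c x. c)" for f :: "real^'n \<Rightarrow> real" and i
  proof -
    have "partial i f = (\<lambda>x. 0)" using that by (auto simp: partial_const)
    then show ?thesis by blast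
  qed
qed auto

lemma smooth_sum: "finite I \<Longrightarrow> (\<And>i. i \<in> I \<Longrightarrow> smooth (f i)) \<Longrightarrow> smooth (\<lambda>x. \<Sum>i\<in>I. f i x)"
  by (induction I rule: finite_induct) (auto intro: smooth_const smooth_add)

lemma smooth_uminus: "smooth f \<Longrightarrow> smooth (\<lambda>x. - f x)"
  using smooth_mult[OF smooth_const[of "-1"]] by simp

lemma smooth_minus: "smooth f \<Longrightarrow> smooth g \<Longrightarrow> smooth (\<lambda>x. f x - g x)"
  using smooth_add[OF _ smooth_uminus] by simp

lemma partial_coord: "partial i (\<lambda>x. x $ j) x = (if i = j then 1 else 0)"
proof -
  have "((\<lambda>x. x $ j) has_derivative (\<lambda>h. h $ j)) (at x)"
    by (rule bounded_linear_imp_has_derivative) (rule bounded_linear_vec_nth)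
  from partial_eq[OF this] show ?thesis by (simp add: axis_def)
qed

lemma smooth_coord: "smooth (\<lambda>x::real^'n::finite. x $ j)"
proof (rule smooth_coinduct[of _ "insert (\<lambda>x. x $ j) (range (\<lambda>c x. c))"])
  show "partial i f \<in> insert (\<lambda>x. x $ j) (range (\<lambda>c x. c))"
    if "f \<in> insert (\<lambda>x. x $ j) (range (\<lambda>c x. c))" for f :: "real^'n \<Rightarrow> real" and i
  proof -
    have "partial i f = (\<lambda>x. if i = j then 1 else 0) \<or> partial i f = (\<lambda>x. 0)"
      using that partial_const partial_coord by blast
    then show ?thesis by blast
  qed
  show "f differentiable (at x)"
    if "f \<in> insert (\<lambda>x. x $ j) (range (\<lambda>c x. c))" for f :: "real^'n \<Rightarrow> real" and x
    using that by (auto intro: bounded_linear_imp_differentiable bounded_linear_vec_nth)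
qed auto

text \<open>\<open>flat_fun 0\<close> is the classical flat function exp(-1/t), extended by 0. The
  powers of 1/t make the family closed under differentiation up to linear combinations;
  \<open>flat_fun 2\<close> is the derivative of \<open>flat_fun 0\<close> and is positive exactly
  for t > 0.\<close>

definition flat_fun :: "nat \<Rightarrow> real \<Rightarrow> real"
  where "flat_fun k t = (if 0 < t then (1/t)^k * exp (-1/t) else 0)"

text \<open>At 0 the substitution s = 1/t turns the right difference quotient into s^(k+1) exp(-s),
  which tends to 0 as s grows; the left one is 0.\<close>

lemma flat_fun_deriv: "(flat_fun k has_real_derivative (flat_fun (k+2) t - real k * flat_fun (k+1) t)) (at t)"
proof -
  consider "t > 0" | "t < 0" | "t = 0" by linarith
  then show ?thesis
  proof cases
    case 1
    have "((\<lambda>t. (1/t)^k) has_real_derivative - real k * (1/t)^(k+1)) (at t)"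
    proof (cases k)
      case (Suc j)
      have "((\<lambda>t. 1/t) has_real_derivative - ((1/t)^2)) (at t)"
        using 1 by (auto intro!: derivative_eq_intros simp: power2_eq_square)
      from DERIV_power_Suc[OF this, of j] show ?thesis
        by (simp add: Suc power2_eq_square algebra_simps add_divide_distrib diff_divide_distrib)
    qed simp
    moreover have "((\<lambda>t. exp (-1/t)) has_real_derivative (1/t)^2 * exp (-1/t)) (at t)"
      using 1 by (auto intro!: derivative_eq_intros simp: power2_eq_square)
    ultimately have "((\<lambda>t. (1/t)^k * exp (-1/t)) has_real_derivative
        (- real k * (1/t)^(k+1)) * exp (-1/t) + ((1/t)^2 * exp (-1/t)) * (1/t)^k) (at t)"
      by (rule DERIV_mult)
    also have "(- real k * (1/t)^(k+1)) * exp (-1/t) + ((1/t)^2 * exp (-1/t)) * (1/t)^k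
        = flat_fun (k+2) t - real k * flat_fun (k+1) t"
      using 1 by (simp add: flat_fun_def power2_eq_square mult.commute mult.left_commute)
    finally have "((\<lambda>t. (1/t)^k * exp (-1/t)) has_real_derivative (flat_fun (k+2) t - real k * flat_fun (k+1) t)) (at t)" .
    then show ?thesis
      by (rule has_field_derivative_transform_within_open[where S="{0<..}"]) (use 1 in \<open>auto simp: flat_fun_def\<close>)
  next
    case 2
    have "((\<lambda>t. 0) has_real_derivative (flat_fun (k+2) t - real k * flat_fun (k+1) t)) (at t)"
      using 2 by (simp add: flat_fun_def)
    then show ?thesis
      by (rule has_field_derivative_transform_within_open[where S="{..<0}"]) (use 2 in \<open>auto simp: flat_fun_def\<close>)
  next
    case 3
    have r: "((\<lambda>h. flat_fun k h / h) \<longlongrightarrow> 0) (at_right 0)"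
    proof (rule Lim_transform_eventually)
      have "((\<lambda>x::real. x^(k+1) * exp (-x)) \<longlongrightarrow> 0) at_top"
        using tendsto_power_div_exp_0[of "k+1"] by (simp add: exp_minus divide_simps)
      then have "((\<lambda>x::real. (inverse x)^(k+1) * exp (-(inverse x))) \<longlongrightarrow> 0) (at_right 0)"
        using filterlim_inverse_at_top_right filterlim_compose by blast
      then show "((\<lambda>x::real. (1/x)^(k+1) * exp (-(1/x))) \<longlongrightarrow> 0) (at_right 0)" by (simp add: field_simps)
      show "\<forall>\<^sub>F x in at_right 0. (1/x)^(k+1) * exp (-(1/x)) = flat_fun k x / x"
        unfolding eventually_at_right_field by (rule exI[of _ 1]) (auto simp: flat_fun_def)
    qed
    have l: "((\<lambda>h. flat_fun k h / h) \<longlongrightarrow> 0) (at_left 0)"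
      by (rule Lim_transform_eventually[OF tendsto_const])
        (auto simp: eventually_at_left_field flat_fun_def intro!: exI[of _ "-1"])
    have "((\<lambda>h. flat_fun k h / h) \<longlongrightarrow> 0) (at 0)" using filterlim_split_at[OF l r] .
    then show ?thesis using 3 by (simp add: DERIV_def flat_fun_def)
  qed
qed

lemma flat_fun_nonneg: "0 \<le> flat_fun k t" by (simp add: flat_fun_def)

lemma partial_flat_fun:
  fixes U :: "real^'n::finite \<Rightarrow> real"
  assumes "U differentiable (at x)"
  shows "(\<lambda>x. flat_fun k (U x)) differentiable (at x)"
    and "partial i (\<lambda>x. flat_fun k (U x)) x = (flat_fun (k+2) (U x) - real k * flat_fun (k+1) (U x)) * partial i U x"
proof -
  have "((\<lambda>x. flat_fun k (U x)) has_derivative (\<lambda>h. (flat_fun (k+2) (U x) - real k * flat_fun (k+1) (U x)) * (grad U x \<bullet> h))) (at x)"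
    using has_derivative_compose[OF has_derivative_grad[OF assms] flat_fun_deriv[unfolded has_field_derivative_def]] .
  then show "(\<lambda>x. flat_fun k (U x)) differentiable (at x)"
    and "partial i (\<lambda>x. flat_fun k (U x)) x = (flat_fun (k+2) (U x) - real k * flat_fun (k+1) (U x)) * partial i U x"
    by (auto simp: partial_eq inner_axis differentiable_def)
qed

text \<open>The generators are all smooth functions together with all compositions
  \<open>flat_fun k (U x)\<close>; the chain rule expresses a derivative of a composition by two
  others and a partial derivative of \<open>U\<close>.\<close>

lemma smooth_flat_fun:
  assumes U: "smooth U"
  shows "smooth (\<lambda>x. flat_fun k (U x))"
proof -
  let ?G = "Collect smooth \<union> range (\<lambda>k x. flat_fun k (U x))"
  have b: "smooth f \<Longrightarrow> f \<in> fun_algebra ?G" "(\<lambda>x. flat_fun k (U x)) \<in> fun_algebra ?G" for f k by (auto intro: fun_algebra.base)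
  have "partial i (\<lambda>x. flat_fun k (U x)) \<in> fun_algebra ?G" for i k
  proof -
    have "partial i (\<lambda>x. flat_fun k (U x)) = (\<lambda>x. (flat_fun (k+2) (U x) + (- real k) * flat_fun (k+1) (U x)) * partial i U x)"
      using partial_flat_fun[OF smooth_differentiable[OF U]] by auto
    also have "\<dots> \<in> fun_algebra ?G" by (intro fun_algebra.add fun_algebra.mult b smooth_const smooth_partial U)
    finally show ?thesis .
  qed
  then show ?thesis
    using b by (intro smooth_fun_algebra[of _ ?G]) (auto intro: smooth_differentiable smooth_partial partial_flat_fun(1) U)
qed

text \<open>Needed for \<open>k = 2\<close>, the factor that the gradient of the truncation carries,
  in the dominating functions of the limit passage. Exponential decay settles large 1/t, the rest is
  a bounded power.\<close>

lemma flat_fun_bdd: "\<exists>B. \<forall>t. flat_fun k t \<le> B"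
proof -
  have "((\<lambda>x::real. x^k * exp (-x)) \<longlongrightarrow> 0) at_top"
    using tendsto_power_div_exp_0[of "k"] by (simp add: exp_minus divide_simps)
  then have "\<forall>\<^sub>F x::real in at_top. x^k * exp (-x) < 1" by (rule order_tendstoD) simp
  then obtain N where N: "x^k * exp (-x) < 1" if "x \<ge> N" for x :: real
    unfolding eventually_at_top_linorder by blast
  have "flat_fun k t \<le> max 1 (\<bar>N\<bar>^k)" for t
  proof (cases "0 < t")
    case True
    show ?thesis
    proof (cases "1/t \<ge> N")
      case True then show ?thesis using N[of "1/t"] by (auto simp: flat_fun_def)
    next
      case False
      then have "(1/t)^k \<le> \<bar>N\<bar>^k" using \<open>0 < t\<close> by (intro power_mono) auto
      then have "(1/t)^k * exp (-1/t) \<le> \<bar>N\<bar>^k * 1" using \<open>0 < t\<close> by (intro mult_mono) auto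
      then show ?thesis using \<open>0 < t\<close> by (auto simp: flat_fun_def)
    qed
  qed (auto simp: flat_fun_def)
  then show ?thesis by blast
qed

section \<open>Compactly supported test functions and the bump function\<close>

definition test_fun :: "(real^'n::finite \<Rightarrow> real) \<Rightarrow> bool"
  where "test_fun \<zeta> \<longleftrightarrow> smooth \<zeta> \<and> bounded {x. \<zeta> x \<noteq> 0}"

lemma test_function_iff:
  "test_function \<Omega> \<psi> \<longleftrightarrow> test_fun \<psi> \<and> closure {x. \<psi> x \<noteq> 0} \<subseteq> \<Omega>"
  by (auto simp: test_function_def test_fun_def smooth_def compact_eq_bounded_closed intro: bounded_subset[OF _ closure_subset])

lemma partial_zero_outside:
  assumes "x \<notin> closure {x. \<zeta> x \<noteq> 0}"
  shows "partial i \<zeta> x = 0"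
proof -
  have "partial i \<zeta> x = partial i (\<lambda>x. 0) x"
    by (rule partial_cong_open[of "- closure {x. \<zeta> x \<noteq> 0}"])
      (use assms closure_subset[of "{x. \<zeta> x \<noteq> 0}"] in auto)
  then show ?thesis by (simp add: partial_const)
qed

lemma test_fun_partial: "test_fun \<zeta> \<Longrightarrow> test_fun (partial i \<zeta>)"
  unfolding test_fun_def
proof safe
  assume "bounded {x. \<zeta> x \<noteq> 0}"
  then show "bounded {x. partial i \<zeta> x \<noteq> 0}"
    by (rule bounded_subset[OF bounded_closure]) (use partial_zero_outside in blast)
qed (rule smooth_partial)

lemma cont_cpt_supp_bdd:
  fixes \<zeta> :: "real^'n::finite \<Rightarrow> real"
  assumes cont: "continuous_on UNIV \<zeta>" and bd: "bounded {x. \<zeta> x \<noteq> 0}"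
  obtains B where "B > 0" "\<And>x. \<bar>\<zeta> x\<bar> \<le> B"
proof -
  let ?S = "closure {x. \<zeta> x \<noteq> 0}"
  have "compact ?S" using bounded_closure[OF bd] compact_eq_bounded_closed closed_closure by metis
  then have "compact (\<zeta> ` ?S)"
    by (rule compact_continuous_image[OF continuous_on_subset[OF cont subset_UNIV]])
  then have "bounded (\<zeta> ` ?S)" by (rule compact_imp_bounded)
  then obtain B where B: "B > 0" "\<forall>y\<in>\<zeta> ` ?S. norm y \<le> B"
    unfolding bounded_pos by blast
  have *: "\<bar>\<zeta> x\<bar> \<le> B" for x
  proof (cases "\<zeta> x = 0")
    case True
    then show ?thesis using B(1) by simp
  next
    case False
    then have "x \<in> ?S" using closure_subset[of "{x. \<zeta> x \<noteq> 0}"] by blast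
    then have "norm (\<zeta> x) \<le> B" using B(2) by blast
    then show ?thesis by simp
  qed
  show ?thesis by (rule that[OF B(1) *])
qed

lemma test_fun_bdd:
  assumes "test_fun \<zeta>"
  obtains B where "B > 0" "\<And>x. \<bar>\<zeta> x\<bar> \<le> B"
proof -
  have "continuous_on UNIV \<zeta>" "bounded {x. \<zeta> x \<noteq> 0}" using assms smooth_cont by (auto simp: test_fun_def)
  then show ?thesis by (rule cont_cpt_supp_bdd) (rule that)
qed

lemma grad_bound_lipschitz:
  fixes f :: "real^'n::finite \<Rightarrow> real"
  assumes "convex S" "\<And>x. x \<in> S \<Longrightarrow> f differentiable (at x)" "\<And>x. x \<in> S \<Longrightarrow> norm (grad f x) \<le> B"
    and "x \<in> S" "y \<in> S"
  shows "\<bar>f x - f y\<bar> \<le> B * norm (x - y)"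
proof -
  have "norm (f x - f y) \<le> B * norm (x - y)"
  proof (rule differentiable_bound[OF assms(1) _ _ assms(4,5), where f'="\<lambda>x h. grad f x \<bullet> h"])
    fix z assume z: "z \<in> S"
    show "(f has_derivative (\<bullet>) (grad f z)) (at z within S)"
      by (rule has_derivative_at_withinI[OF has_derivative_grad[OF assms(2)[OF z]]])
    show "onorm ((\<bullet>) (grad f z)) \<le> B"
    proof (rule onorm_bound)
      show "norm (grad f z \<bullet> h) \<le> B * norm h" for h
        using Cauchy_Schwarz_ineq2[of "grad f z" h] mult_right_mono[OF assms(3)[OF z] norm_ge_zero[of h]] by simp
      show "0 \<le> B" using assms(3)[OF z] norm_ge_zero[of "grad f z"] by linarith
    qed
  qed
  then show ?thesis by simp
qed

lemma test_fun_lipschitz: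
  assumes "test_fun (\<zeta> :: real^'n::finite \<Rightarrow> real)"
  obtains B where "B > 0" "\<And>x y. \<bar>\<zeta> x - \<zeta> y\<bar> \<le> B * norm (x - y)"
proof -
  have "\<exists>B. B > 0 \<and> (\<forall>x. \<bar>partial i \<zeta> x\<bar> \<le> B)" for i
    by (rule test_fun_bdd[OF test_fun_partial[OF assms, of i]]) blast
  then obtain B where B: "\<And>i. B i > 0 \<and> (\<forall>x. \<bar>partial i \<zeta> x\<bar> \<le> B i)" by metis
  have g: "norm (grad \<zeta> x) \<le> sum B UNIV" for x
  proof -
    have "(\<Sum>i\<in>UNIV. \<bar>grad \<zeta> x $ i\<bar>) \<le> sum B UNIV" using B by (intro sum_mono) simp
    then show ?thesis using norm_le_l1_cart[of "grad \<zeta> x"] by linarith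
  qed
  have d: "\<zeta> differentiable (at x)" for x by (rule smooth_differentiable) (use assms in \<open>simp add: test_fun_def\<close>)
  show ?thesis
  proof (rule that)
    show "0 < sum B UNIV" using B by (intro sum_pos) auto
    show "\<bar>\<zeta> x - \<zeta> y\<bar> \<le> sum B UNIV * norm (x - y)" for x y
      by (rule grad_bound_lipschitz[OF convex_UNIV d g]) auto
  qed
qed

text \<open>Written with the coordinates, so that smoothness is immediate from the closure
  properties; \<open>bump_alt\<close> recovers the norm.\<close>

definition bump :: "real \<Rightarrow> real^'n::finite \<Rightarrow> real"
  where "bump \<epsilon> x = flat_fun 0 (1 - (\<Sum>i\<in>UNIV. x $ i * x $ i) * (1/\<epsilon>^2))"

lemma bump_alt: "bump \<epsilon> x = flat_fun 0 (1 - (norm x / \<epsilon>)^2)"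
proof -
  have "(\<Sum>i\<in>UNIV. x $ i * x $ i) = (norm x)^2"
    unfolding power2_norm_eq_inner by (simp add: inner_vec_def)
  then show ?thesis by (simp add: bump_def power_divide)
qed

lemma bump_supp: "\<epsilon> > 0 \<Longrightarrow> bump \<epsilon> x \<noteq> 0 \<Longrightarrow> norm x < \<epsilon>"
  by (auto simp: bump_alt flat_fun_def abs_square_less_1 split: if_splits)

lemma smooth_bump: "smooth (bump \<epsilon>)"
  unfolding bump_def by (intro smooth_flat_fun smooth_minus smooth_mult smooth_sum smooth_const smooth_coord) simp

lemma test_fun_bump: "\<epsilon> > 0 \<Longrightarrow> test_fun (bump \<epsilon> :: real^'n::finite \<Rightarrow> real)"
proof -
  assume "\<epsilon> > 0"
  then have "{x. bump \<epsilon> x \<noteq> 0} \<subseteq> cball (0 :: real^'n) \<epsilon>"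
    by (auto dest: bump_supp[of \<epsilon>])
  then show ?thesis
    using bounded_subset[OF bounded_cball] by (simp add: test_fun_def smooth_bump)
qed

section \<open>Convolution and mollification\<close>

text \<open>The case \<open>c = 1\<close> gives translations and \<open>c = -1\<close> reflections,
  the two substitutions that occur in convolutions.\<close>

lemma lborel_affine1:
  fixes t :: "'a::euclidean_space"
  assumes "\<bar>c\<bar> = 1"
  shows "distr lborel borel (\<lambda>x. t + c *\<^sub>R x) = lborel"
  using lborel_affine[of c t] assms by (auto simp: density_1)

lemma
  fixes f :: "'a::euclidean_space \<Rightarrow> real"
  assumes c: "\<bar>c\<bar> = 1" and [measurable]: "f \<in> borel_measurable borel"
  shows integral_affine1: "(LINT x|lborel. f (t + c *\<^sub>R x)) = (LINT x|lborel. f x)"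
    and integrable_affine1: "integrable lborel (\<lambda>x. f (t + c *\<^sub>R x)) \<longleftrightarrow> integrable lborel f"
proof -
  have "(LINT x|lborel. f x) = (LINT x|distr lborel borel (\<lambda>x. t + c *\<^sub>R x). f x)"
    by (simp add: lborel_affine1[OF c])
  also have "\<dots> = (LINT x|lborel. f (t + c *\<^sub>R x))" by (subst integral_distr) auto
  finally show "(LINT x|lborel. f (t + c *\<^sub>R x)) = (LINT x|lborel. f x)" by simp
  have "integrable lborel f \<longleftrightarrow> integrable (distr lborel borel (\<lambda>x. t + c *\<^sub>R x)) f"
    by (simp add: lborel_affine1[OF c])
  also have "\<dots> \<longleftrightarrow> integrable lborel (\<lambda>x. f (t + c *\<^sub>R x))" by (subst integrable_distr_eq) auto
  finally show "integrable lborel (\<lambda>x. f (t + c *\<^sub>R x)) \<longleftrightarrow> integrable lborel f" by simp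
qed

lemma
  fixes f :: "'a::euclidean_space \<Rightarrow> real"
  assumes [measurable]: "f \<in> borel_measurable borel"
  shows integral_translate: "(LINT x|lborel. f (x - y)) = (LINT x|lborel. f x)"
    and integrable_translate: "integrable lborel (\<lambda>x. f (x - y)) \<longleftrightarrow> integrable lborel f"
    and integral_reflect: "(LINT y|lborel. f (x - y)) = (LINT x|lborel. f x)"
    and integrable_reflect: "integrable lborel (\<lambda>y. f (x - y)) \<longleftrightarrow> integrable lborel f"
  using integral_affine1[of 1 f "-y"] integrable_affine1[of 1 f "-y"]
    integral_affine1[of "-1" f x] integrable_affine1[of "-1" f x] by simp_all

text \<open>Inner regularity is applied to a finite measure, namely Lebesgue measure restricted to
  \<open>A\<close>, encoded as a density with the indicator of \<open>A\<close>.\<close>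

lemma inner_compact_lborel:
  fixes A :: "'a::euclidean_space set"
  assumes A[measurable]: "A \<in> sets borel" and fin: "emeasure lborel A < \<infinity>" and "e > 0"
  obtains K where "compact K" "K \<subseteq> A" "measure lborel (A - K) < e"
proof -
  let ?M = "density lborel (indicator A)"
  have em: "emeasure ?M B = emeasure lborel (A \<inter> B)" if "B \<in> sets borel" for B
    using that by (simp add: emeasure_density indicator_inter_arith[symmetric])
  have "emeasure ?M A = (SUP K\<in>{K. K \<subseteq> A \<and> compact K}. emeasure ?M K)"
    by (rule inner_regular) (use fin em[of UNIV] in auto)
  then have "emeasure lborel A = (SUP K\<in>{K. K \<subseteq> A \<and> compact K}. emeasure ?M K)"
    using em[of A] by simp
  then have "\<not> (\<forall>K\<in>{K. K \<subseteq> A \<and> compact K}. emeasure ?M K \<le> emeasure lborel A - ennreal e) \<or> emeasure lborel A = 0"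
  proof -
    assume sup: "emeasure lborel A = (SUP K\<in>{K. K \<subseteq> A \<and> compact K}. emeasure ?M K)"
    { assume a: "\<forall>K\<in>{K. K \<subseteq> A \<and> compact K}. emeasure ?M K \<le> emeasure lborel A - ennreal e" "emeasure lborel A \<noteq> 0"
      have "emeasure lborel A \<le> emeasure lborel A - ennreal e"
        by (subst sup, rule SUP_least) (use a(1) in blast)
      moreover have "emeasure lborel A - ennreal e < emeasure lborel A"
        using a fin \<open>e > 0\<close> by (intro ennreal_between) (auto simp: zero_less_iff_neq_zero)
      ultimately have False by simp }
    then show ?thesis by blast
  qed
  then show ?thesis
  proof
    assume "emeasure lborel A = 0"
    then show ?thesis using \<open>e > 0\<close> by (intro that[of "{}"]) (auto simp: measure_def)
  next
    assume "\<not> (\<forall>K\<in>{K. K \<subseteq> A \<and> compact K}. emeasure ?M K \<le> emeasure lborel A - ennreal e)"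
    then obtain K where K: "K \<subseteq> A" "compact K" "emeasure lborel A - ennreal e < emeasure ?M K" by (auto simp: not_le)
    have [measurable]: "K \<in> sets borel" using K by (simp add: borel_compact)
    have "emeasure ?M K = emeasure lborel K" using em[of K] K by (simp add: Int_absorb1)
    moreover have KA: "emeasure lborel K \<le> emeasure lborel A" using K by (intro emeasure_mono) auto
    have fK: "emeasure lborel K < \<infinity>" by (rule le_less_trans[OF KA fin])
    moreover have "emeasure lborel A = ennreal (measure lborel A)" "emeasure lborel K = ennreal (measure lborel K)"
      using fin fK by (auto simp: emeasure_eq_ennreal_measure)
    ultimately have "ennreal (measure lborel A) - ennreal e < ennreal (measure lborel K)" using K(3) by simp
    then have "measure lborel A - e < measure lborel K"
      using \<open>e > 0\<close> ennreal_leI[of "measure lborel K" "measure lborel A - e"]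
      by (auto simp: ennreal_minus not_le[symmetric])
    moreover have "measure lborel (A - K) = measure lborel A - measure lborel K"
      using K fin by (intro measure_Diff) auto
    ultimately show ?thesis using K that by simp
  qed
qed

text \<open>Induction over integrable functions. For a set of finite measure, enclose it between a
  compact \<open>K\<close> and an open \<open>U\<close> of almost the same measure: a small
  translation keeps \<open>K\<close> inside \<open>U\<close>. Sums and limits only cost the triangle
  inequality.\<close>

lemma L1_translation_continuous:
  fixes f :: "'a::euclidean_space \<Rightarrow> real"
  assumes "integrable lborel f"
  shows "\<forall>e>0. \<exists>d>0. \<forall>y. norm y < d \<longrightarrow> (LINT x|lborel. \<bar>f (x - y) - f x\<bar>) < e"
  using assms
proof (induction rule: integrable_induct)
  case (base A c)
  then have A[measurable]: "A \<in> sets borel" by simp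
  show ?case
  proof (intro allI impI)
    fix e :: real assume "e > 0"
    \<comment> \<open>The estimate below ends with |c| times 4 e', which has to stay below e; adding
      1 covers c = 0.\<close>
    define e' where "e' = e / (4 * (\<bar>c\<bar> + 1))"
    have e': "e' > 0" using \<open>e > 0\<close> by (simp add: e'_def)
    obtain K where K: "compact K" "K \<subseteq> A" "measure lborel (A - K) < e'"
      using inner_compact_lborel[OF A base(2) e'] by blast
    obtain U where U: "open U" "A \<subseteq> U" "emeasure lborel (U - A) < ennreal e'"
      using outer_regular_lborel[OF A e'] by blast
    have [measurable]: "U \<in> sets borel" "K \<in> sets borel" using U(1) K(1) by (auto simp: borel_compact)
    obtain d where d: "d > 0" "\<And>x. x \<in> K \<Longrightarrow> ball x d \<subseteq> U"
      using compact_subset_open_imp_ball_epsilon_subset[OF K(1) U(1)] K(2) U(2)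
      by (metis UN_subset_iff order_trans)
    have fUA: "emeasure lborel (U - A) < \<infinity>" by (rule less_trans[OF U(3)]) simp
    have "emeasure lborel U = emeasure lborel A + emeasure lborel (U - A)"
      using U(2) by (subst plus_emeasure) (auto simp: Un_absorb1)
    then have fU: "emeasure lborel U < \<infinity>" using base(2) fUA by simp
    have mU: "measure lborel (U - A) < e'"
      using U(3) fUA e' by (subst (asm) emeasure_eq_ennreal_measure) (auto simp: ennreal_less_iff)
    have mUA: "measure lborel (U - A) = measure lborel U - measure lborel A"
      using U base fU by (intro measure_Diff) auto
    have fAK: "emeasure lborel (A - K) < \<infinity>"
      by (rule le_less_trans[OF emeasure_mono[of _ A] base(2)]) auto
    have "(LINT x|lborel. \<bar>indicator A (x - y) *\<^sub>R c - indicator A x *\<^sub>R c\<bar>) < e" if y: "norm y < d" for y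
    proof -
      have i: "integrable lborel (\<lambda>x. indicator B (x - y) :: real)" "(LINT x|lborel. indicator B (x - y)) = measure lborel B"
        if [measurable]: "B \<in> sets borel" and "emeasure lborel B < \<infinity>" for B
        using that integrable_translate[of "indicator B" y] integral_translate[of "indicator B" y] by auto
      \<comment> \<open>The majorant counts a point of exactly one of the two copies of
        \<open>A\<close> at least once. If x - y lies in \<open>K\<close> then x lies in
        \<open>U\<close>; otherwise x - y is charged to \<open>A - K\<close>. Its integral is |c|
        times twice the measures of \<open>U - A\<close> and \<open>A - K\<close>.\<close>
      have "(LINT x|lborel. \<bar>indicator A (x - y) *\<^sub>R c - indicator A x *\<^sub>R c\<bar>)
          \<le> (LINT x|lborel. \<bar>c\<bar> * (2 * indicator U x + 2 * indicator (A - K) (x - y) - indicator A (x - y) - indicator A x))"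
      proof (rule integral_mono')
        show "integrable lborel (\<lambda>x. \<bar>c\<bar> * (2 * indicator U x + 2 * indicator (A - K) (x - y) - indicator A (x - y) - indicator A x))"
          using i[OF A base(2)] i[of "A - K"] fAK fU base(2)
          by (auto intro!: integrable_mult_right Bochner_Integration.integrable_diff Bochner_Integration.integrable_add)
        show pw: "\<bar>indicator A (x - y) *\<^sub>R c - indicator A x *\<^sub>R c\<bar> \<le>
          \<bar>c\<bar> * (2 * indicator U x + 2 * indicator (A - K) (x - y) - indicator A (x - y) - indicator A x)" for x
        proof -
          have "x \<in> U" if "x - y \<in> K" using d(2)[OF that] y by (auto simp: dist_norm)
          then show ?thesis using U(2) by (auto split: split_indicator)
        qed
        show "0 \<le> \<bar>c\<bar> * (2 * indicator U x + 2 * indicator (A - K) (x - y) - indicator A (x - y) - indicator A x)" for x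
          by (rule order_trans[OF abs_ge_zero pw])
      qed
      also have "\<dots> = \<bar>c\<bar> * (2 * measure lborel U + 2 * measure lborel (A - K) - measure lborel A - measure lborel A)"
        using i[OF A base(2)] i[of "A - K"] fAK fU base(2) by simp
      also have "\<dots> \<le> \<bar>c\<bar> * (4 * e')" using mU mUA K(3) by (intro mult_left_mono) auto
      also have "\<dots> < e" using \<open>e > 0\<close> by (simp add: e'_def field_simps)
      finally show ?thesis .
    qed
    then show "\<exists>d>0. \<forall>y. norm y < d \<longrightarrow> (LINT x|lborel. \<bar>indicator A (x - y) *\<^sub>R c - indicator A x *\<^sub>R c\<bar>) < e"
      using d(1) by blast
  qed
next
  case (add f g)
  have [measurable]: "f \<in> borel_measurable borel" "g \<in> borel_measurable borel"
    using add.hyps(1,2) by (auto dest: borel_measurable_integrable)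
  show ?case
  proof (intro allI impI)
    fix e :: real assume e: "e > 0"
    obtain d1 d2 where d: "d1 > 0" "\<forall>y. norm y < d1 \<longrightarrow> (LINT x|lborel. \<bar>f (x - y) - f x\<bar>) < e/2"
      "d2 > 0" "\<forall>y. norm y < d2 \<longrightarrow> (LINT x|lborel. \<bar>g (x - y) - g x\<bar>) < e/2"
      using add.IH(1)[rule_format, OF half_gt_zero[OF e]] add.IH(2)[rule_format, OF half_gt_zero[OF e]] by auto
    have "(LINT x|lborel. \<bar>f (x - y) + g (x - y) - (f x + g x)\<bar>) < e" if "norm y < min d1 d2" for y
    proof -
      have "(LINT x|lborel. \<bar>f (x - y) + g (x - y) - (f x + g x)\<bar>)
        \<le> (LINT x|lborel. \<bar>f (x - y) - f x\<bar> + \<bar>g (x - y) - g x\<bar>)"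
        using add.hyps(1,2) by (intro integral_mono) (auto simp: integrable_translate)
      also have "\<dots> = (LINT x|lborel. \<bar>f (x - y) - f x\<bar>) + (LINT x|lborel. \<bar>g (x - y) - g x\<bar>)"
        using add.hyps(1,2) by (intro Bochner_Integration.integral_add) (auto simp: integrable_translate)
      also have "\<dots> < e" using d that by force
      finally show ?thesis .
    qed
    then show "\<exists>d>0. \<forall>y. norm y < d \<longrightarrow> (LINT x|lborel. \<bar>f (x - y) + g (x - y) - (f x + g x)\<bar>) < e"
      using d by (intro exI[of _ "min d1 d2"]) auto
  qed
next
  case (lim f s)
  have [measurable]: "f \<in> borel_measurable borel" "\<And>i. s i \<in> borel_measurable borel"
    using lim.hyps(1,4) by (auto dest: borel_measurable_integrable)
  \<comment> \<open>The approximants of the induction scheme satisfy |s i| <= 2 |f|, whence the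
    dominating function 3 |f|.\<close>
  have convolve: "(\<lambda>i. LINT x|lborel. \<bar>s i x - f x\<bar>) \<longlonglongrightarrow> (LINT x|(lborel :: 'a measure). 0)"
  proof (rule integral_dominated_convergence[where w="\<lambda>x. 3 * \<bar>f x\<bar>"])
    show "AE x in lborel. (\<lambda>i. \<bar>s i x - f x\<bar>) \<longlonglongrightarrow> 0"
      using lim.hyps(2) by (auto intro!: tendsto_rabs_zero LIM_zero)
    show "AE x in lborel. norm \<bar>s i x - f x\<bar> \<le> 3 * \<bar>f x\<bar>" for i
    proof (rule AE_I2)
      fix x show "norm \<bar>s i x - f x\<bar> \<le> 3 * \<bar>f x\<bar>" using lim.hyps(3)[of x i] by simp
    qed
  qed (use lim.hyps(4) in auto)
  show ?case
  proof (intro allI impI)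
    fix e :: real assume e: "e > 0"
    then have "\<forall>\<^sub>F i in sequentially. (LINT x|lborel. \<bar>s i x - f x\<bar>) < e/3"
      using order_tendstoD(2)[OF convolve, of "e/3"] by simp
    then obtain i where i: "(LINT x|lborel. \<bar>s i x - f x\<bar>) < e/3" by (auto simp: eventually_sequentially)
    have "e/3 > 0" using e by simp
    from lim.IH[of i, rule_format, OF this]
    obtain d where d: "d > 0" "\<forall>y. norm y < d \<longrightarrow> (LINT x|lborel. \<bar>s i (x - y) - s i x\<bar>) < e/3"
      by blast
    have "(LINT x|lborel. \<bar>f (x - y) - f x\<bar>) < e" if y: "norm y < d" for y
    proof -
      have 1: "integrable lborel (\<lambda>x. \<bar>s i (x - y) - f (x - y)\<bar>)"
        using lim.hyps(1,4) integrable_translate[of "\<lambda>x. \<bar>s i x - f x\<bar>" y] by simp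
      have 2: "(LINT x|lborel. \<bar>s i (x - y) - f (x - y)\<bar>) = (LINT x|lborel. \<bar>s i x - f x\<bar>)"
        using integral_translate[of "\<lambda>x. \<bar>s i x - f x\<bar>" y] by simp
      have 3: "integrable lborel (\<lambda>x. \<bar>s i (x - y) - s i x\<bar>)"
        using lim.hyps(1) by (simp add: integrable_translate)
      have 4: "integrable lborel (\<lambda>x. \<bar>s i x - f x\<bar>)" using lim.hyps(1,4) by simp
      have "(LINT x|lborel. \<bar>f (x - y) - f x\<bar>)
        \<le> (LINT x|lborel. \<bar>s i (x - y) - f (x - y)\<bar> + \<bar>s i (x - y) - s i x\<bar> + \<bar>s i x - f x\<bar>)"
        using 1 3 4 lim.hyps(4) by (intro integral_mono) (auto simp: integrable_translate)
      also have "\<dots> = (LINT x|lborel. \<bar>s i (x - y) - f (x - y)\<bar>) + (LINT x|lborel. \<bar>s i (x - y) - s i x\<bar>) + (LINT x|lborel. \<bar>s i x - f x\<bar>)"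
        using 1 3 4 by simp
      also have "\<dots> < e" using d y i 2 by force
      finally show ?thesis .
    qed
    then show "\<exists>d>0. \<forall>y. norm y < d \<longrightarrow> (LINT x|lborel. \<bar>f (x - y) - f x\<bar>) < e" using d(1) by blast
  qed
qed


section \<open>Convolution with test functions: derivatives and convergence in L1\<close>

definition convolve :: "(real^'n::finite \<Rightarrow> real) \<Rightarrow> (real^'n \<Rightarrow> real) \<Rightarrow> real^'n \<Rightarrow> real"
  where "convolve f \<zeta> x = (LINT y|lborel. f y * \<zeta> (x - y))"

lemma test_fun_borel [measurable_dest]: "test_fun \<zeta> \<Longrightarrow> \<zeta> \<in> borel_measurable borel"
  by (rule borel_measurable_continuous_onI) (simp add: test_fun_def smooth_cont)

lemma smooth_borel: "smooth \<zeta> \<Longrightarrow> \<zeta> \<in> borel_measurable borel"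
  by (rule borel_measurable_continuous_onI) (simp add: smooth_cont)

lemma convolve_integrable:
  assumes f: "integrable lborel f" and \<zeta>: "test_fun \<zeta>"
  shows "integrable lborel (\<lambda>y. f y * \<zeta> (x - y))"
proof -
  have [measurable]: "f \<in> borel_measurable borel" "\<zeta> \<in> borel_measurable borel"
    using f \<zeta> by (auto dest: borel_measurable_integrable test_fun_borel)
  obtain B where B: "B > 0" "\<And>x. \<bar>\<zeta> x\<bar> \<le> B" using test_fun_bdd[OF \<zeta>] by blast
  show ?thesis
  proof (rule Bochner_Integration.integrable_bound[of _ "\<lambda>y. B * f y"])
    show "AE y in lborel. norm (f y * \<zeta> (x - y)) \<le> norm (B * f y)"
      using B by (auto simp: abs_mult mult.commute[of "\<bar>f _\<bar>"] intro!: mult_right_mono)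
  qed (use f in auto)
qed

text \<open>The partial derivatives of \<open>\<zeta>\<close> are Lipschitz, so its first order
  Taylor remainder is at most C |h|^2, uniformly in the base point. Integrating this against |f|
  gives a quadratic remainder for the convolution, which is differentiability without any limit
  under the integral.\<close>

lemma convolve_has_derivative:
  assumes f: "integrable lborel f" and \<zeta>: "test_fun \<zeta>"
  shows "(convolve f \<zeta> has_derivative (\<lambda>h. (\<chi> i. convolve f (partial i \<zeta>) x) \<bullet> h)) (at x)"
proof -
  have "\<exists>B. B > 0 \<and> (\<forall>x y. \<bar>partial i \<zeta> x - partial i \<zeta> y\<bar> \<le> B * norm (x - y))" for i
    by (rule test_fun_lipschitz[OF test_fun_partial[OF \<zeta>, of i]]) blast
  then obtain B where B: "\<And>i. B i > 0 \<and> (\<forall>x y. \<bar>partial i \<zeta> x - partial i \<zeta> y\<bar> \<le> B i * norm (x - y))" by metis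
  define C where "C = sum B UNIV"
  have C: "C \<ge> 0" unfolding C_def using B by (intro sum_nonneg) (auto intro: less_imp_le)
  have gl: "norm (grad \<zeta> w - grad \<zeta> z) \<le> C * norm (w - z)" for w z
  proof -
    have "(\<Sum>i\<in>UNIV. \<bar>(grad \<zeta> w - grad \<zeta> z) $ i\<bar>) \<le> (\<Sum>i\<in>UNIV. B i * norm (w - z))"
      using B by (intro sum_mono) simp
    then show ?thesis using norm_le_l1_cart[of "grad \<zeta> w - grad \<zeta> z"] by (simp add: C_def sum_distrib_right)
  qed
  have rem: "\<bar>\<zeta> (z + h) - \<zeta> z - grad \<zeta> z \<bullet> h\<bar> \<le> C * norm h * norm h" for z h
  proof -
    let ?g = "\<lambda>w. \<zeta> w - grad \<zeta> z \<bullet> w"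
    have hd: "(?g has_derivative (\<lambda>k. (grad \<zeta> w - grad \<zeta> z) \<bullet> k)) (at w)" for w
    proof -
      have "(?g has_derivative (\<lambda>k. grad \<zeta> w \<bullet> k - grad \<zeta> z \<bullet> k)) (at w)"
        using \<zeta> by (intro has_derivative_diff has_derivative_grad smooth_differentiable
            bounded_linear_imp_has_derivative bounded_linear_inner_right) (simp add: test_fun_def)
      then show ?thesis by (simp add: inner_diff_left)
    qed
    have "\<bar>?g (z + h) - ?g z\<bar> \<le> (C * norm h) * norm (z + h - z)"
    proof (rule grad_bound_lipschitz[of "cball z (norm h)"])
      fix w assume "w \<in> cball z (norm h)"
      then have "norm (w - z) \<le> norm h" by (simp add: dist_norm norm_minus_commute)
      then show "norm (grad ?g w) \<le> C * norm h"
        using gl[of w z] C mult_left_mono[of "norm (w - z)" "norm h" C] by (simp add: grad_eq[OF hd])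
    qed (use hd in \<open>auto simp: differentiable_def dist_norm\<close>)
    then show ?thesis by (simp add: inner_simps algebra_simps)
  qed
  \<comment> \<open>The summand 1 only makes \<open>D\<close> positive, so that the radius e / D
    below is meaningful.\<close>
  define D where "D = C * (LINT y|lborel. \<bar>f y\<bar>) + 1"
  have D: "D > 0" using C unfolding D_def by (intro add_nonneg_pos mult_nonneg_nonneg integral_nonneg_AE) auto
  have main: "\<bar>convolve f \<zeta> w - convolve f \<zeta> x - (\<chi> i. convolve f (partial i \<zeta>) x) \<bullet> (w - x)\<bar> \<le> D * norm (w - x) * norm (w - x)" for w
  proof -
    let ?h = "w - x"
    have ip: "integrable lborel (\<lambda>y. f y * partial i \<zeta> (x - y))" for i
      by (rule convolve_integrable[OF f test_fun_partial[OF \<zeta>]])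
    have i1: "integrable lborel (\<lambda>y. f y * (grad \<zeta> (x - y) \<bullet> ?h))"
      and i2: "(\<chi> i. convolve f (partial i \<zeta>) x) \<bullet> ?h = (LINT y|lborel. f y * (grad \<zeta> (x - y) \<bullet> ?h))"
    proof -
      have e: "f y * (grad \<zeta> (x - y) \<bullet> ?h) = (\<Sum>i\<in>UNIV. (f y * partial i \<zeta> (x - y)) * ?h $ i)" for y
        by (simp add: inner_vec_def sum_distrib_left mult.assoc)
      show "integrable lborel (\<lambda>y. f y * (grad \<zeta> (x - y) \<bullet> ?h))" unfolding e
        by (intro Bochner_Integration.integrable_sum integrable_mult_left ip)
      show "(\<chi> i. convolve f (partial i \<zeta>) x) \<bullet> ?h = (LINT y|lborel. f y * (grad \<zeta> (x - y) \<bullet> ?h))"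
        unfolding e by (subst Bochner_Integration.integral_sum) (auto simp: ip convolve_def inner_vec_def)
    qed
    have "convolve f \<zeta> w - convolve f \<zeta> x - (\<chi> i. convolve f (partial i \<zeta>) x) \<bullet> ?h
      = (LINT y|lborel. f y * \<zeta> (w - y) - f y * \<zeta> (x - y) - f y * (grad \<zeta> (x - y) \<bullet> ?h))"
      unfolding i2 unfolding convolve_def using convolve_integrable[OF f \<zeta>] i1 by simp
    also have "\<bar>\<dots>\<bar> \<le> (LINT y|lborel. \<bar>f y\<bar> * (C * norm ?h * norm ?h))"
    proof -
      have "norm (LINT y|lborel. f y * \<zeta> (w - y) - f y * \<zeta> (x - y) - f y * (grad \<zeta> (x - y) \<bullet> ?h))
        \<le> (LINT y|lborel. \<bar>f y\<bar> * (C * norm ?h * norm ?h))"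
      proof (rule Bochner_Integration.integral_norm_bound_integral)
        show "norm (f y * \<zeta> (w - y) - f y * \<zeta> (x - y) - f y * (grad \<zeta> (x - y) \<bullet> ?h)) \<le> \<bar>f y\<bar> * (C * norm ?h * norm ?h)" for y
        proof -
          have "f y * \<zeta> (w - y) - f y * \<zeta> (x - y) - f y * (grad \<zeta> (x - y) \<bullet> ?h)
            = f y * (\<zeta> (x - y + ?h) - \<zeta> (x - y) - grad \<zeta> (x - y) \<bullet> ?h)" by (simp add: algebra_simps)
          then show ?thesis using rem[of "x - y" ?h] by (simp add: abs_mult mult_left_mono)
        qed
      qed (use f i1 convolve_integrable[OF f \<zeta>] in auto)
      then show ?thesis by simp
    qed
    also have "\<dots> = (C * (LINT y|lborel. \<bar>f y\<bar>)) * (norm ?h * norm ?h)" by simp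
    also have "\<dots> \<le> D * (norm ?h * norm ?h)" unfolding D_def by (intro mult_right_mono) auto
    finally show ?thesis by (simp add: mult.assoc)
  qed
  show ?thesis
  proof (subst has_derivative_at_alt, intro conjI allI impI)
    show "bounded_linear ((\<bullet>) (\<chi> i. convolve f (partial i \<zeta>) x))" by (rule bounded_linear_inner_right)
    fix e :: real assume "e > 0"
    show "\<exists>d>0. \<forall>y. norm (y - x) < d \<longrightarrow>
        norm (convolve f \<zeta> y - convolve f \<zeta> x - (\<chi> i. convolve f (partial i \<zeta>) x) \<bullet> (y - x)) \<le> e * norm (y - x)"
    proof (intro exI[of _ "e / D"] conjI allI impI)
      show "e / D > 0" using \<open>e > 0\<close> D by simp
      fix y assume "norm (y - x) < e / D"
      then have "D * norm (y - x) \<le> e" using D by (simp add: field_simps)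
      then have "D * norm (y - x) * norm (y - x) \<le> e * norm (y - x)" by (rule mult_right_mono) simp
      then show "norm (convolve f \<zeta> y - convolve f \<zeta> x - (\<chi> i. convolve f (partial i \<zeta>) x) \<bullet> (y - x)) \<le> e * norm (y - x)"
        using main[of y] by simp
    qed
  qed
qed

lemma partial_convolve:
  assumes "integrable lborel f" and "test_fun \<zeta>"
  shows "partial i (convolve f \<zeta>) = convolve f (partial i \<zeta>)"
  by (rule ext, subst partial_eq[OF convolve_has_derivative[OF assms]]) (simp add: inner_axis)

lemma smooth_convolve:
  assumes f: "integrable lborel f" and "test_fun \<zeta>"
  shows "smooth (convolve f \<zeta>)"
proof (rule smooth_coinduct[of _ "convolve f ` Collect test_fun"])
  show "g differentiable (at x)" if "g \<in> convolve f ` Collect test_fun" for g x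
    using that convolve_has_derivative[OF f] by (auto simp: differentiable_def)
  show "partial i g \<in> convolve f ` Collect test_fun" if "g \<in> convolve f ` Collect test_fun" for g i
    using that by (auto simp: partial_convolve[OF f] intro: test_fun_partial)
qed (use assms in auto)

lemma convolve_commute:
  assumes f: "f \<in> borel_measurable borel" and \<zeta>: "test_fun \<zeta>"
  shows "convolve f \<zeta> x = (LINT y|lborel. f (x - y) * \<zeta> y)"
proof -
  have [measurable]: "f \<in> borel_measurable borel" "\<zeta> \<in> borel_measurable borel" using f \<zeta> by (auto intro: test_fun_borel)
  show ?thesis
    using integral_reflect[of "\<lambda>y. f (x - y) * \<zeta> y" x] by (simp add: convolve_def)
qed

text \<open>\<open>convolve f \<zeta> - f\<close> is the average of the differences f(x - y) - f(x)
  with weight \<open>\<zeta>\<close>, so its L1 norm is at most the average of their L1 norms.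
  Working with nonnegative integrals lets Tonelli's theorem yield integrability as well.\<close>

lemma L1_mollify:
  assumes f: "integrable lborel f" and \<zeta>: "test_fun \<zeta>" "\<And>x. 0 \<le> \<zeta> x" "(LINT x|lborel. \<zeta> x) = 1" "\<And>x. d \<le> norm x \<Longrightarrow> \<zeta> x = 0"
    and e: "\<And>y. norm y < d \<Longrightarrow> (LINT x|lborel. \<bar>f (x - y) - f x\<bar>) \<le> e" "e \<ge> 0"
  shows "integrable lborel (convolve f \<zeta>)" "(LINT x|lborel. \<bar>convolve f \<zeta> x - f x\<bar>) \<le> e"
proof -
  have [measurable]: "f \<in> borel_measurable borel" "\<zeta> \<in> borel_measurable borel" "convolve f \<zeta> \<in> borel_measurable borel"
    using f \<zeta> by (auto intro: test_fun_borel smooth_borel smooth_convolve dest: borel_measurable_integrable)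
  have \<zeta>i: "integrable lborel \<zeta>" using not_integrable_integral_eq[of lborel \<zeta>] \<zeta>(3) by (cases "integrable lborel \<zeta>") auto
  have \<zeta>n: "(\<integral>\<^sup>+y. ennreal (\<zeta> y) \<partial>lborel) = 1"
    using nn_integral_eq_integral[OF \<zeta>i] \<zeta> by simp
  have pt: "ennreal \<bar>convolve f \<zeta> x - f x\<bar> \<le> (\<integral>\<^sup>+y. ennreal (\<bar>f (x - y) - f x\<bar> * \<zeta> y) \<partial>lborel)" for x
  proof -
    have i1: "integrable lborel (\<lambda>y. f (x - y) * \<zeta> y)"
      using integrable_reflect[of "\<lambda>y. f y * \<zeta> (x - y)" x] convolve_integrable[OF f \<zeta>(1)] by simp
    have i2: "integrable lborel (\<lambda>y. f x * \<zeta> y)" using \<zeta>i by simp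
    have "convolve f \<zeta> x - f x = (LINT y|lborel. f (x - y) * \<zeta> y) - (LINT y|lborel. f x * \<zeta> y)"
      using \<zeta> by (subst convolve_commute) auto
    also have "\<dots> = (LINT y|lborel. (f (x - y) - f x) * \<zeta> y)"
      using i1 i2 by (simp add: left_diff_distrib)
    finally have eq: "convolve f \<zeta> x - f x = (LINT y|lborel. (f (x - y) - f x) * \<zeta> y)" .
    have "ennreal (norm (LINT y|lborel. (f (x - y) - f x) * \<zeta> y)) \<le> (\<integral>\<^sup>+y. ennreal (norm ((f (x - y) - f x) * \<zeta> y)) \<partial>lborel)"
      using i1 i2 by (intro integral_norm_bound_ennreal) (simp add: left_diff_distrib)
    then show ?thesis using \<zeta>(2) by (simp add: eq abs_mult)
  qed
  have "(\<integral>\<^sup>+x. ennreal \<bar>convolve f \<zeta> x - f x\<bar> \<partial>lborel) \<le> (\<integral>\<^sup>+x. (\<integral>\<^sup>+y. ennreal (\<bar>f (x - y) - f x\<bar> * \<zeta> y) \<partial>lborel) \<partial>lborel)"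
    by (intro nn_integral_mono pt)
  also have "\<dots> = (\<integral>\<^sup>+y. (\<integral>\<^sup>+x. ennreal (\<bar>f (x - y) - f x\<bar> * \<zeta> y) \<partial>lborel) \<partial>lborel)"
    by (rule lborel_pair.Fubini') simp
  also have "\<dots> \<le> (\<integral>\<^sup>+y. ennreal e * ennreal (\<zeta> y) \<partial>lborel)"
  proof (rule nn_integral_mono)
    fix y :: "real^'a"
    show "(\<integral>\<^sup>+x. ennreal (\<bar>f (x - y) - f x\<bar> * \<zeta> y) \<partial>lborel) \<le> ennreal e * ennreal (\<zeta> y)"
    proof (cases "norm y < d")
      case True
      have "(\<integral>\<^sup>+x. ennreal (\<bar>f (x - y) - f x\<bar> * \<zeta> y) \<partial>lborel) = (\<integral>\<^sup>+x. ennreal \<bar>f (x - y) - f x\<bar> \<partial>lborel) * ennreal (\<zeta> y)"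
        using \<zeta>(2)[of y] by (simp add: ennreal_mult nn_integral_multc)
      also have "(\<integral>\<^sup>+x. ennreal \<bar>f (x - y) - f x\<bar> \<partial>lborel) = ennreal (LINT x|lborel. \<bar>f (x - y) - f x\<bar>)"
        using f by (intro nn_integral_eq_integral) (auto simp: integrable_translate)
      also have "\<dots> * ennreal (\<zeta> y) \<le> ennreal e * ennreal (\<zeta> y)"
        using e(1)[OF True] by (intro mult_right_mono) (auto intro: ennreal_leI)
      finally show ?thesis .
    qed (simp add: \<zeta>(4))
  qed
  also have "\<dots> = ennreal e" using \<zeta>n by (simp add: nn_integral_cmult)
  finally have b: "(\<integral>\<^sup>+x. ennreal \<bar>convolve f \<zeta> x - f x\<bar> \<partial>lborel) \<le> ennreal e" .
  have i: "integrable lborel (\<lambda>x. convolve f \<zeta> x - f x)"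
    by (rule integrableI_bounded) (use b le_less_trans in \<open>auto simp: less_top[symmetric] top_unique\<close>)
  then show "integrable lborel (convolve f \<zeta>)" using Bochner_Integration.integrable_add[OF i f] by simp
  have "ennreal (LINT x|lborel. \<bar>convolve f \<zeta> x - f x\<bar>) \<le> ennreal e"
    using b i nn_integral_eq_integral[of lborel "\<lambda>x. \<bar>convolve f \<zeta> x - f x\<bar>"] by simp
  then show "(LINT x|lborel. \<bar>convolve f \<zeta> x - f x\<bar>) \<le> e" using e(2) by simp
qed

section \<open>The standard mollifiers\<close>

definition mollifier :: "real \<Rightarrow> real^'n::finite \<Rightarrow> real"
  where "mollifier \<epsilon> x = bump \<epsilon> x / (LINT y|lborel. bump \<epsilon> (y :: real^'n))"

lemma bump_le1: "0 \<le> bump \<epsilon> x" "bump \<epsilon> x \<le> 1"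
  by (auto simp: bump_def flat_fun_def)

text \<open>On the ball of half the radius 1 - (|y|/\<epsilon>)^2 is at least 3/4, so the bump is at
  least exp(-4/3) there. The resulting power of \<epsilon> is the scaling used in
  \<open>mollifier_bound\<close>.\<close>

lemma bump_integral:
  assumes "\<epsilon> > 0"
  shows "integrable lborel (bump \<epsilon> :: real^'n::finite \<Rightarrow> real)"
    and "(LINT y|lborel. bump \<epsilon> (y :: real^'n)) \<ge> exp (-4/3) * (\<epsilon>/2)^CARD('n) * measure lborel (ball (0::real^'n) 1)"
proof -
  let ?b = "bump \<epsilon> :: real^'n \<Rightarrow> real"
  have [measurable]: "?b \<in> borel_measurable borel" using test_fun_borel test_fun_bump[OF assms] by blast
  show i: "integrable lborel ?b"
  proof (rule integrableI_bounded_set[of "cball 0 \<epsilon>" _ _ 1])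
    show "AE x in lborel. x \<notin> cball 0 \<epsilon> \<longrightarrow> ?b x = 0" using bump_supp[OF assms] by fastforce
    show "emeasure lborel (cball 0 \<epsilon> :: (real^'n) set) < \<infinity>" by (rule emeasure_bounded_finite) simp
  qed (auto simp: bump_le1)
  have "exp (-4/3) * (\<epsilon>/2)^CARD('n) * measure lborel (ball (0::real^'n) 1) = (LINT y|lborel. exp (-4/3) * indicator (ball (0::real^'n) (\<epsilon>/2)) y)"
    using assms by (simp add: content_ball_conv_unit_ball[of "\<epsilon>/2"] emeasure_bounded_finite[OF bounded_ball])
  also have "\<dots> \<le> (LINT y|lborel. ?b y)"
  proof (rule integral_mono)
    fix y :: "real^'n"
    show "exp (-4/3) * indicator (ball (0::real^'n) (\<epsilon>/2)) y \<le> ?b y"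
    proof (cases "y \<in> ball 0 (\<epsilon>/2)")
      case True
      then have "norm y / \<epsilon> \<le> 1/2" using assms by (simp add: field_simps)
      then have "(norm y / \<epsilon>)^2 \<le> (1/2)^2" using assms by (intro power_mono) auto
      then have s: "1 - (norm y / \<epsilon>)^2 \<ge> 3/4" by (simp add: power2_eq_square)
      then have "1 / (1 - (norm y / \<epsilon>)^2) \<le> 4/3" by (simp add: divide_le_eq)
      then show ?thesis using True s by (simp add: bump_alt flat_fun_def)
    qed (simp add: bump_le1)
  next
    have "emeasure lborel (ball (0::real^'n) (\<epsilon>/2)) < \<infinity>" by (rule emeasure_bounded_finite) simp
    then have "integrable lborel (indicator (ball (0::real^'n) (\<epsilon>/2)) :: _ \<Rightarrow> real)"
      by (intro integrable_real_indicator) auto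
    then show "integrable lborel (\<lambda>y. exp (-4/3 :: real) * indicator (ball (0::real^'n) (\<epsilon>/2)) y)"
      by (rule integrable_mult_right)
  qed (rule i)
  finally show "(LINT y|lborel. ?b y) \<ge> exp (-4/3) * (\<epsilon>/2)^CARD('n) * measure lborel (ball (0::real^'n) 1)" .
qed

lemma bump_integral_pos:
  assumes "\<epsilon> > 0" shows "(LINT y|lborel. bump \<epsilon> (y :: real^'n::finite)) > 0"
  using bump_integral(2)[OF assms, where 'n='n] assms content_ball_pos[of 1 "0::real^'n"]
  by (intro less_le_trans[OF _ bump_integral(2)[OF assms]] mult_pos_pos) auto

lemma
  assumes "\<epsilon> > 0"
  shows test_fun_mollifier: "test_fun (mollifier \<epsilon> :: real^'n::finite \<Rightarrow> real)"
    and mollifier_nonneg: "0 \<le> mollifier \<epsilon> (x :: real^'n)"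
    and mollifier_integral: "(LINT x|lborel. mollifier \<epsilon> (x :: real^'n)) = 1"
    and mollifier_supp: "mollifier \<epsilon> (x :: real^'n) \<noteq> 0 \<Longrightarrow> norm x < \<epsilon>"
proof -
  have e: "mollifier \<epsilon> = (\<lambda>x :: real^'n. bump \<epsilon> x * (1 / (LINT y|lborel. bump \<epsilon> (y :: real^'n))))"
    by (auto simp: mollifier_def)
  show "test_fun (mollifier \<epsilon> :: real^'n \<Rightarrow> real)"
    unfolding test_fun_def e
  proof
    show "smooth (\<lambda>x :: real^'n. bump \<epsilon> x * (1 / (LINT y|lborel. bump \<epsilon> (y :: real^'n))))"
      by (intro smooth_mult smooth_const smooth_bump)
    show "bounded {x :: real^'n. bump \<epsilon> x * (1 / (LINT y|lborel. bump \<epsilon> (y :: real^'n))) \<noteq> 0}"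
    proof (rule bounded_subset)
      show "bounded {x :: real^'n. bump \<epsilon> x \<noteq> 0}" using test_fun_bump[OF assms, where 'n='n] by (simp add: test_fun_def)
    qed auto
  qed
qed (use bump_integral_pos[OF assms, where 'n='n] bump_supp[OF assms] in \<open>auto simp: mollifier_def bump_le1\<close>)

lemma mollifier_reflect:
  assumes "\<epsilon> > 0"
  shows "integrable lborel (\<lambda>y :: real^'n::finite. mollifier \<epsilon> (x - y))" "(LINT y|lborel. mollifier \<epsilon> (x - y :: real^'n)) = 1"
proof -
  let ?m = "mollifier \<epsilon> :: real^'n \<Rightarrow> real"
  have m: "?m \<in> borel_measurable borel" by (rule test_fun_borel[OF test_fun_mollifier[OF assms]])
  have "integrable lborel ?m"
    using not_integrable_integral_eq[of lborel ?m] mollifier_integral[OF assms, where 'n='n]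
    by (cases "integrable lborel ?m") auto
  then show "integrable lborel (\<lambda>y. ?m (x - y))" "(LINT y|lborel. ?m (x - y)) = 1"
    using integrable_reflect[OF m, of x] integral_reflect[OF m, of x] mollifier_integral[OF assms, where 'n='n] by auto
qed

lemma integrable_norm_vec:
  fixes W :: "real^'n::finite \<Rightarrow> real^'n"
  assumes Wi: "\<And>i. integrable lborel (\<lambda>y. W y $ i)"
  shows "integrable lborel (\<lambda>y. norm (W y))"
proof (rule Bochner_Integration.integrable_bound)
  have [measurable]: "(\<lambda>y. W y $ i) \<in> borel_measurable borel" for i
    using borel_measurable_integrable[OF Wi] by simp
  show "integrable lborel (\<lambda>y. \<Sum>i\<in>UNIV. \<bar>W y $ i\<bar>)" using Wi by auto
  show "(\<lambda>y. norm (W y)) \<in> borel_measurable lborel"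
    by (simp add: norm_vec_def L2_set_def) (measurable)
  show "AE y in lborel. norm (norm (W y)) \<le> norm (\<Sum>i\<in>UNIV. \<bar>W y $ i\<bar>)"
    by (rule AE_I2) (simp add: sum_nonneg norm_le_l1_cart)
qed

lemma integrable_indicator_cball:
  "integrable lborel (\<lambda>x :: 'a::euclidean_space. indicator (cball a r) x :: real)"
proof -
  have "emeasure lborel (cball a r) < \<infinity>" by (rule emeasure_bounded_finite) simp
  then show ?thesis by (intro integrable_real_indicator) auto
qed

text \<open>The polynomial blow-up rate is what log-Hoelder continuity of the exponent can
  compensate: a power of order \<epsilon> of it stays bounded.\<close>

lemma mollifier_bound: "\<exists>C>0. \<forall>\<epsilon>>0. \<forall>x :: real^'n::finite. mollifier \<epsilon> x \<le> C / \<epsilon>^CARD('n)"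
proof (intro exI conjI allI impI)
  let ?c = "exp (-4/3) * (1/2)^CARD('n) * measure lborel (ball (0::real^'n) 1)"
  have c: "?c > 0" using content_ball_pos[of 1 "0::real^'n"] by simp
  then show "1 / ?c > 0" by simp
  fix \<epsilon> :: real and x :: "real^'n" assume "\<epsilon> > 0"
  have "mollifier \<epsilon> x \<le> 1 / (LINT y|lborel. bump \<epsilon> (y :: real^'n))"
    using bump_integral_pos[OF \<open>\<epsilon> > 0\<close>, where 'n='n] by (simp add: mollifier_def divide_right_mono bump_le1)
  also have "\<dots> \<le> 1 / (exp (-4/3) * (\<epsilon>/2)^CARD('n) * measure lborel (ball (0::real^'n) 1))"
    using \<open>\<epsilon> > 0\<close> content_ball_pos[of 1 "0::real^'n"] by (intro divide_left_mono bump_integral mult_pos_pos bump_integral_pos) auto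
  also have "\<dots> = (1 / ?c) / \<epsilon>^CARD('n)" using \<open>\<epsilon> > 0\<close> by (simp add: power_divide)
  finally show "mollifier \<epsilon> x \<le> (1 / ?c) / \<epsilon>^CARD('n)" .
qed

lemma L1_mollifier_tendsto:
  assumes f: "integrable lborel f" and \<epsilon>: "\<And>m. \<epsilon> m > 0" "\<epsilon> \<longlonglongrightarrow> 0"
  shows "integrable lborel (convolve f (mollifier (\<epsilon> m)))"
    and "(\<lambda>m. LINT x|lborel. \<bar>convolve f (mollifier (\<epsilon> m)) x - f x\<bar>) \<longlonglongrightarrow> 0"
proof -
  have T: "\<forall>e>0. \<exists>d>0. \<forall>y. norm y < d \<longrightarrow> (LINT x|lborel. \<bar>f (x - y) - f x\<bar>) < e"
    by (rule L1_translation_continuous[OF f])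
  have [measurable]: "f \<in> borel_measurable borel" using f by (auto dest: borel_measurable_integrable)
  have z: "mollifier (\<epsilon> m) x = 0" if "\<epsilon> m \<le> norm x" for x :: "real^'a" and m
    using mollifier_supp[OF \<epsilon>(1), of m x] that by linarith
  note mm = test_fun_mollifier[OF \<epsilon>(1)] mollifier_nonneg[OF \<epsilon>(1)] mollifier_integral[OF \<epsilon>(1)]
  \<comment> \<open>A crude bound valid for every shift, enough to obtain integrability of the
    mollification for every m; the small bound is available only for large m.\<close>
  have "(LINT x|lborel. \<bar>f (x - y) - f x\<bar>) \<le> 2 * (LINT x|lborel. \<bar>f x\<bar>)" for y
  proof -
    have i: "integrable lborel (\<lambda>x. \<bar>f (x - y)\<bar>)" using f by (simp add: integrable_translate)
    have "(LINT x|lborel. \<bar>f (x - y) - f x\<bar>) \<le> (LINT x|lborel. \<bar>f (x - y)\<bar> + \<bar>f x\<bar>)"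
      using f i by (intro integral_mono) (auto simp: integrable_translate)
    also have "\<dots> = 2 * (LINT x|lborel. \<bar>f x\<bar>)"
      using f i integral_translate[of "\<lambda>x. \<bar>f x\<bar>" y] by simp
    finally show ?thesis .
  qed
  note T2 = this
  show "integrable lborel (convolve f (mollifier (\<epsilon> m)))"
    by (rule L1_mollify(1)[where d="\<epsilon> m" and e="2 * (LINT x|lborel. \<bar>f x\<bar>)", OF f mm z T2]) auto
  show "(\<lambda>m. LINT x|lborel. \<bar>convolve f (mollifier (\<epsilon> m)) x - f x\<bar>) \<longlonglongrightarrow> 0"
  proof (rule LIMSEQ_I)
    fix e :: real assume "e > 0"
    then obtain d where d: "d > 0" "\<forall>y. norm y < d \<longrightarrow> (LINT x|lborel. \<bar>f (x - y) - f x\<bar>) < e/2"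
      using T half_gt_zero by blast
    obtain N where N: "\<And>m. m \<ge> N \<Longrightarrow> \<epsilon> m < d"
      using order_tendstoD(2)[OF \<epsilon>(2) d(1)] by (auto simp: eventually_sequentially)
    have "norm ((LINT x|lborel. \<bar>convolve f (mollifier (\<epsilon> m)) x - f x\<bar>) - 0) < e" if "m \<ge> N" for m
    proof -
      have "(LINT x|lborel. \<bar>convolve f (mollifier (\<epsilon> m)) x - f x\<bar>) \<le> e/2"
      proof (rule L1_mollify(2)[where d=d, OF f mm])
        show "mollifier (\<epsilon> m) x = 0" if "d \<le> norm x" for x :: "real^'a"
          using z[of m x] N[OF \<open>m \<ge> N\<close>] that by linarith
        show "(LINT x|lborel. \<bar>f (x - y) - f x\<bar>) \<le> e/2" if "norm y < d" for y
          using d(2) that by (auto intro: less_imp_le)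
      qed (use \<open>e > 0\<close> in simp)
      moreover have "0 \<le> (LINT x|lborel. \<bar>convolve f (mollifier (\<epsilon> m)) x - f x\<bar>)" by simp
      ultimately show ?thesis using \<open>e > 0\<close> by simp
    qed
    then show "\<exists>N. \<forall>m\<ge>N. norm ((LINT x|lborel. \<bar>convolve f (mollifier (\<epsilon> m)) x - f x\<bar>) - 0) < e" by blast
  qed
qed

text \<open>Difference quotients in a coordinate direction have integral 0 by translation
  invariance. The mean value theorem bounds them by the supremum of the partial derivative, so they
  converge to it under the integral. A single continuous partial derivative suffices, which fits the
  C^1 exponent.\<close>

lemma integral_partial_eq_0:
  fixes g :: "real^'n::finite \<Rightarrow> real"
  assumes g: "\<And>x. g differentiable (at x)" and supp: "bounded {x. g x \<noteq> 0}"
    and c: "continuous_on UNIV (partial i g)"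
  shows "(LINT x|lborel. partial i g x) = 0"
proof -
  let ?e = "axis i 1 :: real^'n"
  obtain r where r: "r > 0" "\<And>x. g x \<noteq> 0 \<Longrightarrow> norm x \<le> r" using supp unfolding bounded_pos by auto
  have gc: "continuous_on UNIV g"
    using g by (auto intro!: continuous_at_imp_continuous_on differentiable_imp_continuous_within)
  have [measurable]: "g \<in> borel_measurable borel" "partial i g \<in> borel_measurable borel"
    using gc c by (auto intro: borel_measurable_continuous_onI)
  have "bounded {x. partial i g x \<noteq> 0}"
    by (rule bounded_subset[OF bounded_closure[OF supp]]) (use partial_zero_outside in blast)
  then obtain B where B: "B > 0" "\<And>x. \<bar>partial i g x\<bar> \<le> B" using cont_cpt_supp_bdd[OF c] by blast
  obtain G where G: "G > 0" "\<And>x. \<bar>g x\<bar> \<le> G" using cont_cpt_supp_bdd[OF gc supp] by blast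
  have gi: "integrable lborel g"
  proof (rule integrableI_bounded_set[of "cball 0 r" _ _ G])
    show "emeasure lborel (cball 0 r :: (real^'n) set) < \<infinity>" by (rule emeasure_bounded_finite) simp
    show "AE x in lborel. x \<notin> cball 0 r \<longrightarrow> g x = 0" by (rule AE_I2) (use r(2) in auto)
  qed (use G in auto)
  have line: "((\<lambda>s. g (x + s *\<^sub>R ?e)) has_real_derivative partial i g (x + s *\<^sub>R ?e)) (at s)" for x s
  proof -
    have "((\<lambda>s. g (x + s *\<^sub>R ?e)) has_derivative (\<lambda>h. grad g (x + s *\<^sub>R ?e) \<bullet> (h *\<^sub>R ?e))) (at s)"
      by (rule has_derivative_compose[OF _ has_derivative_grad[OF g]]) (auto intro!: derivative_eq_intros)
    moreover have "(\<lambda>h. grad g (x + s *\<^sub>R ?e) \<bullet> (h *\<^sub>R ?e)) = (*) (partial i g (x + s *\<^sub>R ?e))"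
      by (auto simp: inner_axis)
    ultimately show ?thesis by (simp add: has_field_derivative_def)
  qed
  define t where "t m = 1 / real (Suc m)" for m
  have t: "0 < t m" "t m \<le> 1" for m by (auto simp: t_def)
  have t0: "t \<longlonglongrightarrow> 0" unfolding t_def using LIMSEQ_inverse_real_of_nat by (simp add: inverse_eq_divide)
  have "(\<lambda>m. LINT x|lborel. (g (x + t m *\<^sub>R ?e) - g x) / t m) \<longlonglongrightarrow> (LINT x|lborel. partial i g x)"
  proof (rule integral_dominated_convergence[where w="\<lambda>x. B * indicator (cball 0 (r + 1)) x"])
    show "AE x in lborel. (\<lambda>m. (g (x + t m *\<^sub>R ?e) - g x) / t m) \<longlonglongrightarrow> partial i g x"
    proof (rule AE_I2)
      fix x
      have "((\<lambda>s. (g (x + s *\<^sub>R ?e) - g x) / s) \<longlongrightarrow> partial i g x) (at 0)"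
        using line[of x 0] by (simp add: DERIV_def)
      then show "(\<lambda>m. (g (x + t m *\<^sub>R ?e) - g x) / t m) \<longlonglongrightarrow> partial i g x"
        by (rule filterlim_compose) (use t t0 in \<open>auto simp: filterlim_at less_imp_neq[symmetric]\<close>)
    qed
    show "AE x in lborel. norm ((g (x + t m *\<^sub>R ?e) - g x) / t m) \<le> B * indicator (cball 0 (r + 1)) x" for m
    proof (rule AE_I2)
      fix x
      show "norm ((g (x + t m *\<^sub>R ?e) - g x) / t m) \<le> B * indicator (cball 0 (r + 1)) x"
      proof (cases "norm x \<le> r + 1")
        case True
        obtain s where "g (x + t m *\<^sub>R ?e) - g (x + 0 *\<^sub>R ?e) = (t m - 0) * partial i g (x + s *\<^sub>R ?e)"
          using MVT2[of 0 "t m" "\<lambda>s. g (x + s *\<^sub>R ?e)" "\<lambda>s. partial i g (x + s *\<^sub>R ?e)"] t line by blast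
        then have "(g (x + t m *\<^sub>R ?e) - g x) / t m = partial i g (x + s *\<^sub>R ?e)" using t[of m] by simp
        then show ?thesis using B True by simp
      next
        case False
        have "norm x - norm (t m *\<^sub>R ?e) \<le> norm (x + t m *\<^sub>R ?e)" using norm_diff_ineq by blast
        then have "norm (x + t m *\<^sub>R ?e) > r" using False t[of m] by simp
        then have "g (x + t m *\<^sub>R ?e) = 0" "g x = 0" using r(2)[of x] r(2)[of "x + t m *\<^sub>R ?e"] False by linarith+
        then show ?thesis using B(1) by simp
      qed
    qed
    show "integrable lborel (\<lambda>x. B * indicator (cball (0::real^'n) (r + 1)) x)"
      by (intro integrable_mult_right integrable_indicator_cball)
  qed auto
  moreover have "(LINT x|lborel. (g (x + t m *\<^sub>R ?e) - g x) / t m) = 0" for m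
  proof -
    have "integrable lborel (\<lambda>x. g (x + t m *\<^sub>R ?e))" "(LINT x|lborel. g (x + t m *\<^sub>R ?e)) = (LINT x|lborel. g x)"
      using gi integrable_translate[of g "- t m *\<^sub>R ?e"] integral_translate[of g "- t m *\<^sub>R ?e"] by simp_all
    then show ?thesis using gi by simp
  qed
  ultimately have "(\<lambda>m::nat. 0) \<longlonglongrightarrow> (LINT x|lborel. partial i g x)" by (simp only:)
  then show ?thesis by (simp add: LIMSEQ_const_iff)
qed

section \<open>Limits of mollified energies\<close>

text \<open>The weak formulation integrates with respect to Lebesgue measure, whereas mollification
  works with Borel functions; agreement almost everywhere is the bridge between the two.\<close>

lemma lebesgue_AE_borel:
  fixes f f' :: "'a::euclidean_space \<Rightarrow> real"
  assumes f': "f' \<in> borel_measurable borel" and ae: "AE x in lborel. f x = f' x"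
  shows "f \<in> borel_measurable lebesgue" "(LINT x|lebesgue. f x) = (LINT x|lborel. f' x)"
proof -
  have f'm: "f' \<in> borel_measurable lebesgue" using f' by (intro measurable_completion) simp
  have ae': "AE x in lebesgue. f x = f' x" using ae by (rule AE_completion)
  show m: "f \<in> borel_measurable lebesgue"
  proof (rule measurableI)
    fix A :: "real set" assume A: "A \<in> sets borel"
    have "f' -` A \<inter> space lebesgue \<in> sets lebesgue" using f'm A by (rule measurable_sets)
    then show "f -` A \<inter> space lebesgue \<in> sets lebesgue"
      by (rule completion.in_sets_AE[rotated]) (use ae' in auto)
  qed simp
  show "(LINT x|lebesgue. f x) = (LINT x|lborel. f' x)"
    using integral_cong_AE[OF m f'm ae'] integral_completion[of f' lborel] f' by simp
qed

text \<open>The dominating functions vary with m and converge in L1. This is needed because the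
  gradient of the mollification is dominated by the mollification of |Du|^p and not by one fixed
  function.\<close>

lemma generalized_dominated_convergence:
  fixes F :: "nat \<Rightarrow> 'a \<Rightarrow> real"
  assumes [measurable]: "\<And>m. F m \<in> borel_measurable M" "f \<in> borel_measurable M"
    and G: "\<And>m. integrable M (G m)" "integrable M g"
    and L1: "(\<lambda>m. LINT x|M. \<bar>G m x - g x\<bar>) \<longlonglongrightarrow> 0"
    and aeF: "AE x in M. (\<lambda>m. F m x) \<longlonglongrightarrow> f x"
    and aeG: "AE x in M. (\<lambda>m. G m x) \<longlonglongrightarrow> g x"
    and bd: "\<And>m. AE x in M. \<bar>F m x\<bar> \<le> G m x"
  shows "integrable M f" "(\<lambda>m. LINT x|M. F m x) \<longlonglongrightarrow> (LINT x|M. f x)"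
proof -
  have [measurable]: "\<And>m. G m \<in> borel_measurable M" "g \<in> borel_measurable M"
    using G by (auto dest: borel_measurable_integrable)
  have bd': "AE x in M. \<forall>m. \<bar>F m x\<bar> \<le> G m x" using bd by (subst AE_all_countable) blast
  have fg: "AE x in M. \<bar>f x\<bar> \<le> g x"
    using aeF aeG bd'
  proof eventually_elim
    case (elim x)
    show ?case by (rule LIMSEQ_le[OF tendsto_rabs[OF elim(1)] elim(2)]) (use elim(3) in auto)
  qed
  show fi: "integrable M f"
    by (rule Bochner_Integration.integrable_bound[OF G(2)]) (use fg in \<open>auto elim!: eventually_mono\<close>)
  have Fi: "integrable M (F m)" for m
    by (rule Bochner_Integration.integrable_bound[OF G(1)[of m]]) (use bd[of m] in \<open>auto elim!: eventually_mono\<close>)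
  \<comment> \<open>Clamping \<open>F m\<close> to the interval from -|g| to |g| makes ordinary
    dominated convergence applicable, and the part cut off is at most |G m - g|.\<close>
  define C where "C m x = max (- \<bar>g x\<bar>) (min \<bar>g x\<bar> (F m x))" for m x
  have [measurable]: "C m \<in> borel_measurable M" for m unfolding C_def by measurable
  have Cb: "\<bar>C m x\<bar> \<le> \<bar>g x\<bar>" for m x unfolding C_def by (auto simp: max_def min_def)
  have Ci: "integrable M (C m)" for m
    by (rule Bochner_Integration.integrable_bound[OF G(2)]) (use Cb in auto)
  have "(\<lambda>m. LINT x|M. C m x) \<longlonglongrightarrow> (LINT x|M. f x)"
  proof (rule integral_dominated_convergence[where w="\<lambda>x. \<bar>g x\<bar>"])
    show "AE x in M. (\<lambda>m. C m x) \<longlonglongrightarrow> f x"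
      using aeF fg
    proof eventually_elim
      case (elim x)
      have "(\<lambda>m. C m x) \<longlonglongrightarrow> max (- \<bar>g x\<bar>) (min \<bar>g x\<bar> (f x))"
        unfolding C_def by (intro tendsto_max tendsto_min tendsto_const elim)
      then show ?case using elim(2) by (auto simp: max_def min_def split: if_splits)
    qed
  qed (use G(2) Cb in auto)
  moreover have "(\<lambda>m. (LINT x|M. F m x) - (LINT x|M. C m x)) \<longlonglongrightarrow> 0"
  proof (rule Lim_null_comparison[OF _ L1], rule always_eventually, rule allI)
    fix m
    have "norm ((LINT x|M. F m x) - (LINT x|M. C m x)) = norm (LINT x|M. F m x - C m x)"
      using Fi Ci by simp
    also have "\<dots> \<le> (LINT x|M. \<bar>F m x - C m x\<bar>)"
      using integral_norm_bound[of M "\<lambda>x. F m x - C m x"] by simp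
    also have "\<dots> \<le> (LINT x|M. \<bar>G m x - g x\<bar>)"
    proof (rule integral_mono_AE)
      show "AE x in M. \<bar>F m x - C m x\<bar> \<le> \<bar>G m x - g x\<bar>"
        using bd[of m] by eventually_elim (auto simp: C_def max_def min_def abs_if split: if_splits)
    qed (use Fi Ci G in auto)
    finally show "norm ((LINT x|M. F m x) - (LINT x|M. C m x)) \<le> (LINT x|M. \<bar>G m x - g x\<bar>)" .
  qed
  ultimately have "(\<lambda>m. ((LINT x|M. F m x) - (LINT x|M. C m x)) + (LINT x|M. C m x)) \<longlonglongrightarrow> 0 + (LINT x|M. f x)"
    by (intro tendsto_add)
  then show "(\<lambda>m. LINT x|M. F m x) \<longlonglongrightarrow> (LINT x|M. f x)" by simp
qed

section \<open>Pointwise inequalities for the variable exponent\<close>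

lemma norm_powr_scaleR:
  fixes a :: "'a::real_inner"
  shows "norm ((norm a powr (q - 2)) *\<^sub>R a) = norm a powr (q - 1)"
proof (cases "a = 0")
  case False
  then have "norm a powr (q - 2) * norm a powr 1 = norm a powr (q - 1)" by (subst powr_add[symmetric]) simp
  then show ?thesis using False by simp
qed simp

text \<open>The product splits into a radial part (|a|^(q-1) - |b|^(q-1)) (|a| - |b|) and an angular
  part (|a|^(q-2) + |b|^(q-2)) (|a||b| - a.b), both nonnegative. If they vanish, the first gives |a|
  = |b| and the second equality in the Cauchy-Schwarz inequality.\<close>

lemma p_monotone:
  fixes a b :: "'a::real_inner"
  assumes q: "q > 1"
  defines "A \<equiv> (\<lambda>a::'a. (norm a powr (q - 2)) *\<^sub>R a)"
  shows "0 \<le> (A a - A b) \<bullet> (a - b)" and "(A a - A b) \<bullet> (a - b) = 0 \<Longrightarrow> a = b"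
proof -
  let ?s = "norm a" and ?t = "norm b"
  let ?c = "?s powr (q - 2)" and ?d = "?t powr (q - 2)"
  have cs: "a \<bullet> b \<le> ?s * ?t" by (rule norm_cauchy_schwarz)
  have s1: "?c * ?s = ?s powr (q - 1)" "?d * ?t = ?t powr (q - 1)"
    using norm_powr_scaleR[of a q] norm_powr_scaleR[of b q] by simp_all
  have e: "(A a - A b) \<bullet> (a - b) = (?s powr (q-1) - ?t powr (q-1)) * (?s - ?t) + (?c + ?d) * (?s * ?t - a \<bullet> b)"
  proof -
    have "(A a - A b) \<bullet> (a - b) = ?c * (?s * ?s) + ?d * (?t * ?t) - (?c + ?d) * (a \<bullet> b)"
      unfolding A_def by (simp add: inner_diff_left inner_diff_right inner_commute[of b a] algebra_simps
          power2_norm_eq_inner[symmetric] power2_eq_square)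
    also have "\<dots> = (?c * ?s - ?d * ?t) * (?s - ?t) + (?c + ?d) * (?s * ?t - a \<bullet> b)"
      by (simp add: algebra_simps)
    finally show ?thesis unfolding s1 .
  qed
  have t1: "(?s powr (q-1) - ?t powr (q-1)) * (?s - ?t) \<ge> 0"
  proof (cases "?s \<le> ?t")
    case True
    then have "?s powr (q-1) \<le> ?t powr (q-1)" using q by (intro powr_mono2) auto
    then show ?thesis using True by (intro mult_nonpos_nonpos) auto
  next
    case False
    then have "?t powr (q-1) \<le> ?s powr (q-1)" using q by (intro powr_mono2) auto
    then show ?thesis using False by (intro mult_nonneg_nonneg) auto
  qed
  have t2: "(?c + ?d) * (?s * ?t - a \<bullet> b) \<ge> 0" using cs by (intro mult_nonneg_nonneg) auto
  show "0 \<le> (A a - A b) \<bullet> (a - b)" using e t1 t2 by linarith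
  assume "(A a - A b) \<bullet> (a - b) = 0"
  then have z: "(?s powr (q-1) - ?t powr (q-1)) * (?s - ?t) = 0" "(?c + ?d) * (?s * ?t - a \<bullet> b) = 0"
    using e t1 t2 by linarith+
  have st: "?s = ?t"
  proof (rule ccontr)
    assume n: "?s \<noteq> ?t"
    then have "?s powr (q-1) = ?t powr (q-1)" using z(1) by simp
    then show False using n q powr_less_mono2[of "q-1" ?s ?t] powr_less_mono2[of "q-1" ?t ?s]
      by (cases "?s < ?t") auto
  qed
  show "a = b"
  proof (cases "a = 0")
    case True with st show ?thesis by simp
  next
    case False
    then have "?c > 0" by simp
    then have "?c + ?d > 0" using powr_ge_zero[of ?t "q - 2"] by linarith
    then have "a \<bullet> b = ?s * ?t" using z(2) by simp
    moreover have "(a - b) \<bullet> (a - b) = a \<bullet> a - 2 * (a \<bullet> b) + b \<bullet> b"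
      by (simp add: inner_diff_left inner_diff_right inner_commute[of b a])
    ultimately have "(a - b) \<bullet> (a - b) = 0"
      using st by (simp only: dot_square_norm) (simp add: power2_eq_square)
    then show ?thesis by simp
  qed
qed

lemma convolve_le_bound:
  fixes g :: "real^'n::finite \<Rightarrow> real"
  assumes g: "integrable lborel g" "\<And>x. 0 \<le> g x" and C: "\<And>x :: real^'n. mollifier \<epsilon> x \<le> C" and "\<epsilon> > 0"
  shows "convolve g (mollifier \<epsilon>) x \<le> C * (LINT y|lborel. g y)" "0 \<le> convolve g (mollifier \<epsilon>) x"
proof -
  have "convolve g (mollifier \<epsilon>) x \<le> (LINT y|lborel. g y * C)"
    unfolding convolve_def using g C
    by (intro integral_mono convolve_integrable test_fun_mollifier \<open>\<epsilon> > 0\<close> integrable_mult_left mult_left_mono) auto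
  then show "convolve g (mollifier \<epsilon>) x \<le> C * (LINT y|lborel. g y)" by (simp add: mult.commute)
  show "0 \<le> convolve g (mollifier \<epsilon>) x"
    unfolding convolve_def by (intro integral_nonneg_AE AE_I2 mult_nonneg_nonneg g mollifier_nonneg \<open>\<epsilon> > 0\<close>)
qed

text \<open>Jensen's inequality up to a constant: \<open>t \<le> T + T\<^bsup>1-q\<^esup> t\<^bsup>q\<^esup>\<close> for every \<open>T > 0\<close>, used with
  \<open>T = (1 + g * \<eta>\<^sub>\<epsilon>)\<^bsup>1/q\<^esup>\<close>.\<close>

lemma convolve_powr_bound:
  fixes W :: "real^'n::finite \<Rightarrow> real^'n" and P :: "real^'n \<Rightarrow> real"
  assumes Wi: "\<And>i. integrable lborel (\<lambda>y. W y $ i)" and g: "integrable lborel (\<lambda>y. norm (W y) powr P y)"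
    and "\<epsilon> > 0" and q: "q \<ge> 1" and P: "\<And>y. norm (x - y) < \<epsilon> \<Longrightarrow> q \<le> P y" and Px: "q \<le> P x"
  defines "G \<equiv> 1 + convolve (\<lambda>y. norm (W y) powr P y) (mollifier \<epsilon>) x"
  shows "norm (\<chi> i. convolve (\<lambda>y. W y $ i) (mollifier \<epsilon>) x) powr P x \<le> 2 powr P x * G * G powr (P x - q)"
proof -
  have tm: "test_fun (mollifier \<epsilon> :: real^'n \<Rightarrow> real)" using \<open>\<epsilon> > 0\<close> by (rule test_fun_mollifier)
  define T where "T = G powr (1/q)"
  have G1: "G \<ge> 1" unfolding G_def unfolding convolve_def
    using integral_nonneg_AE[OF AE_I2[of lborel "\<lambda>y. 0 \<le> norm (W y) powr P y * mollifier \<epsilon> (x - y)"]] mollifier_nonneg[OF \<open>\<epsilon> > 0\<close>, where 'n='n]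
    by simp
  have T: "T > 0" "T powr q = G" using G1 q by (auto simp: T_def powr_powr)
  let ?a = "\<chi> i. convolve (\<lambda>y. W y $ i) (mollifier \<epsilon>) x"
  have nW: "integrable lborel (\<lambda>y. norm (W y))" by (rule integrable_norm_vec[OF Wi])
  have i1: "integrable lborel (\<lambda>y. norm (W y) * mollifier \<epsilon> (x - y))" by (rule convolve_integrable[OF nW tm])
  have i2: "integrable lborel (\<lambda>y. (norm (W y) powr P y) * mollifier \<epsilon> (x - y))" by (rule convolve_integrable[OF g tm])
  note mm = mollifier_reflect[OF \<open>\<epsilon> > 0\<close>, of x]
  \<comment> \<open>The convolution is defined by components. Testing the vector with itself and
    dividing by its norm yields the norm inequality for the vector-valued integral.\<close>
  have "?a \<bullet> ?a \<le> norm ?a * (LINT y|lborel. norm (W y) * mollifier \<epsilon> (x - y))"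
  proof -
    have ii: "integrable lborel (\<lambda>y. ?a $ i * (W y $ i * mollifier \<epsilon> (x - y)))" for i
      by (intro integrable_mult_right convolve_integrable Wi tm)
    have "?a \<bullet> ?a = (\<Sum>i\<in>UNIV. ?a $ i * (LINT y|lborel. W y $ i * mollifier \<epsilon> (x - y)))"
      by (simp add: inner_vec_def convolve_def)
    also have "\<dots> = (LINT y|lborel. (\<Sum>i\<in>UNIV. ?a $ i * (W y $ i * mollifier \<epsilon> (x - y))))"
      using ii by (subst Bochner_Integration.integral_sum) (auto simp del: vec_lambda_beta)
    also have "\<dots> \<le> (LINT y|lborel. norm ?a * (norm (W y) * mollifier \<epsilon> (x - y)))"
    proof (rule integral_mono)
      fix y
      have "(\<Sum>i\<in>UNIV. ?a $ i * (W y $ i * mollifier \<epsilon> (x - y))) = (?a \<bullet> W y) * mollifier \<epsilon> (x - y)"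
        by (simp add: inner_vec_def sum_distrib_right mult.assoc)
      also have "\<dots> \<le> (norm ?a * norm (W y)) * mollifier \<epsilon> (x - y)"
        by (intro mult_right_mono norm_cauchy_schwarz mollifier_nonneg \<open>\<epsilon> > 0\<close>)
      finally show "(\<Sum>i\<in>UNIV. ?a $ i * (W y $ i * mollifier \<epsilon> (x - y))) \<le> norm ?a * (norm (W y) * mollifier \<epsilon> (x - y))"
        by (simp add: mult.assoc)
    qed (intro Bochner_Integration.integrable_sum ii integrable_mult_right i1)+
    finally show ?thesis by simp
  qed
  then have "norm ?a * norm ?a \<le> norm ?a * (LINT y|lborel. norm (W y) * mollifier \<epsilon> (x - y))"
    by (simp add: power2_norm_eq_inner[symmetric] power2_eq_square)
  moreover have "0 \<le> (LINT y|lborel. norm (W y) * mollifier \<epsilon> (x - y))"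
    by (intro integral_nonneg_AE AE_I2 mult_nonneg_nonneg norm_ge_zero mollifier_nonneg \<open>\<epsilon> > 0\<close>)
  moreover have "a \<le> b" if "a * a \<le> a * b" "0 \<le> b" "0 \<le> a" for a b :: real
    using that by (cases "a = 0") auto
  ultimately have "norm ?a \<le> (LINT y|lborel. norm (W y) * mollifier \<epsilon> (x - y))"
    using norm_ge_zero by blast
  also have "\<dots> \<le> (LINT y|lborel. T * mollifier \<epsilon> (x - y) + T powr (1 - q) * (mollifier \<epsilon> (x - y) + (norm (W y) powr P y) * mollifier \<epsilon> (x - y)))"
  proof (rule integral_mono[OF i1])
    show "integrable lborel (\<lambda>y. T * mollifier \<epsilon> (x - y) + T powr (1 - q) * (mollifier \<epsilon> (x - y) + (norm (W y) powr P y) * mollifier \<epsilon> (x - y)))"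
      using mm i2 by simp
    fix y
    let ?t = "norm (W y)"
    show "?t * mollifier \<epsilon> (x - y) \<le> T * mollifier \<epsilon> (x - y) + T powr (1 - q) * (mollifier \<epsilon> (x - y) + (?t powr P y) * mollifier \<epsilon> (x - y))"
    proof (cases "norm (x - y) < \<epsilon>")
      case False
      then have "mollifier \<epsilon> (x - y) = 0" using mollifier_supp[OF \<open>\<epsilon> > 0\<close>] by blast
      then show ?thesis by simp
    next
      case True
      have "?t powr q \<le> 1 + ?t powr P y"
      proof (cases "?t \<le> 1")
        case True
        then have "?t powr q \<le> 1" using q by (cases "?t = 0") (auto intro: powr_le1)
        then show ?thesis using powr_ge_zero[of ?t "P y"] by linarith
      next
        case False
        then have "?t powr q \<le> ?t powr P y" using P[OF True] by (intro powr_mono) auto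
        then show ?thesis by linarith
      qed
      then have "T powr (1 - q) * ?t powr q \<le> T powr (1 - q) * (1 + ?t powr P y)"
        by (intro mult_left_mono) auto
      moreover have "?t \<le> T + T powr (1 - q) * ?t powr q"
      proof (cases "?t \<le> T")
        case True
        then show ?thesis by (intro add_increasing2) auto
      next
        case False
        then have t: "?t > T" "?t > 0" using T by auto
        then have "?t powr (1 - q) \<le> T powr (1 - q)" using q T(1) by (intro powr_mono2') auto
        then have "?t powr (1 - q) * ?t powr q \<le> T powr (1 - q) * ?t powr q" by (intro mult_right_mono) auto
        moreover have "?t powr (1 - q) * ?t powr q = ?t" using t by (subst powr_add[symmetric]) simp
        ultimately show ?thesis using T(1) by linarith
      qed
      ultimately have "?t \<le> T + T powr (1 - q) * (1 + ?t powr P y)" by linarith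
      from mult_right_mono[OF this mollifier_nonneg[OF \<open>\<epsilon> > 0\<close>, of "x - y"]]
      show ?thesis by (simp add: algebra_simps)
    qed
  qed
  also have "\<dots> = T + T powr (1 - q) * G"
    using mm i2 by (simp add: G_def convolve_def)
  also have "T powr (1 - q) * G = T" using T by (subst T(2)[symmetric], subst powr_add[symmetric]) simp
  finally have "norm ?a \<le> 2 * T" by simp
  then have "norm ?a powr P x \<le> (2 * T) powr P x" using q Px by (intro powr_mono2) auto
  also have "\<dots> = 2 powr P x * G powr (P x / q)" using T G1 q by (simp add: powr_mult T_def powr_powr)
  \<comment> \<open>Splitting off one full power of \<open>G\<close> leaves the exponent P x - q,
    which is as small as the oscillation of the exponent on the mollification ball.\<close>
  also have "G powr (P x / q) \<le> G powr (1 + (P x - q))"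
  proof (rule powr_mono[OF _ G1])
    have "(P x - q) / q \<le> (P x - q) / 1" using q Px by (intro divide_left_mono) auto
    then show "P x / q \<le> 1 + (P x - q)" using q by (simp add: diff_divide_distrib)
  qed
  also have "\<dots> = G * G powr (P x - q)" using G1 by (subst powr_add) simp
  finally show ?thesis by (simp add: mult.assoc mult_left_mono)
qed

text \<open>\<epsilon>^(-n L \<epsilon>) = exp(n L \<epsilon> |ln \<epsilon>|) is bounded because
  \<epsilon> |ln \<epsilon>| <= 1. With L the Lipschitz constant of p, L \<epsilon> is its
  oscillation on a ball of radius \<epsilon>.\<close>

lemma log_hoelder_factor:
  fixes C L \<epsilon> :: real
  assumes "0 < \<epsilon>" "\<epsilon> \<le> 1" "C \<ge> 0" "L \<ge> 0" "1 \<le> G" "G \<le> 1 + C / \<epsilon>^n"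
  shows "G powr (L * \<epsilon>) \<le> (1 + C) powr L * exp (L * real n)"
proof -
  have en: "0 < \<epsilon>^n" "\<epsilon>^n \<le> 1" using assms by (auto simp: power_le_one)
  have "G \<le> (1 + C) / \<epsilon>^n"
    using assms(6) en by (simp add: add_divide_distrib) (meson add_right_mono le_divide_eq_1_pos order_trans)
  then have "G powr (L * \<epsilon>) \<le> ((1 + C) / \<epsilon>^n) powr (L * \<epsilon>)" using assms by (intro powr_mono2) auto
  also have "\<dots> = (1 + C) powr (L * \<epsilon>) * (1 / \<epsilon>^n) powr (L * \<epsilon>)"
    using assms en by (simp add: powr_divide)
  also have "\<dots> \<le> (1 + C) powr L * exp (L * real n)"
  proof (rule mult_mono)
    show "(1 + C) powr (L * \<epsilon>) \<le> (1 + C) powr L" using assms by (intro powr_mono) (auto simp: mult_left_le)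
    have "- ln \<epsilon> * \<epsilon> \<le> 1"
      using ln_le_minus_one[of "1 / \<epsilon>"] assms by (simp add: ln_div field_simps)
    then have "(- ln \<epsilon> * \<epsilon>) * (L * real n) \<le> 1 * (L * real n)" using assms by (intro mult_right_mono) auto
    then have "L * \<epsilon> * (- (real n * ln \<epsilon>)) \<le> L * real n" by (simp add: algebra_simps)
    then show "(1 / \<epsilon>^n) powr (L * \<epsilon>) \<le> exp (L * real n)"
      using assms en by (simp add: powr_def ln_div ln_realpow)
  qed auto
  finally show ?thesis .
qed

section \<open>Testing with mollified truncations\<close>

lemma borel_representative:
  fixes f :: "'a::euclidean_space \<Rightarrow> real"
  assumes f: "f absolutely_integrable_on K" and K [measurable]: "K \<in> sets borel"
  obtains g where "integrable lborel g" "\<And>x. x \<notin> K \<Longrightarrow> g x = 0" "AE x in lborel. x \<in> K \<longrightarrow> g x = f x"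
proof -
  have i: "integrable lebesgue (\<lambda>x. indicator K x *\<^sub>R f x)" using f by (simp add: set_integrable_def)
  from completion_ex_borel_measurable_real[OF borel_measurable_integrable[OF i]]
  obtain g' where g': "g' \<in> borel_measurable lborel" "AE x in lborel. indicator K x *\<^sub>R f x = g' x" by blast
  have [measurable]: "g' \<in> borel_measurable borel" using g'(1) by simp
  let ?g = "\<lambda>x. indicator K x * g' x"
  have "integrable lebesgue ?g"
  proof (subst integrable_cong_AE)
    show "AE x in lebesgue. ?g x = indicator K x *\<^sub>R f x"
      by (rule AE_completion) (use g'(2) in eventually_elim, auto split: split_indicator)
    show "?g \<in> borel_measurable lebesgue" by (rule measurable_completion) simp
  qed (use i in auto)
  then have "integrable lborel ?g" by (subst (asm) integrable_completion) auto
  moreover have "AE x in lborel. x \<in> K \<longrightarrow> ?g x = f x" using g'(2) by eventually_elim auto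
  ultimately show ?thesis by (intro that[of ?g]) auto
qed

lemma cont_cpt_integrable:
  fixes f :: "real^'n::finite \<Rightarrow> real"
  assumes f: "continuous_on UNIV f" and supp: "\<And>x. x \<notin> cball a R \<Longrightarrow> f x = 0"
  shows "integrable lborel f"
proof -
  have b: "bounded {x. f x \<noteq> 0}" by (rule bounded_subset[OF bounded_cball[of a R]]) (use supp in blast)
  obtain B where B: "B > 0" "\<And>x. \<bar>f x\<bar> \<le> B" using cont_cpt_supp_bdd[OF f b] by blast
  show ?thesis
  proof (rule integrableI_bounded_set[of "cball a R" _ _ B])
    show "emeasure lborel (cball a R) < \<infinity>" by (rule emeasure_bounded_finite) simp
    show "f \<in> borel_measurable lborel" using borel_measurable_continuous_onI[OF f] by simp
    show "AE x in lborel. x \<notin> cball a R \<longrightarrow> f x = 0" by (rule AE_I2) (use supp in blast)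
  qed (use B in auto)
qed

text \<open>The divergence of the regularised flux of \<open>\<phi>\<close> divided by its positive
  scalar factor. The logarithmic term is what differentiating the exponent p contributes.\<close>

definition reg_op :: "(real^'n::finite \<Rightarrow> real) \<Rightarrow> (real^'n \<Rightarrow> real) \<Rightarrow> real \<Rightarrow> real^'n \<Rightarrow> real"
  where "reg_op p \<phi> \<delta> x = (\<Sum>i\<in>UNIV. partial i (partial i \<phi>) x)
     + (p x - 2) * (\<Sum>i\<in>UNIV. \<Sum>j\<in>UNIV. partial j (partial i \<phi>) x * partial i \<phi> x * partial j \<phi> x) / ((norm (grad \<phi> x))\<^sup>2 + \<delta>\<^sup>2)
     + ln ((norm (grad \<phi> x))\<^sup>2 + \<delta>\<^sup>2) / 2 * (grad p x \<bullet> grad \<phi> x)"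

text \<open>The constant \<open>c\<close> in the family absorbs the sign that each differentiation
  of a reflected function produces.\<close>

lemma smooth_reflect:
  assumes "smooth \<zeta>" shows "smooth (\<lambda>y. \<zeta> (x - y))"
proof (rule smooth_coinduct[of _ "{\<lambda>y. c * \<zeta> (x - y) | c \<zeta>. smooth \<zeta>}"])
  have *: "((\<lambda>y. c * \<zeta> (x - y)) has_derivative (\<lambda>h. c * (grad \<zeta> (x - y) \<bullet> (- h)))) (at y)" if "smooth \<zeta>" for c \<zeta> y
  proof -
    have "((\<lambda>y. \<zeta> (x - y)) has_derivative (\<lambda>h. grad \<zeta> (x - y) \<bullet> (- h))) (at y)"
      by (rule has_derivative_compose[OF _ has_derivative_grad[OF smooth_differentiable[OF that]]]) (auto intro!: derivative_eq_intros)
    then show ?thesis by (rule has_derivative_mult_right)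
  qed
  show "f differentiable (at z)" if "f \<in> {\<lambda>y. c * \<zeta> (x - y) | c \<zeta>. smooth \<zeta>}" for f z
    using that * unfolding differentiable_def by blast
  show "partial i f \<in> {\<lambda>y. c * \<zeta> (x - y) | c \<zeta>. smooth \<zeta>}" if f: "f \<in> {\<lambda>y. c * \<zeta> (x - y) | c \<zeta>. smooth \<zeta>}" for f i
  proof -
    obtain c \<zeta> where z: "smooth \<zeta>" "f = (\<lambda>y. c * \<zeta> (x - y))" using f by blast
    have "partial i f = (\<lambda>y. (- c) * partial i \<zeta> (x - y))"
      unfolding z(2) by (rule ext, subst partial_eq[OF *[OF z(1)]]) (simp add: inner_axis)
    then show ?thesis using smooth_partial[OF z(1)] by blast
  qed
  show "(\<lambda>y. \<zeta> (x - y)) \<in> {\<lambda>y. c * \<zeta> (x - y) | c \<zeta>. smooth \<zeta>}"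
    using assms by (intro CollectI exI[of _ 1] exI[of _ \<zeta>]) simp
qed

lemma partial_reflect:
  assumes "smooth \<zeta>" shows "partial i (\<lambda>y. \<zeta> (x - y)) y = - partial i \<zeta> (x - y)"
proof -
  have "((\<lambda>y. \<zeta> (x - y)) has_derivative (\<lambda>h. grad \<zeta> (x - y) \<bullet> (- h))) (at y)"
    by (rule has_derivative_compose[OF _ has_derivative_grad[OF smooth_differentiable[OF assms]]]) (auto intro!: derivative_eq_intros)
  from partial_eq[OF this] show ?thesis by (simp add: inner_axis)
qed

text \<open>\<open>sep\<close> compares \<open>\<phi>\<close> outside the small ball with all values
  of the zero extension of \<open>u\<close> within distance \<open>\<epsilon>0\<close>, which is
  what a mollification sees; it confines the truncation to \<open>cball x0 \<rho>\<close>.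
  \<open>ub\<close> and \<open>Vb\<close> are Borel representatives of \<open>u\<close> and its weak
  gradient, cut to zero off \<open>cball x0 r\<close> so that they can be convolved on the whole
  space.\<close>

locale comparison =
  fixes \<Omega> :: "(real^'n::finite) set" and p u \<phi> :: "real^'n \<Rightarrow> real" and V :: "real^'n \<Rightarrow> real^'n"
    and x0 :: "real^'n" and r \<rho> \<epsilon>0 \<delta>0 :: real and ub :: "real^'n \<Rightarrow> real" and Vb :: "real^'n \<Rightarrow> real^'n"
  assumes op: "open \<Omega>" and K: "cball x0 r \<subseteq> \<Omega>" and rad: "0 < \<rho>" "\<rho> < r" "0 < \<epsilon>0" "0 < \<delta>0"
    and p: "C_on 1 \<Omega> p" and p1: "\<And>x. x \<in> \<Omega> \<Longrightarrow> 1 < p x"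
    and W: "W1p_loc \<Omega> p u V"
    and weak: "\<And>\<psi>. test_function \<Omega> \<psi> \<Longrightarrow> (\<And>x. 0 \<le> \<psi> x) \<Longrightarrow>
        (LINT x:\<Omega>|lebesgue. ((norm (V x) powr (p x - 2)) *\<^sub>R V x) \<bullet> grad \<psi> x) \<le> 0"
    and \<phi>: "smooth \<phi>"
    and sep: "\<And>x z. x \<notin> cball x0 \<rho> \<Longrightarrow> dist x z < \<epsilon>0 \<Longrightarrow> (if z \<in> cball x0 r then u z else 0) \<le> \<phi> x"
    and super: "\<And>x \<delta>. x \<in> cball x0 \<rho> \<Longrightarrow> 0 < \<delta> \<Longrightarrow> \<delta> < \<delta>0 \<Longrightarrow> reg_op p \<phi> \<delta> x \<le> 0"
    and ub: "integrable lborel ub" "\<And>x. x \<notin> cball x0 r \<Longrightarrow> ub x = 0" "AE x in lborel. x \<in> cball x0 r \<longrightarrow> ub x = u x"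
    and Vb: "\<And>i. integrable lborel (\<lambda>x. Vb x $ i)" "\<And>x. x \<notin> cball x0 r \<Longrightarrow> Vb x = 0" "AE x in lborel. x \<in> cball x0 r \<longrightarrow> Vb x = V x"
    and gi: "integrable lborel (\<lambda>x. norm (Vb x) powr (if x \<in> cball x0 r then p x else 2))"
begin

text \<open>The exponent 2 off the ball is a default value above 1; \<open>Vb\<close> vanishes
  there, hence so does \<open>g\<close>, as \<open>0 powr s = 0\<close>.\<close>

definition "pb x = (if x \<in> cball x0 r then p x else 2)"
definition "g x = norm (Vb x) powr pb x"

lemma g: "integrable lborel g" "0 \<le> g x"
  using gi unfolding g_def[abs_def] pb_def by auto

lemma sub: "cball x0 \<rho> \<subseteq> cball x0 r" "cball x0 \<rho> \<subseteq> \<Omega>" using rad K by auto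

lemma pdiff: "x \<in> \<Omega> \<Longrightarrow> p differentiable (at x)" and pcont: "continuous_on \<Omega> (partial i p)"
  using p by auto

lemma p_cont: "continuous_on \<Omega> p"
  using pdiff by (auto intro!: continuous_at_imp_continuous_on differentiable_imp_continuous_within)

lemma pb1: "1 < pb x" using p1 K by (auto simp: pb_def)

lemma meas [measurable]: "pb \<in> borel_measurable borel" "ub \<in> borel_measurable borel"
  "(\<lambda>x. Vb x $ i) \<in> borel_measurable borel" "(\<lambda>x. norm (Vb x)) \<in> borel_measurable borel"
  "\<phi> \<in> borel_measurable borel" "partial i \<phi> \<in> borel_measurable borel"
proof -
  show "pb \<in> borel_measurable borel" unfolding pb_def
    by (intro borel_measurable_continuous_on_if continuous_on_subset[OF p_cont K] continuous_on_const) auto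
  show [measurable]: "(\<lambda>x. Vb x $ i) \<in> borel_measurable borel" for i
    using borel_measurable_integrable[OF Vb(1)] by simp
  show "(\<lambda>x. norm (Vb x)) \<in> borel_measurable borel"
    by (simp add: norm_vec_def L2_set_def) measurable
  show "ub \<in> borel_measurable borel" using borel_measurable_integrable[OF ub(1)] by simp
  show "\<phi> \<in> borel_measurable borel" "partial i \<phi> \<in> borel_measurable borel"
    by (intro smooth_borel smooth_partial \<phi>)+
qed

lemma transfer:
  assumes [measurable]: "h \<in> borel_measurable borel" and h: "\<And>x. x \<notin> cball x0 r \<Longrightarrow> h x = 0"
  shows "(LINT x:\<Omega>|lebesgue. u x * h x) = (LINT x|lborel. ub x * h x)"
    and "(LINT x:\<Omega>|lebesgue. V x $ i * h x) = (LINT x|lborel. Vb x $ i * h x)"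
proof -
  have "AE x in lborel. indicator \<Omega> x *\<^sub>R (u x * h x) = ub x * h x"
    using ub(3)
  proof eventually_elim
    case (elim x)
    then show ?case using h[of x] K by (cases "x \<in> cball x0 r") (auto simp: subset_iff)
  qed
  then show "(LINT x:\<Omega>|lebesgue. u x * h x) = (LINT x|lborel. ub x * h x)"
    unfolding set_lebesgue_integral_def by (intro lebesgue_AE_borel) auto
  have "AE x in lborel. indicator \<Omega> x *\<^sub>R (V x $ i * h x) = Vb x $ i * h x"
    using Vb(3)
  proof eventually_elim
    case (elim x)
    then show ?case using h[of x] K by (cases "x \<in> cball x0 r") (auto simp: subset_iff)
  qed
  then show "(LINT x:\<Omega>|lebesgue. V x $ i * h x) = (LINT x|lborel. Vb x $ i * h x)"
    unfolding set_lebesgue_integral_def by (intro lebesgue_AE_borel) auto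
qed

definition "ue \<epsilon> = convolve ub (mollifier \<epsilon>)"
definition "Ve \<epsilon> x = (\<chi> i. convolve (\<lambda>y. Vb y $ i) (mollifier \<epsilon>) x)"
definition "w \<epsilon> x = flat_fun 0 (ue \<epsilon> x - \<phi> x)"
text \<open>The gradient of the truncation \<open>w \<epsilon>\<close>, written with the mollified
  weak gradient \<open>Ve\<close> in place of the gradient of \<open>ue\<close>. The two agree in
  the small ball only; outside it the factor \<open>flat_fun 2\<close> vanishes.\<close>

definition "De \<epsilon> x = flat_fun 2 (ue \<epsilon> x - \<phi> x) *\<^sub>R (Ve \<epsilon> x - grad \<phi> x)"

text \<open>The definition of the weak gradient is tested with the reflected mollifier centred at
  \<open>x\<close>. This is a test function of \<open>\<Omega>\<close> supported in
  \<open>cball x0 r\<close>, because \<open>\<epsilon>\<close> is smaller than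
  \<open>r - \<rho>\<close>.\<close>

lemma ue_partial:
  assumes \<epsilon>: "0 < \<epsilon>" "\<epsilon> < r - \<rho>" and x: "x \<in> cball x0 \<rho>"
  shows "partial i (ue \<epsilon>) x = Ve \<epsilon> x $ i"
proof -
  have tm: "test_fun (mollifier \<epsilon> :: real^'n \<Rightarrow> real)" using \<epsilon> by (intro test_fun_mollifier)
  then have sm: "smooth (mollifier \<epsilon> :: real^'n \<Rightarrow> real)" by (simp add: test_fun_def)
  let ?\<psi> = "\<lambda>y. mollifier \<epsilon> (x - y)"
  have cb: "cball x \<epsilon> \<subseteq> cball x0 r"
  proof
    fix y assume "y \<in> cball x \<epsilon>"
    then show "y \<in> cball x0 r" using x \<epsilon> dist_triangle[of x0 y x] by simp
  qed
  have s: "closure {y. ?\<psi> y \<noteq> 0} \<subseteq> cball x \<epsilon>"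
    by (rule closure_minimal) (auto simp: dist_norm dest!: mollifier_supp[OF \<epsilon>(1)])
  have s2: "{y. ?\<psi> y \<noteq> 0} \<subseteq> cball x \<epsilon>" by (rule order_trans[OF closure_subset s])
  have "test_function \<Omega> ?\<psi>"
    unfolding test_function_iff test_fun_def
    by (intro conjI smooth_reflect[OF sm] bounded_subset[OF bounded_cball s2] order_trans[OF s] order_trans[OF cb K])
  then have "(LINT y:\<Omega>|lebesgue. u y * partial i ?\<psi> y) = - (LINT y:\<Omega>|lebesgue. V y $ i * ?\<psi> y)"
    using W by (simp add: W1p_loc_def weak_gradient_def)
  moreover have z: "y \<notin> cball x0 r \<Longrightarrow> ?\<psi> y = 0" "y \<notin> cball x0 r \<Longrightarrow> partial i ?\<psi> y = 0" for y
  proof -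
    assume "y \<notin> cball x0 r"
    then have y: "y \<notin> cball x \<epsilon>" using cb by blast
    then show "?\<psi> y = 0" using s2 by blast
    have "y \<notin> closure {y. ?\<psi> y \<noteq> 0}" using y s by blast
    then show "partial i ?\<psi> y = 0" by (rule partial_zero_outside)
  qed
  moreover have "?\<psi> \<in> borel_measurable borel" "partial i ?\<psi> \<in> borel_measurable borel"
    by (intro smooth_borel smooth_partial smooth_reflect[OF sm])+
  ultimately have "(LINT y|lborel. ub y * partial i ?\<psi> y) = - (LINT y|lborel. Vb y $ i * ?\<psi> y)"
    using transfer(1)[of "partial i ?\<psi>"] transfer(2)[of ?\<psi> i] by simp
  then have "convolve ub (partial i (mollifier \<epsilon>)) x = convolve (\<lambda>y. Vb y $ i) (mollifier \<epsilon>) x"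
    by (simp add: convolve_def partial_reflect[OF sm])
  then show ?thesis by (simp add: ue_def Ve_def partial_convolve[OF ub(1) tm])
qed

text \<open>The mollifier is a nonnegative weight of mass 1 that sees only points closer than
  \<open>\<epsilon>0\<close>, where \<open>sep\<close> applies.\<close>

lemma ue_le:
  assumes \<epsilon>: "0 < \<epsilon>" "\<epsilon> < \<epsilon>0" and x: "x \<notin> cball x0 \<rho>"
  shows "ue \<epsilon> x \<le> \<phi> x"
proof -
  have tm: "test_fun (mollifier \<epsilon> :: real^'n \<Rightarrow> real)" using \<epsilon> by (intro test_fun_mollifier)
  note mi = mollifier_reflect[OF \<epsilon>(1), of x]
  have "ue \<epsilon> x \<le> (LINT y|lborel. \<phi> x * mollifier \<epsilon> (x - y))"
    unfolding ue_def convolve_def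
  proof (rule integral_mono_AE[OF convolve_integrable[OF ub(1) tm] integrable_mult_right[OF mi(1)]])
    show "AE y in lborel. ub y * mollifier \<epsilon> (x - y) \<le> \<phi> x * mollifier \<epsilon> (x - y)"
      using ub(3)
    proof eventually_elim
      case (elim y)
      show ?case
      proof (cases "dist x y < \<epsilon>0")
        case True
        have "ub y = (if y \<in> cball x0 r then u y else 0)" using elim ub(2)[of y] by auto
        then have "ub y \<le> \<phi> x" using sep[OF x True] by simp
        then show ?thesis using mollifier_nonneg[OF \<epsilon>(1)] by (rule mult_right_mono)
      next
        case False
        then have "mollifier \<epsilon> (x - y) = 0" using mollifier_supp[OF \<epsilon>(1), of "x - y"] \<epsilon> by (force simp: dist_norm)
        then show ?thesis by simp
      qed
    qed
  qed
  also have "\<dots> = \<phi> x" using mi by simp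
  finally show ?thesis .
qed

lemma w_props:
  assumes \<epsilon>: "0 < \<epsilon>" "\<epsilon> < \<epsilon>0" "\<epsilon> < r - \<rho>"
  shows w_smooth: "smooth (w \<epsilon>)" and w_partial: "partial i (w \<epsilon>) x = De \<epsilon> x $ i"
    and w_zero: "x \<notin> cball x0 \<rho> \<Longrightarrow> w \<epsilon> x = 0" "x \<notin> cball x0 \<rho> \<Longrightarrow> De \<epsilon> x = 0"
proof -
  have tm: "test_fun (mollifier \<epsilon> :: real^'n \<Rightarrow> real)" using \<epsilon> by (intro test_fun_mollifier)
  have su: "smooth (ue \<epsilon>)" unfolding ue_def by (rule smooth_convolve[OF ub(1) tm])
  show "smooth (w \<epsilon>)" unfolding w_def by (intro smooth_flat_fun smooth_minus su \<phi>)
  show z1: "w \<epsilon> x = 0" if "x \<notin> cball x0 \<rho>" for x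
    using ue_le[OF \<epsilon>(1,2) that] by (simp add: w_def flat_fun_def)
  show z2: "De \<epsilon> x = 0" if "x \<notin> cball x0 \<rho>" for x
    using ue_le[OF \<epsilon>(1,2) that] by (simp add: De_def flat_fun_def)
  have d: "ue \<epsilon> differentiable (at x)" "\<phi> differentiable (at x)" "(\<lambda>x. ue \<epsilon> x - \<phi> x) differentiable (at x)"
    using smooth_differentiable su \<phi> by (auto intro!: differentiable_diff)
  have "partial i (\<lambda>x. ue \<epsilon> x - \<phi> x) x = partial i (ue \<epsilon>) x - partial i \<phi> x"
    by (subst partial_eq[OF has_derivative_diff[OF has_derivative_grad[OF d(1)] has_derivative_grad[OF d(2)]]])
      (simp add: inner_axis)
  then have e: "partial i (w \<epsilon>) x = flat_fun 2 (ue \<epsilon> x - \<phi> x) * (partial i (ue \<epsilon>) x - partial i \<phi> x)"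
    unfolding w_def using partial_flat_fun(2)[OF d(3), of i 0] by (simp add: numeral_2_eq_2)
  show "partial i (w \<epsilon>) x = De \<epsilon> x $ i"
  proof (cases "x \<in> cball x0 \<rho>")
    case True then show ?thesis using e ue_partial[OF \<epsilon>(1,3)] by (simp add: De_def)
  next
    case False
    then have "flat_fun 2 (ue \<epsilon> x - \<phi> x) = 0" using ue_le[OF \<epsilon>(1,2) False] by (simp add: flat_fun_def)
    then show ?thesis using e by (simp add: De_def)
  qed
qed

definition "A x = (norm (Vb x) powr (pb x - 2)) *\<^sub>R Vb x"
definition "B \<delta> x = (if x \<in> cball x0 r then (((norm (grad \<phi> x))\<^sup>2 + \<delta>\<^sup>2) powr ((p x - 2)/2)) *\<^sub>R grad \<phi> x else 0)"

lemma weak_ineq: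
  assumes \<epsilon>: "0 < \<epsilon>" "\<epsilon> < \<epsilon>0" "\<epsilon> < r - \<rho>"
  shows "(LINT x|lborel. A x \<bullet> De \<epsilon> x) \<le> 0"
proof -
  note wp = w_props[OF \<epsilon>]
  have gw: "grad (w \<epsilon>) x = De \<epsilon> x" for x by (simp add: vec_eq_iff wp(2))
  have "{x. w \<epsilon> x \<noteq> 0} \<subseteq> cball x0 \<rho>" using wp(3) by blast
  then have "bounded {x. w \<epsilon> x \<noteq> 0}" "closure {x. w \<epsilon> x \<noteq> 0} \<subseteq> \<Omega>"
    using sub(2) bounded_subset[OF bounded_cball] closure_minimal[OF _ closed_cball] by blast+
  then have "test_function \<Omega> (w \<epsilon>)" using wp(1) by (simp add: test_function_iff test_fun_def)
  moreover have "0 \<le> w \<epsilon> x" for x by (simp add: w_def flat_fun_nonneg)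
  ultimately have "(LINT x:\<Omega>|lebesgue. ((norm (V x) powr (p x - 2)) *\<^sub>R V x) \<bullet> De \<epsilon> x) \<le> 0"
    using weak[of "w \<epsilon>"] by (simp add: gw)
  moreover have "(LINT x:\<Omega>|lebesgue. ((norm (V x) powr (p x - 2)) *\<^sub>R V x) \<bullet> De \<epsilon> x) = (LINT x|lborel. A x \<bullet> De \<epsilon> x)"
    unfolding set_lebesgue_integral_def
  proof (rule lebesgue_AE_borel)
    have [measurable]: "(\<lambda>x. De \<epsilon> x $ i) \<in> borel_measurable borel" for i
      using smooth_borel[OF smooth_partial[OF wp(1), of i]] by (simp add: wp(2)[abs_def])
    show "(\<lambda>x. A x \<bullet> De \<epsilon> x) \<in> borel_measurable borel"
      unfolding A_def by (simp add: inner_vec_def) measurable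
    show "AE x in lborel. indicator \<Omega> x *\<^sub>R (((norm (V x) powr (p x - 2)) *\<^sub>R V x) \<bullet> De \<epsilon> x) = A x \<bullet> De \<epsilon> x"
      using Vb(3)
    proof eventually_elim
      case (elim x)
      then show ?case
        using wp(4)[of x] sub by (cases "x \<in> cball x0 \<rho>") (auto simp: A_def pb_def subset_iff)
    qed
  qed
  ultimately show ?thesis by simp
qed

text \<open>Integration by parts moves the derivative from the truncation to the regularised flux,
  whose divergence is a positive factor times \<open>reg_op\<close> and hence nonpositive where the
  nonnegative truncation lives.\<close>

lemma super_ineq:
  assumes \<epsilon>: "0 < \<epsilon>" "\<epsilon> < \<epsilon>0" "\<epsilon> < r - \<rho>" and \<delta>: "0 < \<delta>" "\<delta> < \<delta>0"
  shows "0 \<le> (LINT x|lborel. B \<delta> x \<bullet> De \<epsilon> x)"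
proof -
  note wp = w_props[OF \<epsilon>]
  define s where "s x = (\<Sum>j\<in>UNIV. partial j \<phi> x * partial j \<phi> x) + \<delta>\<^sup>2" for x
  define e where "e x = (p x - 2) / 2" for x
  have s_alt: "s x = (norm (grad \<phi> x))\<^sup>2 + \<delta>\<^sup>2" for x
    unfolding power2_norm_eq_inner by (simp add: s_def inner_vec_def)
  have s0: "s x > 0" for x using \<delta> by (simp add: s_alt add_nonneg_pos)
  have ss: "smooth s" unfolding s_def by (intro smooth_add smooth_sum smooth_mult smooth_partial smooth_const \<phi>) simp
  define ds where "ds i x = 2 * (\<Sum>j\<in>UNIV. partial j \<phi> x * partial i (partial j \<phi>) x)" for i x
  have ps: "partial i s x = ds i x" for i x
  proof -
    have "(s has_derivative (\<lambda>h. (\<Sum>j\<in>UNIV. partial j \<phi> x * (grad (partial j \<phi>) x \<bullet> h) + (grad (partial j \<phi>) x \<bullet> h) * partial j \<phi> x) + 0)) (at x)"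
      unfolding s_def
      by (intro has_derivative_add has_derivative_sum has_derivative_mult has_derivative_const
          has_derivative_grad smooth_differentiable smooth_partial \<phi>)
    from partial_eq[OF this] show ?thesis by (simp add: ds_def inner_axis sum_distrib_left mult.commute)
  qed
  define a where "a i x = s x powr e x * partial i \<phi> x" for i x
  define da where "da i x = (s x powr e x * (partial i p x / 2 * ln (s x) + ds i x * e x / s x)) * partial i \<phi> x
      + s x powr e x * partial i (partial i \<phi>) x" for i x
  have ad: "a i differentiable (at x)" "partial i (a i) x = da i x" if x: "x \<in> \<Omega>" for i x
  proof -
    have he: "(e has_derivative (\<lambda>h. (grad p x \<bullet> h) / 2)) (at x)"
      unfolding e_def using has_derivative_grad[OF pdiff[OF x]] by (auto intro!: derivative_eq_intros)
    have hs: "(s has_derivative (\<lambda>h. grad s x \<bullet> h)) (at x)" by (rule has_derivative_grad[OF smooth_differentiable[OF ss]])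
    have "((\<lambda>x. s x powr e x) has_derivative (\<lambda>h. s x powr e x * ((grad p x \<bullet> h) / 2 * ln (s x) + (grad s x \<bullet> h) * e x / s x))) (at x)"
      by (rule has_derivative_powr[OF hs he s0]) simp
    from has_derivative_mult[OF this has_derivative_grad[OF smooth_differentiable[OF smooth_partial[OF \<phi>]]]]
    have h: "(a i has_derivative (\<lambda>h. s x powr e x * (grad (partial i \<phi>) x \<bullet> h)
        + (s x powr e x * ((grad p x \<bullet> h) / 2 * ln (s x) + (grad s x \<bullet> h) * e x / s x)) * partial i \<phi> x)) (at x)"
      unfolding a_def .
    show "a i differentiable (at x)" using h differentiable_def by blast
    show "partial i (a i) x = da i x"
      by (subst partial_eq[OF h]) (simp add: inner_axis da_def ps)
  qed
  define G where "G i x = a i x * w \<epsilon> x" for i x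
  have wd: "w \<epsilon> differentiable (at x)" for x by (rule smooth_differentiable[OF wp(1)])
  have open2: "open (- cball x0 \<rho>)" by (simp add: open_Compl)
  have G0: "(G i has_derivative (\<lambda>h. 0)) (at x)" if x: "x \<notin> cball x0 \<rho>" for i x
    by (rule has_derivative_transform_within_open[OF has_derivative_const open2]) (use x wp(3) in \<open>auto simp: G_def\<close>)
  have Gd: "G i differentiable (at x)" for i x
  proof (cases "x \<in> cball x0 \<rho>")
    case True
    then show ?thesis unfolding G_def using ad(1) wd sub(2) by (intro differentiable_mult) auto
  next
    case False then show ?thesis using G0 differentiable_def by blast
  qed
  have Gp: "partial i (G i) x = da i x * w \<epsilon> x + a i x * partial i (w \<epsilon>) x" for i x
  proof (cases "x \<in> cball x0 \<rho>")
    case True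
    then have "x \<in> \<Omega>" using sub by blast
    then show ?thesis unfolding G_def using partial_mult[OF ad(1) wd] ad(2) by simp
  next
    case False
    then show ?thesis using wp(2-4) by (simp add: partial_eq[OF G0])
  qed
  have c1: "continuous_on \<Omega> (da i)" "continuous_on \<Omega> (a i)" for i
  proof -
    have cs: "continuous_on \<Omega> s" by (rule smooth_cont[OF ss])
    have ce: "continuous_on \<Omega> e" unfolding e_def by (intro continuous_intros p_cont) auto
    have cse: "continuous_on \<Omega> (\<lambda>x. s x powr e x)"
      by (rule continuous_on_powr[OF cs ce]) (use s0 less_imp_neq in \<open>metis\<close>)
    have cph: "continuous_on \<Omega> (partial j \<phi>)" "continuous_on \<Omega> (partial j (partial l \<phi>))" for j l
      by (intro smooth_cont smooth_partial \<phi>)+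
    have s0': "s x \<noteq> 0" for x using s0[of x] by simp
    have cds: "continuous_on \<Omega> (ds i)" unfolding ds_def by (intro continuous_intros cph)
    show "continuous_on \<Omega> (a i)" unfolding a_def by (intro continuous_intros cse cph)
    show "continuous_on \<Omega> (da i)" unfolding da_def
      by (intro continuous_intros cse cph cds ce cs pcont) (use s0' in auto)
  qed
  \<comment> \<open>The flux is C^1 in \<open>\<Omega>\<close> only. Its products with the
    truncation vanish off the small ball, so continuity on the whole space is glued from these two
    open sets.\<close>
  have cov: "\<Omega> \<union> - cball x0 \<rho> = UNIV" using sub by blast
  have c2: "continuous_on UNIV (\<lambda>x. f x * h x)"
    if "continuous_on \<Omega> f" "continuous_on UNIV h" "\<And>x. x \<notin> cball x0 \<rho> \<Longrightarrow> h x = 0" for f h :: "real^'n \<Rightarrow> real"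
  proof -
    have "continuous_on (\<Omega> \<union> - cball x0 \<rho>) (\<lambda>x. f x * h x)"
    proof (rule continuous_on_open_Un[OF op open2])
      show "continuous_on \<Omega> (\<lambda>x. f x * h x)" by (intro continuous_intros that continuous_on_subset[OF that(2)]) auto
      have "continuous_on (- cball x0 \<rho>) (\<lambda>x. 0 :: real)" by simp
      then show "continuous_on (- cball x0 \<rho>) (\<lambda>x. f x * h x)"
        by (rule continuous_on_eq) (use that(3) in auto)
    qed
    then show ?thesis unfolding cov .
  qed
  have pz: "x \<notin> cball x0 \<rho> \<Longrightarrow> partial i (w \<epsilon>) x = 0" for i x using wp(2,4) by simp
  have cc1: "continuous_on UNIV (\<lambda>x. da i x * w \<epsilon> x)" for i by (rule c2[OF c1(1) smooth_cont[OF wp(1)] wp(3)])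
  have cc2: "continuous_on UNIV (\<lambda>x. a i x * partial i (w \<epsilon>) x)" for i
    by (rule c2[OF c1(2) smooth_cont[OF smooth_partial[OF wp(1)]] pz])
  have i1: "integrable lborel (\<lambda>x. da i x * w \<epsilon> x)" for i
    by (rule cont_cpt_integrable[OF cc1, of x0 \<rho>]) (simp add: wp(3))
  have i2: "integrable lborel (\<lambda>x. a i x * partial i (w \<epsilon>) x)" for i
    by (rule cont_cpt_integrable[OF cc2, of x0 \<rho>]) (simp add: pz)
  have z: "(LINT x|lborel. da i x * w \<epsilon> x) + (LINT x|lborel. a i x * partial i (w \<epsilon>) x) = 0" for i
  proof -
    have "(LINT x|lborel. partial i (G i) x) = 0"
    proof (rule integral_partial_eq_0[OF Gd])
      show "bounded {x. G i x \<noteq> 0}"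
      proof (rule bounded_subset[OF bounded_cball[of x0 \<rho>]], rule subsetI)
        fix x assume "x \<in> {x. G i x \<noteq> 0}"
        then show "x \<in> cball x0 \<rho>" using wp(3)[of x] by (auto simp: G_def)
      qed
      show "continuous_on UNIV (partial i (G i))"
        unfolding Gp[abs_def] by (intro continuous_on_add cc1 cc2)
    qed
    then show ?thesis unfolding Gp[abs_def] using i1 i2 by simp
  qed
  \<comment> \<open>Here the divergence is identified: the logarithm comes from the exponent, the
    quotient by \<open>s x\<close> from the base of the power.\<close>
  have key: "(\<Sum>i\<in>UNIV. da i x) = s x powr e x * reg_op p \<phi> \<delta> x" for x
  proof -
    have "(\<Sum>i\<in>UNIV. da i x) = (\<Sum>i\<in>UNIV. s x powr e x * (partial i p x * partial i \<phi> x * (ln (s x) / 2)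
        + (p x - 2) * (\<Sum>j\<in>UNIV. partial i (partial j \<phi>) x * partial j \<phi> x * partial i \<phi> x) / s x
        + partial i (partial i \<phi>) x))"
    proof (rule sum.cong[OF refl])
      fix i :: 'n
      have T: "ds i x * e x / s x * partial i \<phi> x = (p x - 2) * (\<Sum>j\<in>UNIV. partial i (partial j \<phi>) x * partial j \<phi> x * partial i \<phi> x) / s x"
      proof -
        have "(\<Sum>j\<in>UNIV. partial i (partial j \<phi>) x * partial j \<phi> x * partial i \<phi> x)
          = (\<Sum>j\<in>UNIV. partial j \<phi> x * partial i (partial j \<phi>) x) * partial i \<phi> x"
          unfolding sum_distrib_right by (intro sum.cong refl) simp
        then show ?thesis unfolding ds_def e_def by (simp add: mult_ac)
      qed
      have "da i x = s x powr e x * (partial i p x * partial i \<phi> x * (ln (s x) / 2)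
        + ds i x * e x / s x * partial i \<phi> x + partial i (partial i \<phi>) x)"
        unfolding da_def by (simp add: algebra_simps)
      then show "da i x = s x powr e x * (partial i p x * partial i \<phi> x * (ln (s x) / 2)
        + (p x - 2) * (\<Sum>j\<in>UNIV. partial i (partial j \<phi>) x * partial j \<phi> x * partial i \<phi> x) / s x
        + partial i (partial i \<phi>) x)"
        unfolding T .
    qed
    also have "\<dots> = s x powr e x * (((\<Sum>i\<in>UNIV. partial i p x * partial i \<phi> x) * (ln (s x) / 2))
        + (p x - 2) * (\<Sum>i\<in>UNIV. \<Sum>j\<in>UNIV. partial i (partial j \<phi>) x * partial j \<phi> x * partial i \<phi> x) / s x
        + (\<Sum>i\<in>UNIV. partial i (partial i \<phi>) x))"
      by (simp add: sum_distrib_left[symmetric] sum.distrib sum_distrib_right[symmetric] sum_divide_distrib[symmetric])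
    also have "(\<Sum>i\<in>UNIV. \<Sum>j\<in>UNIV. partial i (partial j \<phi>) x * partial j \<phi> x * partial i \<phi> x)
        = (\<Sum>i\<in>UNIV. \<Sum>j\<in>UNIV. partial j (partial i \<phi>) x * partial i \<phi> x * partial j \<phi> x)"
      by (subst sum.swap) simp
    also have "(\<Sum>i\<in>UNIV. partial i p x * partial i \<phi> x) = grad p x \<bullet> grad \<phi> x" by (simp add: inner_vec_def)
    finally show ?thesis by (simp add: reg_op_def s_alt algebra_simps)
  qed
  have "(LINT x|lborel. B \<delta> x \<bullet> De \<epsilon> x) = (LINT x|lborel. (\<Sum>i\<in>UNIV. a i x * partial i (w \<epsilon>) x))"
  proof (rule Bochner_Integration.integral_cong[OF refl])
    fix x
    show "B \<delta> x \<bullet> De \<epsilon> x = (\<Sum>i\<in>UNIV. a i x * partial i (w \<epsilon>) x)"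
    proof (cases "x \<in> cball x0 \<rho>")
      case True
      then have "x \<in> cball x0 r" using sub by blast
      then show ?thesis by (simp add: B_def a_def e_def s_alt inner_vec_def wp(2))
    next
      case False
      then show ?thesis using wp(4) pz by simp
    qed
  qed
  also have "\<dots> = (\<Sum>i\<in>UNIV. LINT x|lborel. a i x * partial i (w \<epsilon>) x)" using i2 by simp
  also have "\<dots> = (\<Sum>i\<in>UNIV. - (LINT x|lborel. da i x * w \<epsilon> x))" using z by (intro sum.cong) (auto simp: add_eq_0_iff)
  also have "\<dots> = (LINT x|lborel. - ((\<Sum>i\<in>UNIV. da i x) * w \<epsilon> x))"
    using i1 by (simp add: sum_negf sum_distrib_right)
  also have "\<dots> \<ge> 0"
  proof (rule integral_nonneg_AE[OF AE_I2])
    fix x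
    show "0 \<le> - ((\<Sum>i\<in>UNIV. da i x) * w \<epsilon> x)"
    proof (cases "x \<in> cball x0 \<rho>")
      case True
      then have "s x powr e x * reg_op p \<phi> \<delta> x \<le> 0" using super \<delta> by (intro mult_nonneg_nonpos) auto
      moreover have "0 \<le> w \<epsilon> x" by (simp add: w_def flat_fun_nonneg)
      ultimately show ?thesis using mult_nonpos_nonneg unfolding key by fastforce
    next
      case False then show ?thesis using wp(3) by simp
    qed
  qed
  finally show ?thesis .
qed

end

section \<open>Passage to the limit\<close>

lemma flat_fun_tendsto: "(f \<longlongrightarrow> t) F \<Longrightarrow> ((\<lambda>x. flat_fun k (f x)) \<longlongrightarrow> flat_fun k t) F"
  using DERIV_isCont[OF flat_fun_deriv] isCont_tendsto_compose by blast

lemma flat_fun_borel [measurable]: "flat_fun k \<in> borel_measurable borel"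
  by (rule borel_measurable_continuous_onI)
    (intro continuous_at_imp_continuous_on ballI DERIV_isCont[OF flat_fun_deriv])

lemma norm_axis_real: "norm (axis i c :: real^'n::finite) = \<bar>c\<bar>"
proof -
  have "(axis i c :: real^'n) = c *\<^sub>R axis i 1" by (simp add: vec_eq_iff axis_def)
  then show ?thesis by simp
qed

lemma cball_borel [measurable]: "cball (a :: 'a::metric_space) b \<in> sets borel"
  by (simp add: borel_closed)

context comparison
begin

lemma p_bounds:
  obtains L m P where "L \<ge> 0" "m > 1" "\<And>x. x \<in> cball x0 r \<Longrightarrow> m \<le> p x \<and> p x \<le> P"
    "\<And>x y. x \<in> cball x0 r \<Longrightarrow> y \<in> cball x0 r \<Longrightarrow> \<bar>p x - p y\<bar> \<le> L * norm (x - y)"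
proof -
  have ne: "cball x0 r \<noteq> {}" using rad by auto
  have c: "continuous_on (cball x0 r) p" by (rule continuous_on_subset[OF p_cont K])
  obtain xm where xm: "xm \<in> cball x0 r" "\<forall>y\<in>cball x0 r. p xm \<le> p y"
    using continuous_attains_inf[OF compact_cball ne c] by blast
  obtain xM where xM: "xM \<in> cball x0 r" "\<forall>y\<in>cball x0 r. p y \<le> p xM"
    using continuous_attains_sup[OF compact_cball ne c] by blast
  have "\<exists>b. \<forall>x\<in>cball x0 r. \<bar>partial i p x\<bar> \<le> b" for i
  proof -
    have "compact (partial i p ` cball x0 r)"
      by (intro compact_continuous_image continuous_on_subset[OF pcont K] compact_cball)
    then have "bounded (partial i p ` cball x0 r)" by (rule compact_imp_bounded)
    then obtain b where "\<forall>y\<in>partial i p ` cball x0 r. norm y \<le> b" unfolding bounded_iff by blast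
    then show ?thesis by auto
  qed
  then obtain b where b: "\<And>i x. x \<in> cball x0 r \<Longrightarrow> \<bar>partial i p x\<bar> \<le> b i" by metis
  have gb: "norm (grad p x) \<le> \<bar>sum b UNIV\<bar>" if "x \<in> cball x0 r" for x
  proof -
    have "(\<Sum>i\<in>UNIV. \<bar>grad p x $ i\<bar>) \<le> sum b UNIV" using b[OF that] by (intro sum_mono) simp
    then show ?thesis using norm_le_l1_cart[of "grad p x"] by linarith
  qed
  show ?thesis
  proof (rule that[of "\<bar>sum b UNIV\<bar>" "p xm" "p xM"])
    show "p xm > 1" using xm(1) K p1 by blast
    show "\<bar>p x - p y\<bar> \<le> \<bar>sum b UNIV\<bar> * norm (x - y)" if "x \<in> cball x0 r" "y \<in> cball x0 r" for x y
      using K pdiff by (intro grad_bound_lipschitz[OF convex_cball _ gb that]) auto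
  qed (use xm xM in auto)
qed

text \<open>Apply \<open>convolve_powr_bound\<close> with q = p(x) - L \<epsilon>, a lower bound of
  p on the mollification ball. The surplus factor has exponent L \<epsilon> and is bounded by
  \<open>log_hoelder_factor\<close>, uniformly in \<epsilon>.\<close>

lemma Ve_bound:
  obtains \<epsilon>1 C1 where "0 < \<epsilon>1" "\<epsilon>1 \<le> \<epsilon>0" "\<epsilon>1 \<le> r - \<rho>" "C1 \<ge> 0"
    "\<And>\<epsilon> x. 0 < \<epsilon> \<Longrightarrow> \<epsilon> < \<epsilon>1 \<Longrightarrow> x \<in> cball x0 \<rho> \<Longrightarrow> norm (Ve \<epsilon> x) powr pb x \<le> C1 * (1 + convolve g (mollifier \<epsilon>) x)"
proof -
  obtain L m P where b: "L \<ge> 0" "m > 1" "\<And>x. x \<in> cball x0 r \<Longrightarrow> m \<le> p x \<and> p x \<le> P"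
    "\<And>x y. x \<in> cball x0 r \<Longrightarrow> y \<in> cball x0 r \<Longrightarrow> \<bar>p x - p y\<bar> \<le> L * norm (x - y)"
    using p_bounds by blast
  obtain C where C: "C > 0" "\<forall>\<epsilon>>0. \<forall>x :: real^'n. mollifier \<epsilon> x \<le> C / \<epsilon>^CARD('n)" using mollifier_bound by blast
  define C' where "C' = C * (LINT y|lborel. g y)"
  have C': "C' \<ge> 0" unfolding C'_def using C(1) g(2) by (intro mult_nonneg_nonneg integral_nonneg_AE AE_I2) auto
  \<comment> \<open>The last entry guarantees q >= 1, since p is at least m > 1 on the ball; the
    others keep the mollification ball inside \<open>cball x0 r\<close> and the logarithm estimate
    valid.\<close>
  define \<epsilon>1 where "\<epsilon>1 = min (min \<epsilon>0 (r - \<rho>)) (min 1 ((m - 1) / (L + 1)))"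
  define C1 where "C1 = 2 powr P * ((1 + C') powr L * exp (L * real CARD('n)))"
  show ?thesis
  proof (rule that[of \<epsilon>1 C1])
    show "0 < \<epsilon>1" using rad b by (simp add: \<epsilon>1_def)
    show "C1 \<ge> 0" by (simp add: C1_def)
    fix \<epsilon> x assume \<epsilon>: "0 < \<epsilon>" "\<epsilon> < \<epsilon>1" and x: "x \<in> cball x0 \<rho>"
    have xr: "x \<in> cball x0 r" using x sub by blast
    let ?q = "p x - L * \<epsilon>"
    have e1: "\<epsilon> < r - \<rho>" "\<epsilon> \<le> 1" "\<epsilon> * (L + 1) \<le> m - 1"
      using \<epsilon> b(1) by (auto simp: \<epsilon>1_def field_simps)
    have q1: "?q \<ge> 1" using e1(3) b(3)[OF xr] \<epsilon> by (simp add: algebra_simps)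
    have pbx: "pb x = p x" using xr by (simp add: pb_def)
    have Py: "?q \<le> pb y" if "norm (x - y) < \<epsilon>" for y
    proof -
      have "y \<in> cball x0 r" using x that e1(1) dist_triangle[of x0 y x] by (simp add: dist_norm)
      moreover from this have "\<bar>p x - p y\<bar> \<le> L * norm (x - y)" using b(4) xr by blast
      moreover have "L * norm (x - y) \<le> L * \<epsilon>" using that b(1) by (intro mult_left_mono) auto
      ultimately show ?thesis by (simp add: pb_def)
    qed
    define G where "G = 1 + convolve g (mollifier \<epsilon>) x"
    have "norm (Ve \<epsilon> x) powr pb x \<le> 2 powr pb x * G * G powr (pb x - ?q)"
      unfolding Ve_def G_def g_def[abs_def]
      by (rule convolve_powr_bound[OF Vb(1) _ \<epsilon>(1) q1 Py]) (use g(1) pbx b(1) \<epsilon>(1) in \<open>simp_all add: g_def[abs_def]\<close>)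
    also have "pb x - ?q = L * \<epsilon>" using pbx by simp
    also have "2 powr pb x * G * G powr (L * \<epsilon>) \<le> 2 powr P * G * ((1 + C') powr L * exp (L * real CARD('n)))"
    proof -
      have "convolve g (mollifier \<epsilon>) x \<le> C / \<epsilon>^CARD('n) * (LINT y|lborel. g y)" "0 \<le> convolve g (mollifier \<epsilon>) x"
        using convolve_le_bound[OF g _ \<epsilon>(1)] C(2) \<epsilon>(1) by blast+
      then have G: "1 \<le> G" "G \<le> 1 + C' / \<epsilon>^CARD('n)" by (auto simp: G_def C'_def)
      have "G powr (L * \<epsilon>) \<le> (1 + C') powr L * exp (L * real CARD('n))"
        by (rule log_hoelder_factor[OF \<epsilon>(1) e1(2) C' b(1) G])
      moreover have "2 powr pb x \<le> 2 powr P" using b(3)[OF xr] pbx by (intro powr_mono) auto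
      ultimately show ?thesis using G(1) by (intro mult_mono) auto
    qed
    also have "\<dots> = C1 * (1 + convolve g (mollifier \<epsilon>) x)" by (simp add: C1_def G_def)
    finally show "norm (Ve \<epsilon> x) powr pb x \<le> C1 * (1 + convolve g (mollifier \<epsilon>) x)" .
  qed (simp_all add: \<epsilon>1_def)
qed

lemma approx_sequence:
  assumes "0 < \<epsilon>1"
  obtains e :: "nat \<Rightarrow> real" where "\<And>m. 0 < e m \<and> e m < \<epsilon>1"
    "AE x in lborel. (\<lambda>m. ue (e m) x) \<longlonglongrightarrow> ub x" "AE x in lborel. (\<lambda>m. Ve (e m) x) \<longlonglongrightarrow> Vb x"
    "AE x in lborel. (\<lambda>m. convolve g (mollifier (e m)) x) \<longlonglongrightarrow> g x"
    "\<And>m. integrable lborel (convolve g (mollifier (e m)))" "(\<lambda>m. LINT x|lborel. \<bar>convolve g (mollifier (e m)) x - g x\<bar>) \<longlonglongrightarrow> 0"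
proof -
  \<comment> \<open>The double successor keeps the first member strictly below
    \<open>\<epsilon>1\<close>.\<close>
  define e0 where "e0 m = \<epsilon>1 * inverse (real (Suc (Suc m)))" for m
  have e0: "0 < e0 m" "e0 m < \<epsilon>1" for m using assms by (auto simp: e0_def field_simps intro!: add_pos_nonneg)
  have "(\<lambda>m. inverse (real (Suc (Suc m)))) \<longlonglongrightarrow> 0" using LIMSEQ_Suc[OF LIMSEQ_inverse_real_of_nat] .
  then have e00: "e0 \<longlonglongrightarrow> 0" unfolding e0_def by (rule tendsto_mult_right_zero)
  note T = L1_mollifier_tendsto[OF _ e0(1) e00]
  \<comment> \<open>Adding up all L1 errors yields a single subsequence along which the function,
    all gradient components and the mollified energy converge almost everywhere.\<close>
  define E where "E m x = \<bar>ue (e0 m) x - ub x\<bar> + (\<Sum>i\<in>UNIV. \<bar>Ve (e0 m) x $ i - Vb x $ i\<bar>) + \<bar>convolve g (mollifier (e0 m)) x - g x\<bar>" for m x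
  have i1: "integrable lborel (\<lambda>x. \<bar>ue (e0 m) x - ub x\<bar>)" for m using T(1)[OF ub(1)] ub(1) by (simp add: ue_def)
  have i2: "integrable lborel (\<lambda>x. \<bar>Ve (e0 m) x $ i - Vb x $ i\<bar>)" for m i using T(1)[OF Vb(1)] Vb(1) by (simp add: Ve_def)
  have i3: "integrable lborel (\<lambda>x. \<bar>convolve g (mollifier (e0 m)) x - g x\<bar>)" for m using T(1)[OF g(1)] g(1) by simp
  have Ei: "integrable lborel (E m)" for m
    unfolding E_def by (intro Bochner_Integration.integrable_add Bochner_Integration.integrable_sum i1 i2 i3)
  have E0: "0 \<le> E m x" for m x unfolding E_def by (intro add_nonneg_nonneg sum_nonneg) auto
  have "(\<lambda>m. LINT x|lborel. norm (E m x)) \<longlonglongrightarrow> 0"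
  proof -
    have "(LINT x|lborel. norm (E m x)) = (LINT x|lborel. \<bar>ue (e0 m) x - ub x\<bar>)
        + (\<Sum>i\<in>UNIV. LINT x|lborel. \<bar>Ve (e0 m) x $ i - Vb x $ i\<bar>) + (LINT x|lborel. \<bar>convolve g (mollifier (e0 m)) x - g x\<bar>)" for m
    proof -
      have "(LINT x|lborel. norm (E m x)) = (LINT x|lborel. E m x)" using E0 by simp
      then show ?thesis unfolding E_def using i1 i2 i3 by simp
    qed
    moreover have "(\<lambda>m. (LINT x|lborel. \<bar>ue (e0 m) x - ub x\<bar>)
        + (\<Sum>i\<in>UNIV. LINT x|lborel. \<bar>Ve (e0 m) x $ i - Vb x $ i\<bar>) + (LINT x|lborel. \<bar>convolve g (mollifier (e0 m)) x - g x\<bar>))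
      \<longlonglongrightarrow> 0 + (\<Sum>i\<in>(UNIV::'n set). 0) + 0"
      using T(2)[OF ub(1)] T(2)[OF Vb(1)] T(2)[OF g(1)]
      by (intro tendsto_add tendsto_sum) (simp_all add: ue_def Ve_def)
    ultimately show ?thesis by simp
  qed
  from tendsto_L1_AE_subseq[OF Ei this]
  obtain s where s: "strict_mono s" "AE x in lborel. (\<lambda>m. E (s m) x) \<longlonglongrightarrow> 0" by blast
  have 1: "AE x in lborel. (\<lambda>m. ue (e0 (s m)) x) \<longlonglongrightarrow> ub x \<and> (\<lambda>m. Ve (e0 (s m)) x) \<longlonglongrightarrow> Vb x \<and> (\<lambda>m. convolve g (mollifier (e0 (s m))) x) \<longlonglongrightarrow> g x"
    using s(2)
  proof eventually_elim
    case (elim x)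
    have sn: "0 \<le> (\<Sum>i\<in>UNIV. \<bar>Ve (e0 m) x $ i - Vb x $ i\<bar>)" for m by (intro sum_nonneg) auto
    have "norm (ue (e0 m) x - ub x) \<le> E m x" "norm (convolve g (mollifier (e0 m)) x - g x) \<le> E m x" for m
      unfolding E_def using sn[of m] by auto
    then have a: "(\<lambda>m. ue (e0 (s m)) x - ub x) \<longlonglongrightarrow> 0" "(\<lambda>m. convolve g (mollifier (e0 (s m))) x - g x) \<longlonglongrightarrow> 0"
      by (intro Lim_null_comparison[OF _ elim] always_eventually allI; simp)+
    have "norm (Ve (e0 m) x $ i - Vb x $ i) \<le> E m x" for m i
      unfolding E_def using member_le_sum[of i UNIV "\<lambda>i. \<bar>Ve (e0 m) x $ i - Vb x $ i\<bar>"] by simp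
    then have "(\<lambda>m. Ve (e0 (s m)) x $ i - Vb x $ i) \<longlonglongrightarrow> 0" for i
      by (intro Lim_null_comparison[OF _ elim] always_eventually allI) simp
    then have "(\<lambda>m. Ve (e0 (s m)) x) \<longlonglongrightarrow> Vb x"
      by (intro vec_tendstoI) (simp add: LIM_zero_iff)
    with a show ?case by (simp add: LIM_zero_iff)
  qed
  show ?thesis
  proof (rule that[of "\<lambda>m. e0 (s m)"])
    show "0 < e0 (s m) \<and> e0 (s m) < \<epsilon>1" for m using e0 by simp
    show "AE x in lborel. (\<lambda>m. ue (e0 (s m)) x) \<longlonglongrightarrow> ub x" using 1 by eventually_elim simp
    show "AE x in lborel. (\<lambda>m. Ve (e0 (s m)) x) \<longlonglongrightarrow> Vb x" using 1 by eventually_elim simp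
    show "AE x in lborel. (\<lambda>m. convolve g (mollifier (e0 (s m))) x) \<longlonglongrightarrow> g x" using 1 by eventually_elim simp
    show "integrable lborel (convolve g (mollifier (e0 (s m))))" for m using T(1)[OF g(1)] .
    show "(\<lambda>m. LINT x|lborel. \<bar>convolve g (mollifier (e0 (s m))) x - g x\<bar>) \<longlonglongrightarrow> 0"
      using LIMSEQ_subseq_LIMSEQ[OF T(2)[OF g(1)] s(1)] by (simp add: o_def)
  qed
qed

definition "D x = indicator (cball x0 \<rho>) x *\<^sub>R (flat_fun 2 (ub x - \<phi> x) *\<^sub>R (Vb x - grad \<phi> x))"

lemma D_meas [measurable]: "(\<lambda>x. D x $ i) \<in> borel_measurable borel"
  unfolding D_def by simp

lemma grad_bound:
  obtains Q where "Q \<ge> 0" "\<And>x. x \<in> cball x0 \<rho> \<Longrightarrow> norm (grad \<phi> x) \<le> Q"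
proof -
  have "compact (grad \<phi> ` cball x0 \<rho>)"
    unfolding grad_def by (intro compact_continuous_image compact_cball continuous_on_vec_lambda smooth_cont smooth_partial \<phi>)
  then have "bounded (grad \<phi> ` cball x0 \<rho>)" by (rule compact_imp_bounded)
  then obtain b where "b > 0" "\<forall>y\<in>grad \<phi> ` cball x0 \<rho>. norm y \<le> b" unfolding bounded_pos by blast
  then show ?thesis using that[of b] by auto
qed

end

locale comparison_limit = comparison \<Omega> p u \<phi> V x0 r \<rho> \<epsilon>0 \<delta>0 ub Vb
  for \<Omega> :: "(real^'n::finite) set" and p u \<phi> V x0 r \<rho> \<epsilon>0 \<delta>0 ub Vb +
  fixes e :: "nat \<Rightarrow> real" and C1 :: real
  assumes e: "\<And>m. 0 < e m" "\<And>m. e m < \<epsilon>0" "\<And>m. e m < r - \<rho>"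
    and C1: "C1 \<ge> 0" "\<And>m x. x \<in> cball x0 \<rho> \<Longrightarrow> norm (Ve (e m) x) powr pb x \<le> C1 * (1 + convolve g (mollifier (e m)) x)"
    and ae: "AE x in lborel. (\<lambda>m. ue (e m) x) \<longlonglongrightarrow> ub x" "AE x in lborel. (\<lambda>m. Ve (e m) x) \<longlonglongrightarrow> Vb x"
      "AE x in lborel. (\<lambda>m. convolve g (mollifier (e m)) x) \<longlonglongrightarrow> g x"
    and L1: "\<And>m. integrable lborel (convolve g (mollifier (e m)))" "(\<lambda>m. LINT x|lborel. \<bar>convolve g (mollifier (e m)) x - g x\<bar>) \<longlonglongrightarrow> 0"
begin

lemma De_tendsto: "AE x in lborel. (\<lambda>m. De (e m) x) \<longlonglongrightarrow> D x"
  using ae(1,2)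
proof eventually_elim
  case (elim x)
  show ?case
  proof (cases "x \<in> cball x0 \<rho>")
    case True
    have "(\<lambda>m. De (e m) x) \<longlonglongrightarrow> flat_fun 2 (ub x - \<phi> x) *\<^sub>R (Vb x - grad \<phi> x)"
      unfolding De_def by (intro tendsto_scaleR flat_fun_tendsto tendsto_diff tendsto_const elim)
    then show ?thesis using True by (simp add: D_def)
  next
    case False
    then show ?thesis using w_zero(2)[OF e False] by (simp add: D_def)
  qed
qed

text \<open>The growth of order p - 1 covers the flux of \<open>u\<close> as well as bounded fields.
  Young's inequality in the form t^(P-1) N <= t^P + N^P reduces the pairing to energies, and N^P is
  controlled by the mollified energy, which converges in L1.\<close>

lemma limit:
  assumes [measurable]: "\<And>i. (\<lambda>x. F x $ i) \<in> borel_measurable borel" and "c \<ge> 0"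
    and F: "\<And>x. x \<in> cball x0 \<rho> \<Longrightarrow> norm (F x) \<le> c * (1 + norm (Vb x) powr (pb x - 1))"
  shows "integrable lborel (\<lambda>x. F x \<bullet> D x)" "(\<lambda>m. LINT x|lborel. F x \<bullet> De (e m) x) \<longlonglongrightarrow> (LINT x|lborel. F x \<bullet> D x)"
proof -
  obtain Q where Q: "Q \<ge> 0" "\<And>x. x \<in> cball x0 \<rho> \<Longrightarrow> norm (grad \<phi> x) \<le> Q" using grad_bound by blast
  obtain H' where H': "\<And>t. flat_fun 2 t \<le> H'" using flat_fun_bdd by blast
  define H where "H = max 0 H'"
  have H: "0 \<le> H" "flat_fun 2 t \<le> H" for t using H'[of t] by (auto simp: H_def)
  have cH: "0 \<le> c * H" using \<open>c \<ge> 0\<close> H(1) by simp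
  \<comment> \<open>These collect the bounds \<open>a1\<close> to \<open>a4\<close> below: each
    power of the mollified gradient costs \<open>C1\<close> times 1 plus the mollified energy, and
    \<open>Q\<close> bounds the gradient of the touching function.\<close>
  define c0 c1 c2 where "c0 = c * H * (1 + 2 * Q + 2 * C1)" and "c1 = c * H * (2 * C1)" and "c2 = c * H * (1 + Q)"
  have c1: "c1 \<ge> 0" using cH C1 by (simp add: c1_def)
  let ?I = "\<lambda>x. indicator (cball x0 \<rho>) x :: real"
  define G where "G m x = ?I x * (c0 + c1 * convolve g (mollifier (e m)) x + c2 * g x)" for m x
  define G0 where "G0 x = ?I x * (c0 + c1 * g x + c2 * g x)" for x
  have [measurable]: "(\<lambda>x. De (e m) x $ i) \<in> borel_measurable borel" for m i
    using smooth_borel[OF smooth_partial[OF w_smooth[OF e]]] by (simp add: w_partial[OF e, abs_def])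
  have Ic: "integrable lborel (\<lambda>x. ?I x * f x)" if "integrable lborel f" for f
    by (rule Bochner_Integration.integrable_bound[OF that])
      (use borel_measurable_integrable[OF that] in \<open>auto split: split_indicator\<close>)
  have Ii: "integrable lborel ?I" by (rule integrable_indicator_cball)
  have Gi: "integrable lborel (G m)" for m
  proof -
    have "G m = (\<lambda>x. c0 * ?I x + ?I x * (c1 * convolve g (mollifier (e m)) x) + ?I x * (c2 * g x))"
      by (auto simp: G_def algebra_simps)
    then show ?thesis using Ii Ic[OF integrable_mult_right[OF L1(1)]] Ic[OF integrable_mult_right[OF g(1)]] by simp
  qed
  have G0i: "integrable lborel G0"
  proof -
    have "G0 = (\<lambda>x. c0 * ?I x + ?I x * (c1 * g x) + ?I x * (c2 * g x))"
      by (auto simp: G0_def algebra_simps)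
    then show ?thesis using Ii Ic[OF integrable_mult_right[OF g(1)]] by simp
  qed
  have GL: "(\<lambda>m. LINT x|lborel. \<bar>G m x - G0 x\<bar>) \<longlonglongrightarrow> 0"
  proof (rule Lim_null_comparison)
    show "(\<lambda>m. c1 * (LINT x|lborel. \<bar>convolve g (mollifier (e m)) x - g x\<bar>)) \<longlonglongrightarrow> 0"
      by (rule tendsto_mult_right_zero[OF L1(2)])
    show "\<forall>\<^sub>F m in sequentially. norm (LINT x|lborel. \<bar>G m x - G0 x\<bar>) \<le> c1 * (LINT x|lborel. \<bar>convolve g (mollifier (e m)) x - g x\<bar>)"
    proof (rule always_eventually, rule allI)
      fix m
      have "(LINT x|lborel. \<bar>G m x - G0 x\<bar>) \<le> (LINT x|lborel. c1 * \<bar>convolve g (mollifier (e m)) x - g x\<bar>)"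
      proof (rule integral_mono)
        fix x
        have "G m x - G0 x = ?I x * (c1 * (convolve g (mollifier (e m)) x - g x))" by (simp add: G_def G0_def algebra_simps)
        then show "\<bar>G m x - G0 x\<bar> \<le> c1 * \<bar>convolve g (mollifier (e m)) x - g x\<bar>"
          using c1 by (auto simp: abs_mult split: split_indicator)
      qed (use Gi G0i L1(1) g(1) in auto)
      then show "norm (LINT x|lborel. \<bar>G m x - G0 x\<bar>) \<le> c1 * (LINT x|lborel. \<bar>convolve g (mollifier (e m)) x - g x\<bar>)" by simp
    qed
  qed
  have bd: "\<bar>F x \<bullet> De (e m) x\<bar> \<le> G m x" for m x
  proof (cases "x \<in> cball x0 \<rho>")
    case False
    then show ?thesis using w_zero(2)[OF e False] by (simp add: G_def)
  next
    case True
    define P where "P = pb x"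
    define t where "t = norm (Vb x)"
    define N where "N = norm (Ve (e m) x)"
    have P1: "P > 1" by (simp add: P_def pb1)
    have t0: "t \<ge> 0" "N \<ge> 0" by (simp_all add: t_def N_def)
    have le1: "s powr a \<le> 1 + s powr b" if "s \<ge> 0" "0 < a" "a \<le> b" for s a b :: real
    proof (cases "s \<le> 1")
      case True
      then have "s powr a \<le> 1" using that by (cases "s = 0") (auto intro: powr_le1)
      then show ?thesis using powr_ge_zero[of s b] by linarith
    next
      case False
      then have "s powr a \<le> s powr b" using that by (intro powr_mono) auto
      then show ?thesis by linarith
    qed
    have a1: "N \<le> 1 + N powr P" using le1[OF t0(2), of 1 P] P1 t0 by simp
    have a2: "t powr (P - 1) \<le> 1 + t powr P" using le1[OF t0(1), of "P - 1" P] P1 by simp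
    have a3: "t powr (P - 1) * N \<le> t powr P + N powr P"
    proof (cases "t \<le> N")
      case True
      have "t powr (P - 1) * N \<le> N powr (P - 1) * N" using True P1 t0 by (intro mult_right_mono powr_mono2) auto
      also have "\<dots> = N powr P" using t0 by (cases "N = 0") (auto simp: powr_diff)
      finally show ?thesis using powr_ge_zero[of t P] by linarith
    next
      case False
      have "t powr (P - 1) * N \<le> t powr (P - 1) * t" using False by (intro mult_left_mono) auto
      also have "\<dots> = t powr P" using t0 by (cases "t = 0") (auto simp: powr_diff)
      finally show ?thesis using powr_ge_zero[of N P] by linarith
    qed
    have a4: "N powr P \<le> C1 * (1 + convolve g (mollifier (e m)) x)" using C1(2)[OF True] by (simp add: N_def P_def)
    have gx: "g x = t powr P" by (simp add: g_def t_def P_def)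
    have "norm (De (e m) x) \<le> H * (N + Q)"
    proof -
      have "norm (De (e m) x) = flat_fun 2 (ue (e m) x - \<phi> x) * norm (Ve (e m) x - grad \<phi> x)" by (simp add: De_def flat_fun_nonneg)
      also have "norm (Ve (e m) x - grad \<phi> x) \<le> N + Q"
        using norm_triangle_ineq4[of "Ve (e m) x" "grad \<phi> x"] Q(2)[OF True] by (simp add: N_def)
      finally show ?thesis using H flat_fun_nonneg[of 2 "ue (e m) x - \<phi> x"] t0 Q(1)
        by (meson add_nonneg_nonneg mult_left_mono mult_right_mono order_trans)
    qed
    then have "\<bar>F x \<bullet> De (e m) x\<bar> \<le> (c * (1 + t powr (P - 1))) * (H * (N + Q))"
      using F[OF True] t0 Q(1) H(1) \<open>c \<ge> 0\<close>
      by (intro order_trans[OF Cauchy_Schwarz_ineq2] mult_mono) (auto simp: t_def P_def)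
    also have "\<dots> = c * H * (N + Q + t powr (P - 1) * N + Q * t powr (P - 1))" by (simp add: algebra_simps)
    also have "\<dots> \<le> c * H * ((1 + 2 * Q + 2 * C1) + 2 * C1 * convolve g (mollifier (e m)) x + (1 + Q) * g x)"
    proof (rule mult_left_mono[OF _ cH])
      have "Q * t powr (P - 1) \<le> Q * (1 + t powr P)" using a2 Q(1) by (rule mult_left_mono)
      then show "N + Q + t powr (P - 1) * N + Q * t powr (P - 1) \<le> (1 + 2 * Q + 2 * C1) + 2 * C1 * convolve g (mollifier (e m)) x + (1 + Q) * g x"
        using a1 a3 a4 unfolding gx by (simp add: algebra_simps)
    qed
    also have "\<dots> = G m x" using True by (simp add: G_def c0_def c1_def c2_def algebra_simps)
    finally show ?thesis .
  qed
  have aeF: "AE x in lborel. (\<lambda>m. F x \<bullet> De (e m) x) \<longlonglongrightarrow> F x \<bullet> D x"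
    using De_tendsto by eventually_elim (intro tendsto_inner tendsto_const)
  have aeG: "AE x in lborel. (\<lambda>m. G m x) \<longlonglongrightarrow> G0 x"
    using ae(3)
  proof eventually_elim
    case (elim x)
    show ?case unfolding G_def G0_def by (intro tendsto_intros elim)
  qed
  have m1: "(\<lambda>x. F x \<bullet> De (e m) x) \<in> borel_measurable lborel" for m by (simp add: inner_vec_def) measurable
  have m2: "(\<lambda>x. F x \<bullet> D x) \<in> borel_measurable lborel" by (simp add: inner_vec_def) measurable
  note R = generalized_dominated_convergence[OF m1 m2 Gi G0i GL aeF aeG]
  show "integrable lborel (\<lambda>x. F x \<bullet> D x)" by (rule R(1)) (simp add: bd)
  show "(\<lambda>m. LINT x|lborel. F x \<bullet> De (e m) x) \<longlonglongrightarrow> (LINT x|lborel. F x \<bullet> D x)" by (rule R(2)) (simp add: bd)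
qed

text \<open>The limit lemma applied to the constant coordinate fields.\<close>

lemma D_integrable: "integrable lborel (\<lambda>x. norm (D x))"
proof (rule integrable_norm_vec)
  fix i
  have "integrable lborel (\<lambda>x. axis i 1 \<bullet> D x)"
    by (rule limit(1)[where c=1]) (simp_all add: norm_axis_real)
  then show "integrable lborel (\<lambda>x. D x $ i)" by (simp add: inner_axis')
qed

definition "B0 x = (if x \<in> cball x0 r then (norm (grad \<phi> x) powr (p x - 2)) *\<^sub>R grad \<phi> x else 0)"

lemma B_borel [measurable]: "(\<lambda>x. B \<delta> x $ i) \<in> borel_measurable borel" "(\<lambda>x. B0 x $ i) \<in> borel_measurable borel"
proof -
  have [measurable]: "(\<lambda>x. norm (grad \<phi> x)) \<in> borel_measurable borel"
    by (simp add: norm_vec_def L2_set_def) measurable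
  have "B \<delta> x $ i = (if x \<in> cball x0 r then (((norm (grad \<phi> x))\<^sup>2 + \<delta>\<^sup>2) powr ((pb x - 2)/2)) * partial i \<phi> x else 0)" for x
    by (simp add: B_def pb_def)
  then show "(\<lambda>x. B \<delta> x $ i) \<in> borel_measurable borel" by simp
  have "B0 x $ i = (if x \<in> cball x0 r then (norm (grad \<phi> x) powr (pb x - 2)) * partial i \<phi> x else 0)" for x
    by (simp add: B0_def pb_def)
  then show "(\<lambda>x. B0 x $ i) \<in> borel_measurable borel" by simp
qed

text \<open>|D\<phi>| <= s^(1/2) with s = |D\<phi>|^2 + \<delta>^2 turns the flux into a positive
  power s^((p-1)/2), so a bound uniform in \<delta> exists also for p < 2. The summand 1 keeps the
  base above 1, for monotonicity in the exponent.\<close>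

lemma B_bound:
  obtains c where "c \<ge> 0" "\<And>x \<delta>. x \<in> cball x0 \<rho> \<Longrightarrow> 0 < \<delta> \<Longrightarrow> \<delta> < \<delta>0 \<Longrightarrow> norm (B \<delta> x) \<le> c"
proof -
  obtain Q where Q: "Q \<ge> 0" "\<And>x. x \<in> cball x0 \<rho> \<Longrightarrow> norm (grad \<phi> x) \<le> Q" using grad_bound by blast
  obtain P where P: "\<And>x. x \<in> cball x0 r \<Longrightarrow> p x \<le> P" using p_bounds by metis
  let ?c = "(1 + Q\<^sup>2 + \<delta>0\<^sup>2) powr ((P - 1) / 2)"
  show ?thesis
  proof (rule that[of ?c])
    fix x \<delta> assume x: "x \<in> cball x0 \<rho>" and \<delta>: "0 < \<delta>" "\<delta> < \<delta>0"
    have xr: "x \<in> cball x0 r" "x \<in> \<Omega>" using x sub by blast+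
    let ?s = "(norm (grad \<phi> x))\<^sup>2 + \<delta>\<^sup>2"
    have s0: "?s > 0" using \<delta> by (simp add: add_nonneg_pos)
    have "norm (grad \<phi> x) = ((norm (grad \<phi> x))\<^sup>2) powr (1/2)" by (simp add: powr_half_sqrt)
    also have "\<dots> \<le> ?s powr (1/2)" by (intro powr_mono2) auto
    finally have "norm (B \<delta> x) \<le> ?s powr ((p x - 2)/2) * ?s powr (1/2)"
      using xr by (simp add: B_def mult_left_mono)
    also have "\<dots> = ?s powr ((p x - 1) / 2)" by (subst powr_add[symmetric]) (simp add: field_simps)
    also have "\<dots> \<le> (1 + Q\<^sup>2 + \<delta>0\<^sup>2) powr ((p x - 1) / 2)"
    proof (rule powr_mono2)
      have "(norm (grad \<phi> x))\<^sup>2 \<le> Q\<^sup>2" "\<delta>\<^sup>2 \<le> \<delta>0\<^sup>2" using Q(2)[OF x] \<delta> by (auto intro: power_mono)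
      then show "?s \<le> 1 + Q\<^sup>2 + \<delta>0\<^sup>2" by linarith
    qed (use p1[OF xr(2)] in auto)
    also have "\<dots> \<le> ?c"
      using P[OF xr(1)] by (intro powr_mono divide_right_mono) (auto simp: add_nonneg_nonneg)
    finally show "norm (B \<delta> x) \<le> ?c" .
  qed simp
qed

text \<open>The limits of the two tested inequalities give opposite signs for the pairings of
  \<open>A\<close> and of \<open>B0\<close> with \<open>D\<close>. Their difference is nonnegative
  pointwise by monotonicity, so it vanishes almost everywhere, and the case of equality in
  \<open>p_monotone\<close> forces \<open>D\<close> to vanish.\<close>

lemma D_zero: "AE x in lborel. D x = 0"
proof -
  have A1: "norm (A x) \<le> 1 * (1 + norm (Vb x) powr (pb x - 1))" for x
    unfolding A_def norm_powr_scaleR by simp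
  have [measurable]: "(\<lambda>x. A x $ i) \<in> borel_measurable borel" for i unfolding A_def by simp
  have LA: "integrable lborel (\<lambda>x. A x \<bullet> D x)" "(\<lambda>m. LINT x|lborel. A x \<bullet> De (e m) x) \<longlonglongrightarrow> (LINT x|lborel. A x \<bullet> D x)"
    by (rule limit[where c=1]; use A1 in simp)+
  have IA: "(LINT x|lborel. A x \<bullet> D x) \<le> 0"
    by (rule LIMSEQ_le_const2[OF LA(2)]) (use weak_ineq e in blast)
  obtain c where c: "c \<ge> 0" "\<And>x \<delta>. x \<in> cball x0 \<rho> \<Longrightarrow> 0 < \<delta> \<Longrightarrow> \<delta> < \<delta>0 \<Longrightarrow> norm (B \<delta> x) \<le> c"
    using B_bound by blast
  define d where "d k = \<delta>0 * inverse (real (Suc (Suc k)))" for k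
  have d: "0 < d k" "d k < \<delta>0" for k using rad by (auto simp: d_def field_simps intro!: add_pos_nonneg)
  have "(\<lambda>m. inverse (real (Suc (Suc m)))) \<longlonglongrightarrow> 0" using LIMSEQ_Suc[OF LIMSEQ_inverse_real_of_nat] .
  then have d0: "d \<longlonglongrightarrow> 0" unfolding d_def by (rule tendsto_mult_right_zero)
  have IB: "0 \<le> (LINT x|lborel. B (d k) x \<bullet> D x)" for k
  proof -
    have "norm (B (d k) x) \<le> c * (1 + norm (Vb x) powr (pb x - 1))" if "x \<in> cball x0 \<rho>" for x
    proof -
      have "norm (B (d k) x) \<le> c * 1" using c(2)[OF that d] by simp
      also have "\<dots> \<le> c * (1 + norm (Vb x) powr (pb x - 1))" using c(1) by (intro mult_left_mono) auto
      finally show ?thesis .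
    qed
    then have "(\<lambda>m. LINT x|lborel. B (d k) x \<bullet> De (e m) x) \<longlonglongrightarrow> (LINT x|lborel. B (d k) x \<bullet> D x)"
      by (rule limit(2)[OF B_borel(1) c(1)])
    then show ?thesis by (rule LIMSEQ_le_const) (intro exI allI impI, rule super_ineq[OF e d])
  qed
  have m1: "(\<lambda>x. B \<delta> x \<bullet> D x) \<in> borel_measurable lborel" for \<delta> by (simp add: inner_vec_def) measurable
  have m2: "(\<lambda>x. B0 x \<bullet> D x) \<in> borel_measurable lborel" by (simp add: inner_vec_def) measurable
  \<comment> \<open>At critical points of the touching function both fields are 0 for every
    regularisation parameter, although the scalar factor may blow up; elsewhere the power is
    continuous.\<close>
  have pw: "(\<lambda>k. B (d k) x \<bullet> D x) \<longlonglongrightarrow> B0 x \<bullet> D x" for x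
  proof (cases "x \<in> cball x0 r \<and> grad \<phi> x \<noteq> 0")
    case False then show ?thesis by (auto simp: B_def B0_def)
  next
    case True
    have "(\<lambda>k. ((norm (grad \<phi> x))\<^sup>2 + (d k)\<^sup>2) powr ((p x - 2)/2)) \<longlonglongrightarrow> ((norm (grad \<phi> x))\<^sup>2 + 0\<^sup>2) powr ((p x - 2)/2)"
      using True by (intro tendsto_intros d0) auto
    moreover have "((norm (grad \<phi> x))\<^sup>2 + 0\<^sup>2) powr ((p x - 2)/2) = norm (grad \<phi> x) powr (p x - 2)"
      using True by (simp add: powr_def ln_realpow)
    ultimately have "(\<lambda>k. B (d k) x) \<longlonglongrightarrow> B0 x" using True by (auto simp: B_def B0_def intro!: tendsto_intros)
    then show ?thesis by (intro tendsto_inner tendsto_const)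
  qed
  have bdd: "norm (B (d k) x \<bullet> D x) \<le> c * norm (D x)" for k x
  proof (cases "x \<in> cball x0 \<rho>")
    case True
    then show ?thesis
      using Cauchy_Schwarz_ineq2[of "B (d k) x" "D x"] mult_right_mono[OF c(2)[OF True d(1)[of k] d(2)[of k]] norm_ge_zero[of "D x"]] by simp
  next
    case False then show ?thesis by (simp add: D_def)
  qed
  have cD: "integrable lborel (\<lambda>x. c * norm (D x))" by (rule integrable_mult_right[OF D_integrable])
  have ae1: "AE x in lborel. (\<lambda>k. B (d k) x \<bullet> D x) \<longlonglongrightarrow> B0 x \<bullet> D x" by (rule AE_I2) (rule pw)
  have ae2: "AE x in lborel. norm (B (d k) x \<bullet> D x) \<le> c * norm (D x)" for k by (rule AE_I2) (rule bdd)
  have B0i: "integrable lborel (\<lambda>x. B0 x \<bullet> D x)"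
    by (rule integrable_dominated_convergence[OF m2 m1 cD ae1 ae2])
  have B0l: "(\<lambda>k. LINT x|lborel. B (d k) x \<bullet> D x) \<longlonglongrightarrow> (LINT x|lborel. B0 x \<bullet> D x)"
    by (rule integral_dominated_convergence[OF m2 m1 cD ae1 ae2])
  have IB0: "0 \<le> (LINT x|lborel. B0 x \<bullet> D x)"
    by (rule LIMSEQ_le_const[OF B0l]) (use IB in blast)
  have nn: "0 \<le> (A x - B0 x) \<bullet> D x" and zz: "(A x - B0 x) \<bullet> D x = 0 \<Longrightarrow> D x = 0" for x
  proof -
    show "0 \<le> (A x - B0 x) \<bullet> D x"
    proof (cases "x \<in> cball x0 \<rho>")
      case True
      then have xr: "x \<in> cball x0 r" "x \<in> \<Omega>" using sub by blast+
      show ?thesis using True xr p_monotone(1)[OF p1[OF xr(2)], of "Vb x" "grad \<phi> x"]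
        by (simp add: D_def A_def B0_def pb_def flat_fun_nonneg)
    qed (simp add: D_def)
    assume z: "(A x - B0 x) \<bullet> D x = 0"
    show "D x = 0"
    proof (cases "x \<in> cball x0 \<rho> \<and> flat_fun 2 (ub x - \<phi> x) \<noteq> 0")
      case True
      then have xr: "x \<in> cball x0 r" "x \<in> \<Omega>" using sub by blast+
      have "Vb x = grad \<phi> x"
        by (rule p_monotone(2)[OF p1[OF xr(2)]]) (use z True xr in \<open>simp add: D_def A_def B0_def pb_def\<close>)
      then show ?thesis by (simp add: D_def)
    qed (auto simp: D_def)
  qed
  have i: "integrable lborel (\<lambda>x. (A x - B0 x) \<bullet> D x)"
    unfolding inner_diff_left by (intro Bochner_Integration.integrable_diff LA B0i)
  have "(LINT x|lborel. (A x - B0 x) \<bullet> D x) \<le> 0"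
    unfolding inner_diff_left using LA(1) B0i IA IB0 by simp
  moreover have "(LINT x|lborel. (A x - B0 x) \<bullet> D x) \<ge> 0" by (rule integral_nonneg_AE) (simp add: nn)
  ultimately have "(LINT x|lborel. (A x - B0 x) \<bullet> D x) = 0" by simp
  then have "AE x in lborel. (A x - B0 x) \<bullet> D x = 0"
    using integral_nonneg_eq_0_iff_AE[OF i] nn by simp
  then show ?thesis by eventually_elim (rule zz)
qed

text \<open>A one-dimensional Poincare argument: the field with the single component x_i - x0_i has
  divergence 1, so the integral of the truncation is minus the pairing of this field with its
  gradient. The latter tends to the pairing with \<open>D\<close>, which is 0; the limit of the
  truncations is nonnegative with integral 0.\<close>

lemma limit_conclusion: "AE x in lborel. x \<in> cball x0 \<rho> \<longrightarrow> ub x \<le> \<phi> x"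
proof -
  fix i :: 'n
  let ?F = "\<lambda>x. axis i (x $ i - x0 $ i) :: real^'n"
  have Fb: "norm (?F x) \<le> \<rho> * (1 + norm (Vb x) powr (pb x - 1))" if "x \<in> cball x0 \<rho>" for x
  proof -
    have "norm (?F x) \<le> \<rho> * 1"
      using that component_le_norm_cart[of "x - x0" i] by (simp add: norm_axis_real dist_norm norm_minus_commute)
    also have "\<dots> \<le> \<rho> * (1 + norm (Vb x) powr (pb x - 1))" using rad by (intro mult_left_mono) auto
    finally show ?thesis .
  qed
  have Fm: "(\<lambda>x. ?F x $ j) \<in> borel_measurable borel" for j by (cases "j = i") (auto simp: axis_def)
  have L: "(\<lambda>m. LINT x|lborel. ?F x \<bullet> De (e m) x) \<longlonglongrightarrow> (LINT x|lborel. ?F x \<bullet> D x)"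
    using limit(2)[OF Fm _ Fb] rad by simp
  have "AE x in lborel. ?F x \<bullet> D x = 0" using D_zero by eventually_elim simp
  then have "(LINT x|lborel. ?F x \<bullet> D x) = 0" by (rule integral_eq_zero_AE)
  with L have L0: "(\<lambda>m. - (LINT x|lborel. ?F x \<bullet> De (e m) x)) \<longlonglongrightarrow> 0" using tendsto_minus by fastforce
  have wI: "(LINT x|lborel. w (e m) x) = - (LINT x|lborel. ?F x \<bullet> De (e m) x)" for m
  proof -
    note wp = w_props[OF e(1)[of m] e(2)[of m] e(3)[of m]]
    let ?G = "\<lambda>x. (x $ i - x0 $ i) * w (e m) x"
    have sG: "smooth ?G" by (intro smooth_mult smooth_minus smooth_coord smooth_const wp(1))
    have d1: "(\<lambda>x. x $ i - x0 $ i) differentiable (at x)" for x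
      by (rule smooth_differentiable) (intro smooth_minus smooth_coord smooth_const)
    have d2: "partial i (\<lambda>x. x $ i - x0 $ i) x = 1" for x
    proof -
      have "((\<lambda>x. x $ i - x0 $ i) has_derivative (\<lambda>h. h $ i)) (at x)"
        using has_derivative_diff[OF bounded_linear_imp_has_derivative[OF bounded_linear_vec_nth[of i]] has_derivative_const] by simp
      from partial_eq[OF this] show ?thesis by simp
    qed
    have pG: "partial i ?G x = w (e m) x + ?F x \<bullet> De (e m) x" for x
      using partial_mult[OF d1[of x] smooth_differentiable[OF wp(1)], of i] by (simp add: d2 wp(2) inner_axis')
    have "(LINT x|lborel. partial i ?G x) = 0"
    proof (rule integral_partial_eq_0)
      show "?G differentiable (at x)" for x by (rule smooth_differentiable[OF sG])
      show "continuous_on UNIV (partial i ?G)" by (rule smooth_cont[OF smooth_partial[OF sG]])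
      show "bounded {x. ?G x \<noteq> 0}"
      proof (rule bounded_subset[OF bounded_cball[of x0 \<rho>]], rule subsetI)
        fix x assume "x \<in> {x. ?G x \<noteq> 0}"
        then show "x \<in> cball x0 \<rho>" using wp(3)[of x] by auto
      qed
    qed
    moreover have i1: "integrable lborel (w (e m))"
      by (rule cont_cpt_integrable[OF smooth_cont[OF wp(1)], of x0 \<rho>]) (simp add: wp(3))
    moreover have "integrable lborel (\<lambda>x. ?F x \<bullet> De (e m) x)"
    proof (rule cont_cpt_integrable[of _ x0 \<rho>])
      have eq: "(\<lambda>x. ?F x \<bullet> De (e m) x) = (\<lambda>x. (x $ i - x0 $ i) * partial i (w (e m)) x)"
        by (simp add: wp(2) inner_axis')
      show "continuous_on UNIV (\<lambda>x. ?F x \<bullet> De (e m) x)"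
        unfolding eq by (intro smooth_cont smooth_mult smooth_minus smooth_coord smooth_const smooth_partial wp(1))
    qed (simp add: wp(4))
    ultimately show ?thesis unfolding pG by simp
  qed
  define W where "W x = indicator (cball x0 \<rho>) x * flat_fun 0 (ub x - \<phi> x)" for x
  have H1: "flat_fun 0 t \<le> 1" for t by (simp add: flat_fun_def)
  have Ii: "integrable lborel (\<lambda>x. indicator (cball x0 \<rho>) x :: real)" by (rule integrable_indicator_cball)
  have Wm: "W \<in> borel_measurable lborel" unfolding W_def[abs_def] by simp
  have wm: "w (e m) \<in> borel_measurable lborel" for m
    using smooth_borel[OF w_smooth[OF e(1,2,3)]] by simp
  have wlim: "AE x in lborel. (\<lambda>m. w (e m) x) \<longlonglongrightarrow> W x"
    using ae(1)
  proof eventually_elim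
    case (elim x)
    show ?case
    proof (cases "x \<in> cball x0 \<rho>")
      case True
      have "(\<lambda>m. w (e m) x) \<longlonglongrightarrow> flat_fun 0 (ub x - \<phi> x)"
        unfolding w_def by (intro flat_fun_tendsto tendsto_diff tendsto_const elim)
      then show ?thesis using True by (simp add: W_def)
    next
      case False
      then show ?thesis using w_zero(1)[OF e False] by (simp add: W_def)
    qed
  qed
  have wb: "norm (w (e m) x) \<le> indicator (cball x0 \<rho>) x" for m x
    using w_zero(1)[OF e(1)[of m] e(2)[of m] e(3)[of m]] H1 flat_fun_nonneg
    by (cases "x \<in> cball x0 \<rho>") (simp_all add: w_def)
  have Wi: "integrable lborel W"
    by (rule integrable_dominated_convergence[OF Wm wm Ii wlim]) (use wb in simp)
  have Wl: "(\<lambda>m. LINT x|lborel. w (e m) x) \<longlonglongrightarrow> (LINT x|lborel. W x)"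
    by (rule integral_dominated_convergence[OF Wm wm Ii wlim]) (use wb in simp)
  have "(LINT x|lborel. W x) = 0"
    using LIMSEQ_unique[OF Wl] L0 unfolding wI by blast
  moreover have W0: "0 \<le> W x" for x by (simp add: W_def flat_fun_nonneg)
  ultimately have "AE x in lborel. W x = 0" using integral_nonneg_eq_0_iff_AE[OF Wi] by simp
  then show ?thesis
  proof eventually_elim
    case (elim x)
    then show ?case by (auto simp: W_def flat_fun_def split: if_splits)
  qed
qed

end

context comparison
begin

lemma conclusion: "AE x in lborel. x \<in> cball x0 \<rho> \<longrightarrow> ub x \<le> \<phi> x"
proof -
  obtain \<epsilon>1 C1 where 1: "0 < \<epsilon>1" "\<epsilon>1 \<le> \<epsilon>0" "\<epsilon>1 \<le> r - \<rho>" "C1 \<ge> 0"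
    "\<And>\<epsilon> x. 0 < \<epsilon> \<Longrightarrow> \<epsilon> < \<epsilon>1 \<Longrightarrow> x \<in> cball x0 \<rho> \<Longrightarrow> norm (Ve \<epsilon> x) powr pb x \<le> C1 * (1 + convolve g (mollifier \<epsilon>) x)"
    using Ve_bound by blast
  obtain e :: "nat \<Rightarrow> real" where 2: "\<And>m. 0 < e m \<and> e m < \<epsilon>1"
    "AE x in lborel. (\<lambda>m. ue (e m) x) \<longlonglongrightarrow> ub x" "AE x in lborel. (\<lambda>m. Ve (e m) x) \<longlonglongrightarrow> Vb x"
    "AE x in lborel. (\<lambda>m. convolve g (mollifier (e m)) x) \<longlonglongrightarrow> g x"
    "\<And>m. integrable lborel (convolve g (mollifier (e m)))" "(\<lambda>m. LINT x|lborel. \<bar>convolve g (mollifier (e m)) x - g x\<bar>) \<longlonglongrightarrow> 0"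
    using approx_sequence[OF 1(1)] by blast
  interpret comparison_limit \<Omega> p u \<phi> V x0 r \<rho> \<epsilon>0 \<delta>0 ub Vb e C1
  proof
    show "0 < e m" "e m < \<epsilon>0" "e m < r - \<rho>" for m using 2(1)[of m] 1(2,3) by linarith+
    show "norm (Ve (e m) x) powr pb x \<le> C1 * (1 + convolve g (mollifier (e m)) x)" if "x \<in> cball x0 \<rho>" for m x
      using 1(5)[OF _ _ that] 2(1) by blast
  qed (fact 1(4) 2)+
  show ?thesis by (rule limit_conclusion)
qed

end

lemma weak_comparison:
  fixes u :: "real^'n::finite \<Rightarrow> real"
  assumes op: "open \<Omega>" and K: "cball x0 r \<subseteq> \<Omega>" and rad: "0 < \<rho>" "\<rho> < r" "0 < \<epsilon>0" "0 < \<delta>0"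
    and p: "C_on 1 \<Omega> p" and p1: "\<And>x. x \<in> \<Omega> \<Longrightarrow> 1 < p x"
    and sub: "weak_subsolution \<Omega> p u"
    and \<phi>: "smooth \<phi>"
    and sep: "\<And>x z. x \<notin> cball x0 \<rho> \<Longrightarrow> dist x z < \<epsilon>0 \<Longrightarrow> (if z \<in> cball x0 r then u z else 0) \<le> \<phi> x"
    and super: "\<And>x \<delta>. x \<in> cball x0 \<rho> \<Longrightarrow> 0 < \<delta> \<Longrightarrow> \<delta> < \<delta>0 \<Longrightarrow> reg_op p \<phi> \<delta> x \<le> 0"
  shows "AE x in lborel. x \<in> cball x0 \<rho> \<longrightarrow> u x \<le> \<phi> x"
    and "u absolutely_integrable_on cball x0 r"
proof -
  obtain V where W: "W1p_loc \<Omega> p u V" and weak: "\<And>\<psi>. test_function \<Omega> \<psi> \<Longrightarrow> (\<And>x. 0 \<le> \<psi> x) \<Longrightarrow>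
        (LINT x:\<Omega>|lebesgue. ((norm (V x) powr (p x - 2)) *\<^sub>R V x) \<bullet> grad \<psi> x) \<le> 0"
    using sub by (auto simp: weak_subsolution_def)
  let ?K = "cball x0 r"
  have ai: "u absolutely_integrable_on ?K" "V absolutely_integrable_on ?K" and LV: "Lp_var ?K p V"
    using W K by (auto simp: W1p_loc_def weak_gradient_def Lp_var_loc_def)
  show "u absolutely_integrable_on cball x0 r" by (rule ai(1))
  obtain ub where ub: "integrable lborel ub" "\<And>x. x \<notin> ?K \<Longrightarrow> ub x = 0" "AE x in lborel. x \<in> ?K \<longrightarrow> ub x = u x"
    using borel_representative[OF ai(1)] by auto
  have "\<exists>g. integrable lborel g \<and> (\<forall>x. x \<notin> ?K \<longrightarrow> g x = 0) \<and> (AE x in lborel. x \<in> ?K \<longrightarrow> g x = V x $ i)" for i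
  proof -
    have "(\<lambda>x. V x $ i) absolutely_integrable_on ?K"
      using absolutely_integrable_linear[OF ai(2) bounded_linear_vec_nth] by (simp add: o_def)
    from borel_representative[OF this] show ?thesis by auto
  qed
  then have "\<forall>i. \<exists>g. integrable lborel g \<and> (\<forall>x. x \<notin> ?K \<longrightarrow> g x = 0) \<and> (AE x in lborel. x \<in> ?K \<longrightarrow> g x = V x $ i)"
    by blast
  from choice[OF this] obtain vb where vb: "\<And>i. integrable lborel (vb i)" "\<And>i x. x \<notin> ?K \<Longrightarrow> vb i x = 0"
    "\<And>i. AE x in lborel. x \<in> ?K \<longrightarrow> vb i x = V x $ i" by blast
  define Vb where "Vb x = (\<chi> i. vb i x)" for x
  have "AE x in lborel. \<forall>i\<in>UNIV. x \<in> ?K \<longrightarrow> vb i x = V x $ i" by (rule AE_finite_allI) (use vb(3) in auto)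
  then have Vae: "AE x in lborel. x \<in> ?K \<longrightarrow> Vb x = V x" by eventually_elim (simp add: Vb_def vec_eq_iff)
  have pd: "x \<in> \<Omega> \<Longrightarrow> p differentiable (at x)" for x using p by auto
  then have pc: "continuous_on ?K p"
    using K by (auto intro!: continuous_at_imp_continuous_on differentiable_imp_continuous_within)
  have gi: "integrable lborel (\<lambda>x. norm (Vb x) powr (if x \<in> ?K then p x else 2))"
  proof -
    let ?h = "\<lambda>x. norm (Vb x) powr (if x \<in> ?K then p x else 2)"
    have [measurable]: "(\<lambda>x. if x \<in> ?K then p x else 2) \<in> borel_measurable borel"
      by (intro borel_measurable_continuous_on_if pc continuous_on_const) auto
    have [measurable]: "vb i \<in> borel_measurable borel" for i using borel_measurable_integrable[OF vb(1)] by simp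
    have [measurable]: "(\<lambda>x. norm (Vb x)) \<in> borel_measurable borel"
      by (simp add: norm_vec_def L2_set_def Vb_def)
    have hm: "?h \<in> borel_measurable lborel" by measurable
    obtain c where c: "c > 0" "(\<integral>\<^sup>+ x. ennreal (norm (V x /\<^sub>R c) powr p x) \<partial>lebesgue_on ?K) < \<infinity>"
      and Vm: "V \<in> borel_measurable (lebesgue_on ?K)" using LV by (auto simp: Lp_var_def)
    have "?K \<noteq> {}" using rad by auto
    then obtain xM where xM: "xM \<in> ?K" "\<forall>y\<in>?K. p y \<le> p xM"
      using continuous_attains_sup[OF compact_cball _ pc] by blast
    \<comment> \<open>Membership in the variable exponent space only bounds the integral of |V/c|^p
      for some c. As p is bounded on the ball, undoing the scaling costs a constant factor.\<close>
    define C where "C = (1 + c) powr p xM"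
    have pm [measurable]: "p \<in> borel_measurable (lebesgue_on ?K)"
      by (rule continuous_imp_measurable_on_sets_lebesgue[OF pc]) simp
    have "(\<integral>\<^sup>+ x. ennreal (?h x) \<partial>lborel) = (\<integral>\<^sup>+ x. ennreal (?h x) * indicator ?K x \<partial>lebesgue)"
      unfolding nn_integral_completion[symmetric, of lborel]
      by (rule nn_integral_cong) (auto simp: Vb_def vb(2) vec_eq_iff split: split_indicator)
    also have "\<dots> = (\<integral>\<^sup>+ x. ennreal (?h x) \<partial>lebesgue_on ?K)"
      by (subst nn_integral_restrict_space) auto
    also have "\<dots> \<le> (\<integral>\<^sup>+ x. ennreal C * ennreal (norm (V x /\<^sub>R c) powr p x) \<partial>lebesgue_on ?K)"
    proof (rule nn_integral_mono_AE)
      have "AE x in lebesgue. x \<in> ?K \<longrightarrow> Vb x = V x" by (rule AE_completion[OF Vae])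
      then have "AE x in lebesgue_on ?K. Vb x = V x" by (subst AE_restrict_space_iff) auto
      moreover have "AE x in lebesgue_on ?K. x \<in> ?K" by (rule AE_I2) simp
      ultimately show "AE x in lebesgue_on ?K. ennreal (?h x) \<le> ennreal C * ennreal (norm (V x /\<^sub>R c) powr p x)"
      proof eventually_elim
        case (elim x)
        have "p x > 1" using elim(2) K p1 by blast
        have "norm (V x) = c * norm (V x /\<^sub>R c)" using c(1) by simp
        then have "norm (V x) powr p x = c powr p x * norm (V x /\<^sub>R c) powr p x"
          using c(1) by (metis norm_ge_zero powr_mult less_imp_le)
        also have "\<dots> \<le> C * norm (V x /\<^sub>R c) powr p x"
        proof (rule mult_right_mono)
          have "c powr p x \<le> (1 + c) powr p x" using c(1) \<open>p x > 1\<close> by (intro powr_mono2) auto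
          also have "\<dots> \<le> C" unfolding C_def using c(1) xM(2) elim(2) by (intro powr_mono) auto
          finally show "c powr p x \<le> C" .
        qed simp
        finally show ?case using elim by (simp add: ennreal_mult[symmetric] C_def)
      qed
    qed
    also have "\<dots> = ennreal C * (\<integral>\<^sup>+ x. ennreal (norm (V x /\<^sub>R c) powr p x) \<partial>lebesgue_on ?K)"
      by (rule nn_integral_cmult) (use Vm pm in measurable)
    also have "\<dots> < \<infinity>" using c(2) by (simp add: ennreal_mult_less_top)
    finally have "(\<integral>\<^sup>+ x. ennreal (norm (?h x)) \<partial>lborel) < \<infinity>" by simp
    then show ?thesis using hm by (intro integrableI_bounded)
  qed
  interpret comparison \<Omega> p u \<phi> V x0 r \<rho> \<epsilon>0 \<delta>0 ub Vb
  proof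
    show "integrable lborel (\<lambda>x. Vb x $ i)" for i by (simp add: Vb_def vb(1))
    show "x \<notin> ?K \<Longrightarrow> Vb x = 0" for x by (simp add: Vb_def vb(2) vec_eq_iff)
  qed (fact op K rad p p1 W weak \<phi> sep super ub Vae gi)+
  have "AE x in lborel. x \<in> cball x0 \<rho> \<longrightarrow> ub x \<le> \<phi> x" by (rule conclusion)
  with ub(3) show "AE x in lborel. x \<in> cball x0 \<rho> \<longrightarrow> u x \<le> \<phi> x"
    by eventually_elim (use rad in auto)
qed

section \<open>Trace inequalities and Taylor's formula\<close>

lemma qf_sum: "e \<bullet> (X *v e) = (\<Sum>i\<in>UNIV. \<Sum>j\<in>UNIV. X $ i $ j * e $ i * e $ j)"
  by (simp add: inner_vec_def matrix_vector_mult_def sum_distrib_left mult_ac)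

text \<open>Summing \<open>0 \<le> v \<bullet> Z v\<close> over the vectors \<open>v = e\<^sub>i - (e \<bullet> e\<^sub>i) e\<close> avoids the spectral theorem.\<close>

lemma psd_qf_le_trace:
  assumes Z: "psd Z" and e: "norm e \<le> 1"
  shows "0 \<le> e \<bullet> (Z *v e)" "e \<bullet> (Z *v e) \<le> trace Z"
proof -
  let ?q = "e \<bullet> (Z *v e)"
  show q0: "0 \<le> ?q" using Z by (simp add: psd_def)
  have "0 \<le> (\<Sum>i\<in>UNIV. (axis i 1 - e $ i *\<^sub>R e) \<bullet> (Z *v (axis i 1 - e $ i *\<^sub>R e)))"
    using Z by (intro sum_nonneg) (simp add: psd_def)
  also have "\<dots> = (\<Sum>i\<in>UNIV. Z $ i $ i - e $ i * (Z *v e) $ i - e $ i * (e \<bullet> (Z *v axis i 1)) + (e $ i)\<^sup>2 * ?q)"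
  proof (rule sum.cong[OF refl])
    fix i
    have "(Z *v axis i 1) $ i = Z $ i $ i"
      by (simp add: matrix_vector_mult_def axis_def if_distrib cong: if_cong)
    then show "(axis i 1 - e $ i *\<^sub>R e) \<bullet> (Z *v (axis i 1 - e $ i *\<^sub>R e))
       = Z $ i $ i - e $ i * (Z *v e) $ i - e $ i * (e \<bullet> (Z *v axis i 1)) + (e $ i)\<^sup>2 * ?q"
      by (simp add: matrix_vector_mult_diff_distrib matrix_vector_mult_scaleR inner_diff_left inner_diff_right inner_axis'
          power2_eq_square algebra_simps)
  qed
  also have "\<dots> = trace Z - ?q - (\<Sum>i\<in>UNIV. e $ i * (e \<bullet> (Z *v axis i 1))) + (\<Sum>i\<in>UNIV. (e $ i)\<^sup>2) * ?q"
    by (simp add: sum.distrib sum_subtractf trace_def inner_vec_def[of e "Z *v e"] sum_distrib_right)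
  also have "(\<Sum>i\<in>UNIV. e $ i * (e \<bullet> (Z *v axis i 1))) = ?q"
  proof -
    have "?q = e \<bullet> (Z *v (\<Sum>i\<in>UNIV. e $ i *\<^sub>R axis i 1))"
      by (simp add: basis_expansion[of e, unfolded scalar_mult_eq_scaleR])
    also have "\<dots> = (\<Sum>i\<in>UNIV. e $ i * (e \<bullet> (Z *v axis i 1)))"
      by (simp add: linear_sum[OF matrix_vector_mul_linear] matrix_vector_mult_scaleR inner_sum_right)
    finally show ?thesis by simp
  qed
  also have "(\<Sum>i\<in>UNIV. (e $ i)\<^sup>2) = (norm e)\<^sup>2"
    unfolding power2_norm_eq_inner by (simp add: inner_vec_def power2_eq_square)
  finally have "?q + (1 - (norm e)\<^sup>2) * ?q \<le> trace Z" by (simp add: algebra_simps)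
  moreover have "(norm e)\<^sup>2 \<le> 1" using e by (simp add: abs_square_le_1)
  then have "0 \<le> (1 - (norm e)\<^sup>2) * ?q" using q0 by simp
  ultimately show "?q \<le> trace Z" by linarith
qed

text \<open>The supremum is over the ball rather than the sphere, because the regularised direction
  D\<phi> / sqrt(|D\<phi>|^2 + \<delta>^2) has norm below 1. It therefore applies at every point,
  critical or not.\<close>

definition sup_op :: "real \<Rightarrow> real^'n::finite^'n \<Rightarrow> real"
  where "sup_op s X = (SUP e\<in>cball 0 1. trace X + (s - 2) * (e \<bullet> (X *v e)))"

lemma sup_op_bdd: "bdd_above ((\<lambda>e. trace X + (s - 2) * (e \<bullet> (X *v e))) ` cball 0 1)"
proof -
  have "compact ((\<lambda>e. trace X + (s - 2) * (e \<bullet> (X *v e))) ` cball 0 1)"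
    by (intro compact_continuous_image compact_cball continuous_intros linear_continuous_on) simp
  then show ?thesis by (intro bounded_imp_bdd_above compact_imp_bounded)
qed

lemma sup_op_ge: "norm e \<le> 1 \<Longrightarrow> trace X + (s - 2) * (e \<bullet> (X *v e)) \<le> sup_op s X"
  unfolding sup_op_def by (rule cSUP_upper[OF _ sup_op_bdd]) simp

lemma sup_op_le: "(\<And>e. norm e \<le> 1 \<Longrightarrow> trace X + (s - 2) * (e \<bullet> (X *v e)) \<le> b) \<Longrightarrow> sup_op s X \<le> b"
  unfolding sup_op_def by (rule cSUP_least) auto

lemma trace_diff: "trace (X - Y) = trace X - trace (Y :: real^'n::finite^'n)"
  by (simp add: trace_def sum_subtractf)

lemma qf_diff: "e \<bullet> ((X - Y) *v e) = e \<bullet> (X *v e) - e \<bullet> ((Y :: real^'n::finite^'n) *v e)"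
  by (simp add: matrix_vector_mult_diff_rdistrib inner_diff_right)

text \<open>For positive semidefinite Z the value of the form is between 0 and the trace, and s - 2
  > -1, so tr Z + (s - 2) e.Ze is nonnegative for each direction separately.\<close>

lemma sup_op_mono:
  assumes "s > 1" "psd (Y - X)" shows "sup_op s X \<le> sup_op s Y"
proof (rule sup_op_le)
  fix e :: "real^'a" assume e: "norm e \<le> 1"
  let ?q = "e \<bullet> ((Y - X) *v e)"
  have q: "0 \<le> ?q" "?q \<le> trace (Y - X)" using psd_qf_le_trace[OF assms(2) e] by auto
  have "- ?q \<le> (s - 2) * ?q" using q(1) assms(1) mult_right_mono[of "-1" "s - 2" ?q] by simp
  then have "0 \<le> trace (Y - X) + (s - 2) * ?q" using q by linarith
  then have "trace X + (s - 2) * (e \<bullet> (X *v e)) \<le> trace Y + (s - 2) * (e \<bullet> (Y *v e))"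
    unfolding trace_diff qf_diff by (simp add: algebra_simps)
  also have "\<dots> \<le> sup_op s Y" by (rule sup_op_ge[OF e])
  finally show "trace X + (s - 2) * (e \<bullet> (X *v e)) \<le> sup_op s Y" .
qed

text \<open>For each direction the two parts are estimated separately. The sign of s - 2 decides
  whether the value of the form is compared with 0 or with the trace.\<close>

lemma sup_op_parts:
  assumes "pos_neg_parts X P N" "s > 1"
  shows "sup_op s X \<le> max 1 (s - 1) * trace P - min 1 (s - 1) * trace N"
proof (rule sup_op_le)
  fix e :: "real^'a" assume e: "norm e \<le> 1"
  let ?a = "e \<bullet> (P *v e)" and ?b = "e \<bullet> (N *v e)"
  have X: "X = P - N" and PN: "psd P" "psd N" using assms by (auto simp: pos_neg_parts_def)
  have q: "0 \<le> ?a" "?a \<le> trace P" "0 \<le> ?b" "?b \<le> trace N" using psd_qf_le_trace[OF _ e] PN by auto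
  have "trace P + (s - 2) * ?a \<le> max 1 (s - 1) * trace P"
  proof (cases "s \<ge> 2")
    case True
    then have "(s - 2) * ?a \<le> (s - 2) * trace P" using q by (intro mult_left_mono) auto
    then show ?thesis using True by (simp add: max_def algebra_simps)
  next
    case False
    then have "(s - 2) * ?a \<le> 0" using q by (intro mult_nonpos_nonneg) auto
    then show ?thesis using False by (simp add: max_def)
  qed
  moreover have "trace N + (s - 2) * ?b \<ge> min 1 (s - 1) * trace N"
  proof (cases "s \<ge> 2")
    case True
    then have "(s - 2) * ?b \<ge> 0" using q by (intro mult_nonneg_nonneg) auto
    then show ?thesis using True by (simp add: min_def)
  next
    case False
    then have "(s - 2) * trace N \<le> (s - 2) * ?b" using q by (intro mult_left_mono_neg) auto
    then show ?thesis using False by (simp add: min_def algebra_simps)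
  qed
  ultimately show "trace X + (s - 2) * (e \<bullet> (X *v e)) \<le> max 1 (s - 1) * trace P - min 1 (s - 1) * trace N"
    unfolding X trace_diff qf_diff by (simp add: algebra_simps)
qed

text \<open>Along the segment from x0 the mean value theorem is applied to the function minus its
  first and second order terms. Differentiability of the first partial derivatives at x0 makes the
  derivative of this difference small.\<close>

lemma C2_taylor_upper:
  fixes \<phi> :: "real^'n::finite \<Rightarrow> real"
  assumes C: "C_on 2 \<Omega> \<phi>" and op: "open \<Omega>" and x0: "x0 \<in> \<Omega>" and "\<tau> > 0"
  obtains s where "s > 0" "\<And>z. norm z < s \<Longrightarrow>
     \<phi> (x0 + z) \<le> \<phi> x0 + grad \<phi> x0 \<bullet> z + (z \<bullet> (hess \<phi> x0 *v z)) / 2 + \<tau> * (norm z)\<^sup>2"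
proof -
  \<comment> \<open>One share of the error for each of the n components that are summed at the
    end.\<close>
  define e where "e = \<tau> / real CARD('n)"
  have e: "e > 0" using \<open>\<tau> > 0\<close> by (simp add: e_def)
  have C1: "\<phi> differentiable (at x)" "partial i \<phi> differentiable (at x)" if "x \<in> \<Omega>" for x i
    using C that by (auto simp: numeral_2_eq_2)
  obtain b where b: "b > 0" "ball x0 b \<subseteq> \<Omega>" using op x0 open_contains_ball by blast
  have h: "(hess \<phi> x0 *v z) $ i = grad (partial i \<phi>) x0 \<bullet> z" for z i
    by (simp add: matrix_vector_mult_def hess_def inner_vec_def)
  have "\<exists>d>0. \<forall>y. norm (y - x0) < d \<longrightarrow> norm (partial i \<phi> y - partial i \<phi> x0 - grad (partial i \<phi>) x0 \<bullet> (y - x0)) \<le> e * norm (y - x0)" for i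
    using has_derivative_grad[OF C1(2)[OF x0, of i]] e unfolding has_derivative_at_alt by blast
  then obtain d where d: "\<And>i. d i > 0" "\<And>i y. norm (y - x0) < d i \<Longrightarrow>
      norm (partial i \<phi> y - partial i \<phi> x0 - grad (partial i \<phi>) x0 \<bullet> (y - x0)) \<le> e * norm (y - x0)" by metis
  define s where "s = min b (Min (range d))"
  have s: "s > 0" "s \<le> b" "s \<le> d i" for i using b d by (auto simp: s_def min.coboundedI2)
  show ?thesis
  proof (rule that[OF s(1)])
    fix z :: "real^'n" assume z: "norm z < s"
    let ?X = "hess \<phi> x0"
    have sym: "z \<bullet> (?X *v (t *\<^sub>R z)) = t * (z \<bullet> (?X *v z))" for t by (simp add: matrix_vector_mult_scaleR)
    define g where "g t = \<phi> (x0 + t *\<^sub>R z) - t * (grad \<phi> x0 \<bullet> z) - t\<^sup>2 / 2 * (z \<bullet> (?X *v z))" for t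
    have inb: "x0 + t *\<^sub>R z \<in> \<Omega>" "norm (t *\<^sub>R z) < s" if "0 \<le> t" "t \<le> 1" for t
    proof -
      have "\<bar>t\<bar> * norm z \<le> 1 * norm z" using that by (intro mult_right_mono) auto
      then show "norm (t *\<^sub>R z) < s" using z by simp
      then have "x0 + t *\<^sub>R z \<in> ball x0 b" using s(2) by (simp add: dist_norm)
      then show "x0 + t *\<^sub>R z \<in> \<Omega>" using b by blast
    qed
    have gd: "(g has_real_derivative (grad \<phi> (x0 + t *\<^sub>R z) \<bullet> z - grad \<phi> x0 \<bullet> z - t * (z \<bullet> (?X *v z)))) (at t)"
      if "0 \<le> t" "t \<le> 1" for t
    proof -
      have "((\<lambda>t. \<phi> (x0 + t *\<^sub>R z)) has_derivative (\<lambda>h. grad \<phi> (x0 + t *\<^sub>R z) \<bullet> (h *\<^sub>R z))) (at t)"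
        by (rule has_derivative_compose[where f="\<lambda>t. x0 + t *\<^sub>R z" and g=\<phi>,
              OF _ has_derivative_grad[OF C1(1)[OF inb(1)[OF that]]]])
          (auto intro!: derivative_eq_intros)
      moreover have "(\<lambda>h. grad \<phi> (x0 + t *\<^sub>R z) \<bullet> (h *\<^sub>R z)) = (*) (grad \<phi> (x0 + t *\<^sub>R z) \<bullet> z)" by auto
      ultimately have "((\<lambda>t. \<phi> (x0 + t *\<^sub>R z)) has_real_derivative (grad \<phi> (x0 + t *\<^sub>R z) \<bullet> z)) (at t)"
        by (simp add: has_field_derivative_def)
      then show ?thesis unfolding g_def[abs_def] by (auto intro!: derivative_eq_intros)
    qed
    obtain t where t: "0 < t" "t < 1" "g 1 - g 0 = (1 - 0) * (grad \<phi> (x0 + t *\<^sub>R z) \<bullet> z - grad \<phi> x0 \<bullet> z - t * (z \<bullet> (?X *v z)))"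
      using MVT2[of 0 1 g "\<lambda>t. grad \<phi> (x0 + t *\<^sub>R z) \<bullet> z - grad \<phi> x0 \<bullet> z - t * (z \<bullet> (?X *v z))"] gd by auto
    have "g 1 - g 0 = (\<Sum>i\<in>UNIV. (partial i \<phi> (x0 + t *\<^sub>R z) - partial i \<phi> x0 - grad (partial i \<phi>) x0 \<bullet> (t *\<^sub>R z)) * z $ i)"
    proof -
      have "t * (z \<bullet> (?X *v z)) = (\<Sum>i\<in>UNIV. (grad (partial i \<phi>) x0 \<bullet> (t *\<^sub>R z)) * z $ i)"
        unfolding sym[symmetric] inner_vec_def[of z] by (simp add: h matrix_vector_mult_scaleR sum_distrib_left mult_ac)
      then show ?thesis unfolding t(3)
        by (simp add: inner_vec_def[of "grad \<phi> _" z] sum_subtractf left_diff_distrib)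
    qed
    also have "\<dots> \<le> (\<Sum>i\<in>(UNIV::'n set). e * norm z * norm z)"
    proof (rule sum_mono)
      fix i
      let ?A = "partial i \<phi> (x0 + t *\<^sub>R z) - partial i \<phi> x0 - grad (partial i \<phi>) x0 \<bullet> (t *\<^sub>R z)"
      have "norm (t *\<^sub>R z) < d i" using inb(2)[of t] t s(3)[of i] by linarith
      then have "\<bar>?A\<bar> \<le> e * norm (t *\<^sub>R z)" using d(2)[of "x0 + t *\<^sub>R z" i] by simp
      also have "\<dots> \<le> e * norm z" using t e by (intro mult_left_mono) (auto intro: mult_left_le_one_le)
      finally have "\<bar>?A\<bar> * \<bar>z $ i\<bar> \<le> (e * norm z) * norm z"
        using component_le_norm_cart[of z i] e by (intro mult_mono) auto
      then show "?A * z $ i \<le> e * norm z * norm z" using abs_ge_self[of "?A * z $ i"] by (simp add: abs_mult)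
    qed
    also have "\<dots> = \<tau> * (norm z)\<^sup>2" by (simp add: e_def power2_eq_square)
    finally show "\<phi> (x0 + z) \<le> \<phi> x0 + grad \<phi> x0 \<bullet> z + (z \<bullet> (hess \<phi> x0 *v z)) / 2 + \<tau> * (norm z)\<^sup>2"
      by (simp add: g_def)
  qed
qed

section \<open>The modulus t |ln t|\<close>

definition eta :: "real \<Rightarrow> real" where "eta t = t * \<bar>ln t\<bar>"

lemma eta_nonneg: "0 \<le> t \<Longrightarrow> 0 \<le> eta t" by (simp add: eta_def)

lemma eta_le_sqrt: "0 \<le> t \<Longrightarrow> t \<le> 1 \<Longrightarrow> eta t \<le> 2 * sqrt t"
proof (cases "t = 0")
  case False
  assume "0 \<le> t" "t \<le> 1"
  with False have t: "0 < t" "t \<le> 1" by auto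
  have "ln (1 / sqrt t) \<le> 1 / sqrt t - 1" using t by (intro ln_le_minus_one) simp
  moreover have "ln (1 / sqrt t) = - ln t / 2" using t by (simp add: ln_div ln_sqrt)
  moreover have "\<bar>ln t\<bar> = - ln t" using t by simp
  ultimately have "\<bar>ln t\<bar> \<le> 2 / sqrt t" by simp
  then have "t * \<bar>ln t\<bar> \<le> t * (2 / sqrt t)" using t by (intro mult_left_mono) auto
  also have "\<dots> = 2 * (t / sqrt t)" by simp
  also have "\<dots> = 2 * sqrt t" using t by (simp only: real_div_sqrt less_imp_le)
  finally show ?thesis by (simp add: eta_def)
qed (simp add: eta_def)

lemma continuous_on_eta: "continuous_on {0..} eta"
  unfolding continuous_on_def
proof
  fix t :: real assume t: "t \<in> {0..}"
  show "(eta \<longlongrightarrow> eta t) (at t within {0..})"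
  proof (cases "t = 0")
    case False
    then have "t > 0" using t by simp
    then have "isCont eta t" unfolding eta_def[abs_def] by (intro continuous_intros) auto
    then show ?thesis unfolding isCont_def by (rule tendsto_within_subset) simp
  next
    case True
    have "((\<lambda>t. 2 * sqrt t) \<longlongrightarrow> 2 * sqrt 0) (at 0 within {0..})"
      by (intro tendsto_intros)
    then have l: "((\<lambda>t. 2 * sqrt t) \<longlongrightarrow> 0) (at 0 within {0..})" by simp
    have ev: "\<forall>\<^sub>F t in at 0 within {0..}. norm (eta t) \<le> 2 * sqrt t"
      unfolding eventually_at
      by (rule exI[of _ 1]) (auto simp: dist_real_def eta_le_sqrt eta_nonneg)
    have "eta 0 = 0" by (simp add: eta_def)
    then show ?thesis using Lim_null_comparison[OF ev l] True by simp
  qed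
qed

text \<open>Replaces the logarithmic term of \<open>reg_op\<close> by \<open>eta\<close> of the
  regularised norm, which is continuous as the gradient and the regularisation tend to 0
  together.\<close>

lemma half_ln_square_bound:
  assumes "0 \<le> a" "0 < d"
  shows "a * \<bar>ln (a\<^sup>2 + d\<^sup>2) / 2\<bar> \<le> eta (sqrt (a\<^sup>2 + d\<^sup>2))"
proof -
  have p: "a\<^sup>2 + d\<^sup>2 > 0" using assms by (simp add: add_nonneg_pos)
  have "a \<le> sqrt (a\<^sup>2 + d\<^sup>2)" by (rule real_le_rsqrt) simp
  moreover have "ln (sqrt (a\<^sup>2 + d\<^sup>2)) = ln (a\<^sup>2 + d\<^sup>2) / 2" using p by (simp add: ln_sqrt)
  ultimately show ?thesis unfolding eta_def by (simp only: mult_right_mono abs_ge_zero)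
qed

section \<open>Weak subsolutions are viscosity subsolutions\<close>

lemma usc_open: "open \<Omega> \<Longrightarrow> usc_on \<Omega> u \<Longrightarrow> open {x \<in> \<Omega>. u x < a}"
  using openin_open_eq by (auto simp: usc_on_def)

lemma usc_bounded_above:
  assumes "open \<Omega>" "usc_on \<Omega> u" "compact K" "K \<subseteq> \<Omega>"
  obtains U where "\<And>x. x \<in> K \<Longrightarrow> u x \<le> U"
proof -
  have "K \<subseteq> (\<Union>n\<in>UNIV. {x \<in> \<Omega>. u x < real n})"
  proof
    fix x assume "x \<in> K"
    moreover obtain n where "u x < real n" using reals_Archimedean2 by blast
    ultimately show "x \<in> (\<Union>n\<in>UNIV. {x \<in> \<Omega>. u x < real n})" using assms(4) by blast
  qed
  then obtain C where C: "C \<subseteq> UNIV" "finite C" "K \<subseteq> (\<Union>n\<in>C. {x \<in> \<Omega>. u x < real n})"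
    using compactE_image[OF assms(3), of UNIV "\<lambda>n. {x \<in> \<Omega>. u x < real n}"] usc_open[OF assms(1,2)] by blast
  show ?thesis
  proof (rule that[of "real (Max (insert 0 C))"])
    fix x assume "x \<in> K"
    then obtain n where n: "n \<in> C" "u x < real n" using C by blast
    have "n \<le> Max (insert 0 C)" using n(1) C(2) by simp
    then show "u x \<le> real (Max (insert 0 C))" using n(2) by linarith
  qed
qed

text \<open>The second order part is compared with its value at x0 for the same direction
  \<open>e\<close>. Since \<open>str\<close> holds for all directions in the unit ball, it does not
  matter how the direction varies near a critical point; only coefficients and second derivatives
  have to be continuous.\<close>

lemma strict_supersolution_near:
  fixes Q :: "real^'n::finite \<Rightarrow> real"
  assumes op: "open \<Omega>" and x0: "x0 \<in> \<Omega>" and p: "C_on 1 \<Omega> p" and Q: "smooth Q"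
    and S: "S > 0" and \<Phi>: "norm (grad p x0) * eta (norm (grad Q x0)) \<le> \<Phi>"
    and str: "\<And>e. norm e \<le> 1 \<Longrightarrow> trace (hess Q x0) + (p x0 - 2) * (e \<bullet> (hess Q x0 *v e)) \<le> - S - \<Phi>"
  obtains d where "d > 0" "\<And>x \<delta>. dist x0 x < d \<Longrightarrow> 0 < \<delta> \<Longrightarrow> \<delta> < d \<Longrightarrow> reg_op p Q \<delta> x \<le> 0"
proof -
  have pd: "p differentiable (at x)" if "x \<in> \<Omega>" for x using p that by auto
  have pc: "continuous_on \<Omega> p"
    using pd by (auto intro!: continuous_at_imp_continuous_on differentiable_imp_continuous_within)
  have pgc: "continuous_on \<Omega> (grad p)" unfolding grad_def[abs_def]
    using p by (intro continuous_on_vec_lambda) auto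
  define Y where "Y = hess Q"
  have Yc: "continuous_on \<Omega> (\<lambda>x. Y x $ i $ j)" for i j
    unfolding Y_def hess_def by (simp add: smooth_cont smooth_partial Q)
  have gQc: "continuous_on \<Omega> (grad Q)" unfolding grad_def[abs_def]
    by (intro continuous_on_vec_lambda smooth_cont smooth_partial Q)
  define err where "err x = \<bar>trace (Y x) - trace (Y x0)\<bar> + \<bar>p x - 2\<bar> * (\<Sum>i\<in>UNIV. \<Sum>j\<in>UNIV. \<bar>Y x $ i $ j - Y x0 $ i $ j\<bar>)
      + \<bar>p x - p x0\<bar> * (\<Sum>i\<in>UNIV. \<Sum>j\<in>UNIV. \<bar>Y x0 $ i $ j\<bar>)" for x
  have errc: "continuous_on \<Omega> err" unfolding err_def trace_def by (intro continuous_intros pc Yc)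
  \<comment> \<open>All errors and the first order term in one function, jointly continuous down to
    \<delta> = 0. A product neighbourhood of (x0, 0) then works uniformly in \<delta>.\<close>
  define H where "H = (\<lambda>(x, \<delta>). err x + norm (grad p x) * eta (sqrt ((norm (grad Q x))\<^sup>2 + \<delta>\<^sup>2)))"
  have fstc: "continuous_on (\<Omega> \<times> (UNIV :: real set)) (\<lambda>z. f (fst z))" if "continuous_on \<Omega> f" for f :: "real^'n \<Rightarrow> 'b::topological_space"
    by (rule continuous_on_compose2[OF that continuous_on_fst]) (auto intro: continuous_on_id)
  have "continuous_on (\<Omega> \<times> UNIV) H"
    unfolding H_def case_prod_unfold
    by (intro continuous_intros fstc errc pgc gQc continuous_on_compose2[OF continuous_on_eta]) auto
  then have o1: "open (\<Omega> \<times> UNIV \<inter> H -` {..<\<Phi> + S})"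
    by (rule continuous_open_preimage) (auto intro: open_Times op)
  have o2: "(x0, 0) \<in> \<Omega> \<times> UNIV \<inter> H -` {..<\<Phi> + S}"
    using x0 \<Phi> S by (simp add: H_def err_def)
  obtain A B where AB: "open A" "open B" "(x0, 0) \<in> A \<times> B" "A \<times> B \<subseteq> \<Omega> \<times> UNIV \<inter> H -` {..<\<Phi> + S}"
    by (rule open_prod_elim[OF o1 o2])
  have AB': "x0 \<in> A" "0 \<in> B" using AB(3) by auto
  obtain a where a: "a > 0" "ball x0 a \<subseteq> A" using AB(1) AB'(1) unfolding open_contains_ball by blast
  obtain b where b: "b > 0" "ball 0 b \<subseteq> B" using AB(2) AB'(2) unfolding open_contains_ball by blast
  show ?thesis
  proof (rule that[of "min a b"])
    show "0 < min a b" using a b by simp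
    fix x \<delta> assume x: "dist x0 x < min a b" and \<delta>: "0 < \<delta>" "\<delta> < min a b"
    have "x \<in> A" "\<delta> \<in> B" using a b x \<delta> by (auto simp: subset_iff)
    then have "(x, \<delta>) \<in> \<Omega> \<times> UNIV \<inter> H -` {..<\<Phi> + S}" using AB by blast
    then have Hx: "H (x, \<delta>) < \<Phi> + S" by simp
    let ?q = "grad Q x"
    define s where "s = (norm ?q)\<^sup>2 + \<delta>\<^sup>2"
    have s0: "s > 0" using \<delta> by (simp add: s_def add_nonneg_pos)
    \<comment> \<open>With this choice the quotient in \<open>reg_op\<close> is exactly the
      quadratic form of the Hessian at \<open>e\<close>.\<close>
    define e where "e = (1 / sqrt s) *\<^sub>R ?q"
    have e1: "norm e \<le> 1"
    proof -
      have "norm ?q \<le> sqrt s" by (rule real_le_rsqrt) (simp add: s_def)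
      then show ?thesis using s0 by (simp add: e_def divide_le_eq)
    qed
    have ei: "\<bar>e $ i\<bar> \<le> 1" for i using component_le_norm_cart[of e i] e1 by linarith
    have ss: "sqrt s * sqrt s = s" using s0 by simp
    have quad: "(\<Sum>i\<in>UNIV. \<Sum>j\<in>UNIV. partial j (partial i Q) x * partial i Q x * partial j Q x) / s
        = (\<Sum>i\<in>UNIV. \<Sum>j\<in>UNIV. Y x $ i $ j * e $ i * e $ j)"
      unfolding sum_divide_distrib
    proof (intro sum.cong refl)
      fix i j
      have "Y x $ i $ j * e $ i * e $ j = Y x $ i $ j * partial i Q x * partial j Q x / (sqrt s * sqrt s)"
        by (simp add: e_def)
      then show "partial j (partial i Q) x * partial i Q x * partial j Q x / s = Y x $ i $ j * e $ i * e $ j"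
        unfolding ss by (simp add: Y_def hess_def)
    qed
    let ?P = "\<lambda>M. \<Sum>i\<in>UNIV. \<Sum>j\<in>UNIV. M $ i $ j * e $ i * e $ j"
    have dP: "\<bar>?P M - ?P M'\<bar> \<le> (\<Sum>i\<in>UNIV. \<Sum>j\<in>UNIV. \<bar>M $ i $ j - M' $ i $ j\<bar>)" for M M' :: "real^'n^'n"
    proof -
      have "?P M - ?P M' = (\<Sum>i\<in>UNIV. \<Sum>j\<in>UNIV. (M $ i $ j - M' $ i $ j) * e $ i * e $ j)"
        by (simp add: sum_subtractf left_diff_distrib)
      also have "\<bar>\<dots>\<bar> \<le> (\<Sum>i\<in>UNIV. \<Sum>j\<in>UNIV. \<bar>(M $ i $ j - M' $ i $ j) * e $ i * e $ j\<bar>)"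
        by (rule order_trans[OF sum_abs]) (intro sum_mono sum_abs)
      also have "\<dots> \<le> (\<Sum>i\<in>UNIV. \<Sum>j\<in>UNIV. \<bar>M $ i $ j - M' $ i $ j\<bar>)"
      proof (intro sum_mono)
        fix i j
        have "\<bar>(M $ i $ j - M' $ i $ j) * e $ i * e $ j\<bar> = \<bar>M $ i $ j - M' $ i $ j\<bar> * (\<bar>e $ i\<bar> * \<bar>e $ j\<bar>)" by (simp add: abs_mult)
        also have "\<dots> \<le> \<bar>M $ i $ j - M' $ i $ j\<bar> * (1 * 1)" using ei by (intro mult_left_mono mult_mono) auto
        finally show "\<bar>(M $ i $ j - M' $ i $ j) * e $ i * e $ j\<bar> \<le> \<bar>M $ i $ j - M' $ i $ j\<bar>" by simp
      qed
      finally show ?thesis .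
    qed
    have P0: "\<bar>?P M\<bar> \<le> (\<Sum>i\<in>UNIV. \<Sum>j\<in>UNIV. \<bar>M $ i $ j\<bar>)" for M :: "real^'n^'n"
      using dP[of M 0] by simp
    have "(p x - 2) * ?P (Y x) = (p x0 - 2) * ?P (Y x0) + (p x - 2) * (?P (Y x) - ?P (Y x0)) + (p x - p x0) * ?P (Y x0)"
      by (simp add: algebra_simps)
    moreover have "(p x - 2) * (?P (Y x) - ?P (Y x0)) \<le> \<bar>p x - 2\<bar> * (\<Sum>i\<in>UNIV. \<Sum>j\<in>UNIV. \<bar>Y x $ i $ j - Y x0 $ i $ j\<bar>)"
      by (rule order_trans[OF abs_ge_self]) (simp add: abs_mult mult_left_mono dP)
    moreover have "(p x - p x0) * ?P (Y x0) \<le> \<bar>p x - p x0\<bar> * (\<Sum>i\<in>UNIV. \<Sum>j\<in>UNIV. \<bar>Y x0 $ i $ j\<bar>)"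
      by (rule order_trans[OF abs_ge_self]) (simp add: abs_mult mult_left_mono P0)
    ultimately have b1: "trace (Y x) + (p x - 2) * ?P (Y x) \<le> trace (Y x0) + (p x0 - 2) * ?P (Y x0) + err x"
      unfolding err_def by linarith
    have b2: "trace (Y x0) + (p x0 - 2) * ?P (Y x0) \<le> - S - \<Phi>"
      using str[OF e1] by (simp add: Y_def qf_sum)
    have b3: "ln s / 2 * (grad p x \<bullet> ?q) \<le> norm (grad p x) * eta (sqrt s)"
    proof -
      have "ln s / 2 * (grad p x \<bullet> ?q) \<le> \<bar>ln s / 2\<bar> * \<bar>grad p x \<bullet> ?q\<bar>"
        using abs_ge_self[of "ln s / 2 * (grad p x \<bullet> ?q)"] by (simp add: abs_mult)
      also have "\<dots> \<le> \<bar>ln s / 2\<bar> * (norm (grad p x) * norm ?q)"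
        by (intro mult_left_mono Cauchy_Schwarz_ineq2) simp
      also have "\<dots> = norm (grad p x) * (norm ?q * \<bar>ln s / 2\<bar>)" by simp
      also have "\<dots> \<le> norm (grad p x) * eta (sqrt s)"
        unfolding s_def by (intro mult_left_mono half_ln_square_bound \<delta>) auto
      finally show ?thesis .
    qed
    have "reg_op p Q \<delta> x = trace (Y x) + (p x - 2) * ?P (Y x) + ln s / 2 * (grad p x \<bullet> ?q)"
      unfolding reg_op_def s_def[symmetric] times_divide_eq_right[symmetric] quad by (simp add: trace_def Y_def hess_def)
    also have "\<dots> \<le> (- S - \<Phi>) + H (x, \<delta>)"
      using b1 b2 b3 by (simp add: H_def s_def)
    also have "\<dots> \<le> 0" using Hx by simp
    finally show "reg_op p Q \<delta> x \<le> 0" .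
  qed
qed

text \<open>The term with \<open>\<tau>\<close> makes the touching strict. The quartic term does not
  affect derivatives up to second order at \<open>x0\<close>, yet makes the polynomial large far
  away.\<close>

definition qpoly :: "real \<Rightarrow> real^'n::finite \<Rightarrow> real^'n \<Rightarrow> real^'n^'n \<Rightarrow> real \<Rightarrow> real \<Rightarrow> real^'n \<Rightarrow> real"
  where "qpoly c x0 q X \<tau> N x = c + q \<bullet> (x - x0) + ((x - x0) \<bullet> (X *v (x - x0))) / 2 + \<tau> * ((x - x0) \<bullet> (x - x0))
     + N * ((x - x0) \<bullet> (x - x0)) * ((x - x0) \<bullet> (x - x0))"

lemma qpoly_smooth: "smooth (qpoly c x0 q X \<tau> N)"
proof -
  have eq: "qpoly c x0 q X \<tau> N = (\<lambda>x. c + (\<Sum>i\<in>UNIV. q $ i * (x $ i - x0 $ i))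
     + (\<Sum>i\<in>UNIV. (x $ i - x0 $ i) * (\<Sum>j\<in>UNIV. X $ i $ j * (x $ j - x0 $ j))) * (1/2)
     + \<tau> * (\<Sum>i\<in>UNIV. (x $ i - x0 $ i) * (x $ i - x0 $ i))
     + N * (\<Sum>i\<in>UNIV. (x $ i - x0 $ i) * (x $ i - x0 $ i)) * (\<Sum>i\<in>UNIV. (x $ i - x0 $ i) * (x $ i - x0 $ i)))"
    by (simp add: qpoly_def fun_eq_iff inner_vec_def matrix_vector_mult_def)
  have sz: "smooth (\<lambda>x. x $ i - x0 $ i)" for i
    by (rule smooth_minus[OF smooth_coord smooth_const])
  have sq: "smooth (\<lambda>x. \<Sum>i\<in>UNIV. (x $ i - x0 $ i) * (x $ i - x0 $ i))"
    by (intro smooth_sum smooth_mult sz) simp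
  have s1: "smooth (\<lambda>x. \<Sum>i\<in>UNIV. q $ i * (x $ i - x0 $ i))"
    by (intro smooth_sum smooth_mult[OF smooth_const] sz) simp
  have s2: "smooth (\<lambda>x. \<Sum>i\<in>UNIV. (x $ i - x0 $ i) * (\<Sum>j\<in>UNIV. X $ i $ j * (x $ j - x0 $ j)))"
    by (intro smooth_sum smooth_mult[OF sz] smooth_mult[OF smooth_const] sz) simp_all
  show ?thesis unfolding eq
    by (rule smooth_add[OF smooth_add[OF smooth_add[OF smooth_add[OF smooth_const s1]
        smooth_mult[OF s2 smooth_const]] smooth_mult[OF smooth_const sq]] smooth_mult[OF smooth_mult[OF smooth_const sq] sq]])
qed

lemma qpoly_partial:
  "partial i (qpoly c x0 q X \<tau> N) x = q $ i + ((X *v (x - x0)) $ i + (x - x0) \<bullet> (X *v axis i 1)) / 2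
     + 2 * \<tau> * (x - x0) $ i + 4 * N * ((x - x0) \<bullet> (x - x0)) * (x - x0) $ i"
proof -
  let ?z = "x - x0"
  have d: "((\<lambda>x. x - x0) has_derivative (\<lambda>h. h)) (at x)" by (auto intro!: derivative_eq_intros)
  have dX: "((\<lambda>x. X *v (x - x0)) has_derivative (\<lambda>h. X *v h)) (at x)"
    by (rule bounded_linear.has_derivative[OF matrix_vector_mul_bounded_linear d])
  have dz: "((\<lambda>x. (x - x0) \<bullet> (x - x0)) has_derivative (\<lambda>h. ?z \<bullet> h + h \<bullet> ?z)) (at x)"
    by (rule has_derivative_inner[OF d d])
  have dq: "((\<lambda>x. ((x - x0) \<bullet> (X *v (x - x0))) / 2) has_derivative (\<lambda>h. (?z \<bullet> (X *v h) + h \<bullet> (X *v ?z)) / 2)) (at x)"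
    by (rule bounded_linear.has_derivative[OF bounded_linear_divide has_derivative_inner[OF d dX]])
  have "(qpoly c x0 q X \<tau> N has_derivative (\<lambda>h. 0 + q \<bullet> h + (?z \<bullet> (X *v h) + h \<bullet> (X *v ?z)) / 2 + \<tau> * (?z \<bullet> h + h \<bullet> ?z)
     + ((N * (?z \<bullet> ?z)) * (?z \<bullet> h + h \<bullet> ?z) + (N * (?z \<bullet> h + h \<bullet> ?z)) * (?z \<bullet> ?z)))) (at x)"
    unfolding qpoly_def[abs_def]
    by (intro has_derivative_add has_derivative_const has_derivative_mult_right has_derivative_mult
        dq dz has_derivative_inner_right d)
  from partial_eq[OF this] show ?thesis
    by (simp add: inner_axis inner_axis' algebra_simps)
qed

lemma qpoly_grad: "grad (qpoly c x0 q X \<tau> N) x0 = q"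
  by (simp add: vec_eq_iff qpoly_partial)

text \<open>\<open>X\<close> is not assumed symmetric, so its symmetrisation appears; trace and
  quadratic form are the same for both.\<close>

lemma qpoly_hess:
  fixes X :: "real^'n::finite^'n"
  shows "hess (qpoly c x0 q X \<tau> N) x0 $ i $ j = (X $ i $ j + X $ j $ i) / 2 + (if i = j then 2 * \<tau> else 0)"
proof -
  have mv: "(X *v axis l 1) $ m = X $ m $ l" for l m
    by (simp add: matrix_vector_mult_def axis_def if_distrib cong: if_cong)
  have ax: "axis l (1::real) $ m = (if m = l then 1 else 0)" for l m :: 'n by (simp add: axis_def)
  have d: "((\<lambda>x. x - x0) has_derivative (\<lambda>h. h)) (at x0)" by (auto intro!: derivative_eq_intros)
  have di: "((\<lambda>x. (x - x0) $ i) has_derivative (\<lambda>h. h $ i)) (at x0)"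
    by (rule bounded_linear.has_derivative[OF bounded_linear_vec_nth d])
  have dX: "((\<lambda>x. (X *v (x - x0)) $ i) has_derivative (\<lambda>h. (X *v h) $ i)) (at x0)"
    by (rule bounded_linear.has_derivative[OF bounded_linear_vec_nth bounded_linear.has_derivative[OF matrix_vector_mul_bounded_linear d]])
  have dz: "((\<lambda>x. (x - x0) \<bullet> (x - x0)) has_derivative (\<lambda>h. (x0 - x0) \<bullet> h + h \<bullet> (x0 - x0))) (at x0)"
    by (rule has_derivative_inner[OF d d])
  have c: "(\<lambda>x. q $ i + ((X *v (x - x0)) $ i + (x - x0) \<bullet> (X *v axis i 1)) / 2
     + 2 * \<tau> * (x - x0) $ i + 4 * N * ((x - x0) \<bullet> (x - x0)) * (x - x0) $ i) = partial i (qpoly c x0 q X \<tau> N)"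
    by (simp add: fun_eq_iff qpoly_partial)
  have dq: "((\<lambda>x. ((X *v (x - x0)) $ i + (x - x0) \<bullet> (X *v axis i 1)) / 2) has_derivative
      (\<lambda>h. ((X *v h) $ i + h \<bullet> (X *v axis i 1)) / 2)) (at x0)"
    by (rule bounded_linear.has_derivative[OF bounded_linear_divide
        has_derivative_add[OF dX has_derivative_inner_left[OF d]]])
  have "(partial i (qpoly c x0 q X \<tau> N) has_derivative (\<lambda>h. 0 + ((X *v h) $ i + h \<bullet> (X *v axis i 1)) / 2 + 2 * \<tau> * h $ i
     + ((4 * N * ((x0 - x0) \<bullet> (x0 - x0))) * h $ i + (4 * N * ((x0 - x0) \<bullet> h + h \<bullet> (x0 - x0))) * (x0 - x0) $ i))) (at x0)"
    unfolding c[symmetric]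
    by (intro has_derivative_add has_derivative_const has_derivative_mult_right has_derivative_mult dq dz di)
  from partial_eq[OF this] show ?thesis
    by (simp add: hess_def inner_axis' mv ax)
qed

lemma viscosity_core:
  fixes u :: "real^'n::finite \<Rightarrow> real"
  assumes op: "open \<Omega>" and x0: "x0 \<in> \<Omega>" and p: "C_on 1 \<Omega> p" and p1: "\<And>x. x \<in> \<Omega> \<Longrightarrow> 1 < p x"
    and sub: "px_subharmonic \<Omega> p u" and \<phi>: "C_on 2 \<Omega> \<phi>"
    and max: "\<forall>\<^sub>F x in at x0 within \<Omega>. u x - \<phi> x \<le> u x0 - \<phi> x0"
    and S: "S > 0" and \<Phi>: "norm (grad p x0) * eta (norm (grad \<phi> x0)) \<le> \<Phi>"
    and str: "\<And>e. norm e \<le> 1 \<Longrightarrow> trace (hess \<phi> x0) + (p x0 - 2) * (e \<bullet> (hess \<phi> x0 *v e)) \<le> - S - \<Phi>"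
  shows False
proof -
  have ws: "weak_subsolution \<Omega> p u" and usc: "usc_on \<Omega> u" and can: "ereal (u x0) = ess_limsup \<Omega> u x0"
    using sub x0 by (auto simp: px_subharmonic_def)
  let ?q = "grad \<phi> x0" and ?X = "hess \<phi> x0"
  \<comment> \<open>Adding 2 \<tau> times the identity to the Hessian raises the second order part
    by at most 2 \<tau> (n + |p(x0) - 2|) = S / 2, so half of the strictness survives.\<close>
  define \<tau> where "\<tau> = S / (4 * (real CARD('n) + \<bar>p x0 - 2\<bar>))"
  have den: "real CARD('n) + \<bar>p x0 - 2\<bar> > 0" by (simp add: add_pos_nonneg)
  have \<tau>: "\<tau> > 0" "2 * \<tau> * (real CARD('n) + \<bar>p x0 - 2\<bar>) = S / 2"
  proof -
    have "\<tau> = S / (4 * D)" "D > 0 \<Longrightarrow> 2 * (S / (4 * D)) * D = S / 2" if "D = real CARD('n) + \<bar>p x0 - 2\<bar>" for D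
      by (simp_all add: \<tau>_def that[symmetric])
    from this[OF refl] show "\<tau> > 0" "2 * \<tau> * (real CARD('n) + \<bar>p x0 - 2\<bar>) = S / 2"
      using S den by (simp_all only: divide_pos_pos mult_pos_pos zero_less_numeral)
  qed
  obtain s where s: "s > 0" "\<And>z. norm z < s \<Longrightarrow>
     \<phi> (x0 + z) \<le> \<phi> x0 + ?q \<bullet> z + (z \<bullet> (?X *v z)) / 2 + \<tau> / 2 * (norm z)\<^sup>2"
    using C2_taylor_upper[OF \<phi> op x0, of "\<tau> / 2"] \<tau>(1) by auto
  obtain d where d: "d > 0" "\<And>x. x \<in> \<Omega> \<Longrightarrow> x \<noteq> x0 \<Longrightarrow> dist x x0 < d \<Longrightarrow> u x - \<phi> x \<le> u x0 - \<phi> x0"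
    using max unfolding eventually_at by blast
  obtain b where b: "b > 0" "cball x0 b \<subseteq> \<Omega>" using op x0 open_contains_cball by blast
  define r where "r = min b (min s d / 2)"
  have r: "r > 0" "r < s" "r < d" "cball x0 r \<subseteq> \<Omega>" using b s d by (auto simp: r_def)
  obtain U where U: "\<And>x. x \<in> cball x0 r \<Longrightarrow> u x \<le> U"
    using usc_bounded_above[OF op usc compact_cball r(4)] by blast
  define R where "R = r / 2"
  have R: "R > 0" using r by (simp add: R_def)
  \<comment> \<open>The maximum with 0 accounts for the zero extension of \<open>u\<close>; the
    summand 1 pays for the later lowering by \<kappa> <= 1.\<close>
  define m where "m = max U 0 + 1"
  define B where "B = onorm ((*v) ?X)"
  have B: "B \<ge> 0" "\<bar>z \<bullet> (?X *v z)\<bar> \<le> B * (norm z)\<^sup>2" for z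
  proof -
    show "B \<ge> 0" unfolding B_def by (rule onorm_pos_le) simp
    have "\<bar>z \<bullet> (?X *v z)\<bar> \<le> norm z * norm (?X *v z)" by (rule Cauchy_Schwarz_ineq2)
    also have "\<dots> \<le> norm z * (B * norm z)" unfolding B_def by (intro mult_left_mono onorm) auto
    finally show "\<bar>z \<bullet> (?X *v z)\<bar> \<le> B * (norm z)\<^sup>2" by (simp add: power2_eq_square algebra_simps)
  qed
  \<comment> \<open>From distance \<open>R\<close> on, the three parts of the quartic term outweigh
    the linear term, the quadratic form, and the constant together with the target value
    \<open>m\<close>.\<close>
  define N where "N = norm ?q / R^3 + B / R^2 + (\<bar>u x0\<bar> + m) / R^4"
  have m: "m \<ge> 1" by (simp add: m_def)
  have N: "N \<ge> 0" unfolding N_def using R B m by (intro add_nonneg_nonneg divide_nonneg_pos) auto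
  define Q where "Q = qpoly (u x0) x0 ?q ?X \<tau> N"
  have Qs: "smooth Q" unfolding Q_def by (rule qpoly_smooth)
  have Qx: "Q x = u x0 + ?q \<bullet> (x - x0) + ((x - x0) \<bullet> (?X *v (x - x0))) / 2 + \<tau> * (norm (x - x0))\<^sup>2 + N * (norm (x - x0))^4" for x
    unfolding Q_def qpoly_def power2_norm_eq_inner[symmetric] by (simp add: power2_eq_square power4_eq_xxxx)
  have Q0: "Q x0 = u x0" by (simp add: Qx)
  have touch: "u x \<le> Q x - \<tau> / 2 * (norm (x - x0))\<^sup>2" if x: "x \<in> cball x0 r" for x
  proof (cases "x = x0")
    case False
    have n: "norm (x - x0) \<le> r" using x by (simp add: dist_norm norm_minus_commute)
    have "u x - \<phi> x \<le> u x0 - \<phi> x0"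
      using d(2)[OF _ False] x r n by (auto simp: dist_norm)
    moreover have "\<phi> x \<le> \<phi> x0 + ?q \<bullet> (x - x0) + ((x - x0) \<bullet> (?X *v (x - x0))) / 2 + \<tau> / 2 * (norm (x - x0))\<^sup>2"
      using s(2)[of "x - x0"] n r(2) by simp
    moreover have "0 \<le> N * (norm (x - x0))^4" using N by simp
    ultimately show ?thesis unfolding Qx by linarith
  qed (simp add: Q0)
  have far: "Q x \<ge> m" if x: "norm (x - x0) \<ge> R" for x
  proof -
    let ?n = "norm (x - x0)"
    have "norm ?q * ?n \<le> norm ?q / R^3 * ?n^4"
    proof -
      have "R^3 \<le> ?n^3" using x R by (intro power_mono) auto
      then have "?n * R^3 \<le> ?n * ?n^3" by (intro mult_left_mono) auto
      then have "?n \<le> ?n^4 / R^3" using R by (simp add: field_simps power4_eq_xxxx power3_eq_cube)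
      from mult_left_mono[OF this norm_ge_zero[of ?q]] show ?thesis by simp
    qed
    moreover have "B * ?n^2 \<le> B / R^2 * ?n^4"
    proof -
      have "R^2 \<le> ?n^2" using x R by (intro power_mono) auto
      then have "?n^2 * R^2 \<le> ?n^2 * ?n^2" by (intro mult_left_mono) auto
      then have "?n^2 \<le> ?n^4 / R^2" using R by (simp add: field_simps power4_eq_xxxx power2_eq_square)
      from mult_left_mono[OF this B(1)] show ?thesis by simp
    qed
    moreover have "\<bar>u x0\<bar> + m \<le> (\<bar>u x0\<bar> + m) / R^4 * ?n^4"
    proof -
      have "R^4 \<le> ?n^4" using x R by (intro power_mono) auto
      then have "1 \<le> ?n^4 / R^4" using R by simp
      from mult_left_mono[OF this, of "\<bar>u x0\<bar> + m"] m show ?thesis by simp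
    qed
    ultimately have "norm ?q * ?n + B * ?n^2 + (\<bar>u x0\<bar> + m) \<le> N * ?n^4"
      unfolding N_def by (simp add: distrib_right)
    moreover have "- (norm ?q * ?n) \<le> ?q \<bullet> (x - x0)" using Cauchy_Schwarz_ineq2[of ?q "x - x0"] by linarith
    moreover have "- (B * ?n^2) \<le> ((x - x0) \<bullet> (?X *v (x - x0))) / 2"
      using B(2)[of "x - x0"] B(1) mult_nonneg_nonneg[OF B(1) zero_le_power2[of ?n]] by linarith
    moreover have "0 \<le> \<tau> * ?n\<^sup>2" using \<tau> by simp
    ultimately show ?thesis unfolding Qx by linarith
  qed
  have hQ: "hess Q x0 $ i $ j = (?X $ i $ j + ?X $ j $ i) / 2 + (if i = j then 2 * \<tau> else 0)" for i j
    unfolding Q_def by (rule qpoly_hess)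
  have tr: "trace (hess Q x0) = trace ?X + 2 * \<tau> * real CARD('n)"
    by (simp add: trace_def hQ sum.distrib)
  have qf: "e \<bullet> (hess Q x0 *v e) = e \<bullet> (?X *v e) + 2 * \<tau> * (norm e)\<^sup>2" for e
  proof -
    have "e \<bullet> (hess Q x0 *v e) = (\<Sum>i\<in>UNIV. \<Sum>j\<in>UNIV. (?X $ i $ j * e $ i * e $ j) / 2)
        + (\<Sum>i\<in>UNIV. \<Sum>j\<in>UNIV. (?X $ j $ i * e $ i * e $ j) / 2) + (\<Sum>i\<in>UNIV. \<Sum>j\<in>UNIV. (if i = j then 2 * \<tau> * e $ i * e $ j else 0))"
      unfolding qf_sum hQ sum.distrib[symmetric] by (intro sum.cong refl) (auto simp: field_simps)
    also have "(\<Sum>i\<in>UNIV. \<Sum>j\<in>UNIV. (?X $ j $ i * e $ i * e $ j) / 2) = (\<Sum>i\<in>UNIV. \<Sum>j\<in>UNIV. (?X $ i $ j * e $ i * e $ j) / 2)"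
      by (subst sum.swap) (simp add: mult_ac)
    also have "(\<Sum>i\<in>UNIV. \<Sum>j\<in>UNIV. (if i = j then 2 * \<tau> * e $ i * e $ j else 0)) = 2 * \<tau> * (norm e)\<^sup>2"
      unfolding power2_norm_eq_inner by (simp add: inner_vec_def sum_distrib_left mult_ac)
    finally show ?thesis unfolding qf_sum by (simp add: sum_divide_distrib[symmetric])
  qed
  have str': "trace (hess Q x0) + (p x0 - 2) * (e \<bullet> (hess Q x0 *v e)) \<le> - (S / 2) - \<Phi>" if e: "norm e \<le> 1" for e
  proof -
    have "(norm e)\<^sup>2 \<le> 1" using e by (simp add: abs_square_le_1)
    then have "(p x0 - 2) * (2 * \<tau> * (norm e)\<^sup>2) \<le> \<bar>p x0 - 2\<bar> * (2 * \<tau> * 1)"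
      using \<tau>(1) by (intro mult_mono) auto
    then have "trace (hess Q x0) + (p x0 - 2) * (e \<bullet> (hess Q x0 *v e))
      \<le> trace ?X + (p x0 - 2) * (e \<bullet> (?X *v e)) + 2 * \<tau> * (real CARD('n) + \<bar>p x0 - 2\<bar>)"
      unfolding tr qf by (simp add: algebra_simps)
    then show ?thesis using str[OF e] \<tau>(2) by linarith
  qed
  have gQ: "grad Q x0 = ?q" unfolding Q_def by (rule qpoly_grad)
  obtain D where D: "D > 0" "\<And>x \<delta>. dist x0 x < D \<Longrightarrow> 0 < \<delta> \<Longrightarrow> \<delta> < D \<Longrightarrow> reg_op p Q \<delta> x \<le> 0"
    using strict_supersolution_near[OF op x0 p Qs, of "S / 2" \<Phi>] S \<Phi> str' gQ by auto
  define \<rho> where "\<rho> = min (D / 2) (r / 4)"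
  have \<rho>: "\<rho> > 0" "\<rho> < D" "\<rho> < r" "\<rho> \<le> r / 4" using D r by (auto simp: \<rho>_def)
  \<comment> \<open>At distance at least \<rho> / 2 from x0 the strict touching leaves a gap of
    \<tau> \<rho>^2 / 8. One half pays for the change of \<open>Q\<close> within the mollification
    radius, the other half for lowering \<open>Q\<close> by \<kappa>.\<close>
  define \<kappa> where "\<kappa> = min 1 (\<tau> * \<rho>\<^sup>2 / 16)"
  have \<kappa>: "\<kappa> > 0" "\<kappa> \<le> 1" "\<kappa> \<le> \<tau> * \<rho>\<^sup>2 / 16" using \<tau> \<rho> by (auto simp: \<kappa>_def)
  have "uniformly_continuous_on (cball x0 r) Q"
    by (intro compact_uniformly_continuous smooth_cont Qs compact_cball)
  then obtain \<epsilon> where \<epsilon>: "\<epsilon> > 0" "\<And>x y. x \<in> cball x0 r \<Longrightarrow> y \<in> cball x0 r \<Longrightarrow> dist y x < \<epsilon> \<Longrightarrow> dist (Q y) (Q x) < \<tau> * \<rho>\<^sup>2 / 16"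
    unfolding uniformly_continuous_on_def using \<tau> \<rho> by (metis divide_pos_pos mult_pos_pos zero_less_numeral zero_less_power)
  define \<epsilon>0 where "\<epsilon>0 = min \<epsilon> (\<rho> / 2)"
  have \<epsilon>0: "\<epsilon>0 > 0" "\<epsilon>0 \<le> \<epsilon>" "\<epsilon>0 \<le> \<rho> / 2" using \<epsilon> \<rho> by (auto simp: \<epsilon>0_def)
  \<comment> \<open>Lowering pushes the polynomial below \<open>u\<close> at x0 while it still
    dominates outside the small ball. Its derivatives, and so \<open>reg_op\<close>, are those of
    \<open>Q\<close>.\<close>
  define P where "P x = Q x - \<kappa>" for x
  have Ps: "smooth P" unfolding P_def by (intro smooth_minus Qs smooth_const)
  have pP: "partial i P = partial i Q" for i
  proof
    fix x
    have "((\<lambda>x. Q x - \<kappa>) has_derivative (\<lambda>h. grad Q x \<bullet> h - 0)) (at x)"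
      by (intro has_derivative_diff has_derivative_const has_derivative_grad smooth_differentiable Qs)
    from partial_eq[OF this] show "partial i P x = partial i Q x" by (simp add: P_def[abs_def] inner_axis)
  qed
  then have LP: "reg_op p P \<delta> x = reg_op p Q \<delta> x" for \<delta> x by (simp only: reg_op_def grad_def)
  have sep: "(if z \<in> cball x0 r then u z else 0) \<le> P x" if x: "x \<notin> cball x0 \<rho>" and z: "dist x z < \<epsilon>0" for x z
  proof (cases "norm (x - x0) \<ge> R")
    case True
    have "(if z \<in> cball x0 r then u z else 0) \<le> max U 0" using U[of z] by auto
    also have "\<dots> \<le> P x" using far[OF True] \<kappa>(2) unfolding P_def m_def by linarith
    finally show ?thesis .
  next
    case False
    have xr: "x \<in> cball x0 r" using False R by (simp add: R_def dist_norm norm_minus_commute)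
    have zx: "dist x0 z \<le> dist x0 x + dist x z" "dist x0 x \<le> dist x0 z + dist x z"
      using dist_triangle[of x0 z x] dist_triangle[of x0 x z] by (auto simp: dist_commute)
    have zr: "z \<in> cball x0 r" using False zx z \<epsilon>0 \<rho> r(1) by (auto simp: R_def dist_norm norm_minus_commute)
    have "\<rho> < dist x0 x" using x by simp
    then have "\<rho> / 2 \<le> norm (z - x0)" using zx(2) z \<epsilon>0(3) by (simp add: dist_norm norm_minus_commute)
    then have "(\<rho> / 2)\<^sup>2 \<le> (norm (z - x0))\<^sup>2" using \<rho> by (intro power_mono) auto
    then have "\<tau> / 2 * (\<rho>\<^sup>2 / 4) \<le> \<tau> / 2 * (norm (z - x0))\<^sup>2"
      using \<tau>(1) by (intro mult_left_mono) (auto simp: power2_eq_square)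
    then have "u z \<le> Q z - \<tau> * \<rho>\<^sup>2 / 8" using touch[OF zr] by simp
    moreover have "dist (Q z) (Q x) < \<tau> * \<rho>\<^sup>2 / 16"
      using \<epsilon>(2)[OF xr zr] z \<epsilon>0(2) by (simp add: dist_commute)
    ultimately have "u z \<le> Q x - \<kappa>" using \<kappa>(3) by (simp add: dist_real_def abs_if split: if_splits)
    then show ?thesis using zr by (simp add: P_def)
  qed
  have sup: "reg_op p P \<delta> x \<le> 0" if "x \<in> cball x0 \<rho>" "0 < \<delta>" "\<delta> < D" for x \<delta>
    using D(2)[of x \<delta>] that \<rho> unfolding LP by simp
  note wc = weak_comparison[OF op r(4) \<rho>(1) \<rho>(3) \<epsilon>0(1) D(1) p p1 ws Ps sep sup]
  have ae: "AE x in lborel. x \<in> cball x0 \<rho> \<longrightarrow> u x \<le> P x" by (rule wc(1))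
  have "isCont Q x0" using smooth_cont[OF Qs, of UNIV] by (simp add: continuous_on_eq_continuous_at)
  then obtain \<rho>1 where \<rho>1: "\<rho>1 > 0" "\<And>x. dist x x0 < \<rho>1 \<Longrightarrow> dist (Q x) (Q x0) < \<kappa> / 2"
    unfolding continuous_at_eps_delta using half_gt_zero[OF \<kappa>(1)] by (metis dist_norm)
  define t where "t = min \<rho> \<rho>1"
  have t: "t > 0" "t \<le> \<rho>" "t \<le> \<rho>1" using \<rho> \<rho>1 by (auto simp: t_def)
  have bt: "\<Omega> \<inter> ball x0 t \<subseteq> cball x0 r" using t \<rho> by auto
  have um: "u \<in> borel_measurable (lebesgue_on (cball x0 r))"
  proof (rule absolutely_integrable_imp_borel_measurable)
    show "u absolutely_integrable_on cball x0 r" by (rule wc(2))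
    show "cball x0 r \<in> sets lebesgue" by (rule fmeasurableD[OF lmeasurable_cball])
  qed
  have "(\<lambda>x. ereal (u x)) \<in> borel_measurable (lebesgue_on (\<Omega> \<inter> ball x0 t))"
    by (rule borel_measurable_ereal, rule measurable_restrict_mono[OF um bt])
  moreover have "AE x in lebesgue_on (\<Omega> \<inter> ball x0 t). ereal (u x) \<le> ereal (u x0 - \<kappa> / 2)"
  proof -
    have "AE x in lebesgue. x \<in> \<Omega> \<inter> ball x0 t \<longrightarrow> ereal (u x) \<le> ereal (u x0 - \<kappa> / 2)"
      using AE_completion[OF ae]
    proof eventually_elim
      case (elim x)
      show ?case
      proof
        assume "x \<in> \<Omega> \<inter> ball x0 t"
        then have x: "dist x0 x < t" by simp
        then have "u x \<le> Q x - \<kappa>" using elim t by (simp add: P_def)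
        moreover have "Q x < u x0 + \<kappa> / 2"
          using \<rho>1(2)[of x] x t Q0 by (simp add: dist_commute dist_real_def abs_if split: if_splits)
        ultimately show "ereal (u x) \<le> ereal (u x0 - \<kappa> / 2)" by simp
      qed
    qed
    then show ?thesis by (subst AE_restrict_space_iff) (auto intro!: sets.Int simp: op)
  qed
  \<comment> \<open>Near x0 almost all values of \<open>u\<close> lie below u(x0) - \<kappa> / 2, by
    continuity of \<open>Q\<close>. This contradicts u(x0) being the essential upper limit.\<close>
  ultimately have "esssup (lebesgue_on (\<Omega> \<inter> ball x0 t)) (\<lambda>y. ereal (u y)) \<le> ereal (u x0 - \<kappa> / 2)"
    by (rule esssup_I)
  moreover have "ess_limsup \<Omega> u x0 \<le> esssup (lebesgue_on (\<Omega> \<inter> ball x0 t)) (\<lambda>y. ereal (u y))"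
    unfolding ess_limsup_def by (rule INF_lower) (use t in simp)
  ultimately have "ereal (u x0) \<le> ereal (u x0 - \<kappa> / 2)" using can by (metis order_trans)
  then show False using \<kappa>(1) by simp
qed

section \<open>The operator and its structure condition\<close>

locale px_setting =
  fixes k :: "'n::finite" and p :: "real ^ 'n \<Rightarrow> real"
  assumes pC: "C_on 1 (half_space k) p"
    and p1: "\<forall>x\<in>half_space k. 1 < p x"
    and lam_fin: "\<forall>t>0. 0 < p_lam k p t \<and> p_lam k p t < \<infinity>"
    and Lam_fin: "\<forall>t>0. 0 < p_Lam k p t \<and> p_Lam k p t < \<infinity>"
    and Phi_fin: "\<forall>t\<ge>0. \<forall>s\<ge>0. \<bar>Phi k p t s\<bar> \<noteq> \<infinity>"
    and Phi_cont: "continuous_on ({0..} \<times> {0..}) (\<lambda>(t, s). Phi k p t s)"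
begin

abbreviation "\<Omega> \<equiv> half_space k"

section \<open>The coefficient functions as real functions\<close>

definition "D t = real_of_ereal (Dp_norm k p t)"
definition "lam t = real_of_ereal (p_lam k p t)"
definition "Lam t = real_of_ereal (p_Lam k p t)"

lemma open_half: "open \<Omega>"
proof -
  have "\<Omega> = {x. 0 < axis k 1 \<bullet> x}" by (auto simp: half_space_def inner_axis')
  then show ?thesis by (simp only: open_halfspace_gt)
qed

lemma convex_half: "convex \<Omega>"
proof -
  have "\<Omega> = {x. axis k 1 \<bullet> x > 0}" by (auto simp: half_space_def inner_axis')
  then show ?thesis by (simp only: convex_halfspace_gt)
qed

lemma axis_half: "t > 0 \<Longrightarrow> axis k t \<in> \<Omega>" by (simp add: half_space_def axis_def)

lemma nth_le_norm: "x $ k \<le> norm x"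
  using component_le_norm_cart[of x k] by linarith

lemma half_pos: "x \<in> \<Omega> \<Longrightarrow> 0 < x $ k" by (simp add: half_space_def)

lemma pdiff: "x \<in> \<Omega> \<Longrightarrow> p differentiable (at x)" using pC by auto

lemma Dp_nonneg: "0 \<le> Dp_norm k p t"
proof -
  have "axis k (max t 1) \<in> {y \<in> \<Omega>. t \<le> norm y}" by (auto simp: axis_half norm_axis_real)
  from SUP_upper[OF this, of "\<lambda>y. ereal (norm (grad p y))"]
  show ?thesis unfolding Dp_norm_def by (rule order_trans[rotated]) simp
qed

text \<open>At s = 1/2 the factor s |ln s| is not 0, so finiteness of \<open>Phi\<close> forces
  finiteness of \<open>Dp_norm\<close>. The case t = 0 makes p Lipschitz on the whole
  half-space.\<close>

lemma Dp_eq: "0 \<le> t \<Longrightarrow> Dp_norm k p t = ereal (D t)"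
proof -
  assume t: "0 \<le> t"
  have "\<bar>Phi k p t (1/2)\<bar> \<noteq> \<infinity>" using Phi_fin t by simp
  then have "Dp_norm k p t \<noteq> \<infinity>" by (auto simp: Phi_def ln_div)
  then show ?thesis unfolding D_def using Dp_nonneg[of t] by (simp add: ereal_real)
qed

lemma D_nonneg: "0 \<le> D t" unfolding D_def using Dp_nonneg by (simp add: real_of_ereal_pos)

lemma grad_le_D: "x \<in> \<Omega> \<Longrightarrow> 0 \<le> t \<Longrightarrow> t \<le> norm x \<Longrightarrow> norm (grad p x) \<le> D t"
  using SUP_upper[of x "{y \<in> \<Omega>. t \<le> norm y}" "\<lambda>y. ereal (norm (grad p y))"] Dp_eq[of t]
  by (simp add: Dp_norm_def)

lemma D_antimono: "0 \<le> s \<Longrightarrow> s \<le> t \<Longrightarrow> D t \<le> D s"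
proof -
  assume st: "0 \<le> s" "s \<le> t"
  have "Dp_norm k p t \<le> Dp_norm k p s" unfolding Dp_norm_def by (rule SUP_subset_mono) (use st in auto)
  then show ?thesis using Dp_eq[of s] Dp_eq[of t] st by simp
qed

lemma Phi_eq: "0 \<le> t \<Longrightarrow> Phi k p t s = ereal (D t * eta s)"
  by (simp add: Phi_def Dp_eq eta_def)

lemma D_cont: "continuous_on {0..} D"
proof -
  have c: "continuous_on {0..} (\<lambda>t. (\<lambda>(t, s). Phi k p t s) (t, 1/2))"
    by (rule continuous_on_compose2[OF Phi_cont]) (auto intro!: continuous_intros)
  have e: "eta (1/2) \<noteq> 0" by (simp add: eta_def ln_div)
  have "continuous_on {0..} (\<lambda>t. ereal (D t * eta (1/2)))"
    by (rule continuous_on_eq[OF c]) (simp add: Phi_eq)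
  then have "continuous_on {0..} (\<lambda>t. D t * eta (1/2))"
    unfolding continuous_on_def by (simp add: lim_ereal del: times_ereal.simps)
  from continuous_on_mult_right[OF this, of "1 / eta (1/2)"]
  show ?thesis by (rule continuous_on_eq) (use e in simp)
qed

lemma p_lipschitz: "x \<in> \<Omega> \<Longrightarrow> y \<in> \<Omega> \<Longrightarrow> \<bar>p x - p y\<bar> \<le> D 0 * norm (x - y)"
  by (rule grad_bound_lipschitz[OF convex_half pdiff]) (auto intro: grad_le_D)

lemma lam_eq: "t > 0 \<Longrightarrow> p_lam k p t = ereal (lam t)" and lam_pos: "t > 0 \<Longrightarrow> 0 < lam t"
proof -
  assume "t > 0"
  then have "0 < p_lam k p t" "p_lam k p t < \<infinity>" using lam_fin by auto
  then show "p_lam k p t = ereal (lam t)" "0 < lam t" unfolding lam_def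
    by (cases "p_lam k p t"; simp)+
qed

lemma Lam_eq: "t > 0 \<Longrightarrow> p_Lam k p t = ereal (Lam t)" and Lam_pos: "t > 0 \<Longrightarrow> 0 < Lam t"
proof -
  assume "t > 0"
  then have "0 < p_Lam k p t" "p_Lam k p t < \<infinity>" using Lam_fin by auto
  then show "p_Lam k p t = ereal (Lam t)" "0 < Lam t" unfolding Lam_def
    by (cases "p_Lam k p t"; simp)+
qed

lemma lam_le: "x \<in> \<Omega> \<Longrightarrow> x $ k \<le> t \<Longrightarrow> lam t \<le> min 1 (p x - 1)"
  using INF_lower[of x "{y \<in> \<Omega>. y $ k \<le> t}" "\<lambda>y. ereal (min 1 (p y - 1))"] lam_eq[of t] half_pos[of x]
  by (simp add: p_lam_def)

lemma Lam_ge: "x \<in> \<Omega> \<Longrightarrow> x $ k \<le> t \<Longrightarrow> max 1 (p x - 1) \<le> Lam t"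
  using SUP_upper[of x "{y \<in> \<Omega>. y $ k \<le> t}" "\<lambda>y. ereal (max 1 (p y - 1))"] Lam_eq[of t] half_pos[of x]
  by (simp add: p_Lam_def)

lemma lam_greatest: "t > 0 \<Longrightarrow> (\<And>x. x \<in> \<Omega> \<Longrightarrow> x $ k \<le> t \<Longrightarrow> c \<le> min 1 (p x - 1)) \<Longrightarrow> c \<le> lam t"
proof -
  assume t: "t > 0" and c: "\<And>x. x \<in> \<Omega> \<Longrightarrow> x $ k \<le> t \<Longrightarrow> c \<le> min 1 (p x - 1)"
  have "ereal c \<le> p_lam k p t" unfolding p_lam_def by (rule INF_greatest) (use c in auto)
  then show ?thesis using lam_eq[OF t] by simp
qed

lemma lam_le1: "t > 0 \<Longrightarrow> lam t \<le> 1"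
  using lam_le[of "axis k t" t] axis_half[of t] by (simp add: axis_def)

lemma lam_antimono: "0 < s \<Longrightarrow> s \<le> t \<Longrightarrow> lam t \<le> lam s"
proof (rule lam_greatest)
  fix x assume "s \<le> t" "x \<in> \<Omega>" "x $ k \<le> s"
  then show "lam t \<le> min 1 (p x - 1)" by (intro lam_le) auto
qed simp

text \<open>A point of height at most t is pushed down to height at most s, a displacement of at
  most t - s, which changes p by at most \<open>D 0\<close> times that.\<close>

lemma lam_lipschitz: "0 < s \<Longrightarrow> s \<le> t \<Longrightarrow> lam s - D 0 * (t - s) \<le> lam t"
proof (rule lam_greatest)
  fix x assume st: "0 < s" "s \<le> t" and x: "x \<in> \<Omega>" "x $ k \<le> t"
  define y where "y = x - axis k (x $ k - min (x $ k) s)"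
  have yk: "y $ k = min (x $ k) s" by (simp add: y_def axis_def)
  have y: "y \<in> \<Omega>" using yk half_pos[OF x(1)] st by (simp add: half_space_def)
  have "norm (y - x) \<le> t - s" using x(2) st by (simp add: y_def norm_axis_real)
  then have "D 0 * norm (y - x) \<le> D 0 * (t - s)" by (intro mult_left_mono D_nonneg)
  then have "p y - p x \<le> D 0 * (t - s)" using p_lipschitz[OF y x(1)] by linarith
  moreover have "lam s \<le> min 1 (p y - 1)" using lam_le[OF y, of s] yk by simp
  moreover have "0 \<le> D 0 * (t - s)" using D_nonneg st by simp
  ultimately show "lam s - D 0 * (t - s) \<le> min 1 (p x - 1)" by simp
qed simp

lemma lam_cont: "continuous_on {0<..} lam"
proof -
  have "\<bar>lam s - lam t\<bar> \<le> D 0 * \<bar>s - t\<bar>" if "0 < s" "0 < t" for s t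
  proof -
    have "\<bar>lam s - lam t\<bar> \<le> D 0 * (t - s)" if "0 < s" "s \<le> t" for s t
      using lam_lipschitz[OF that] lam_antimono[OF that] by simp
    from this[of s t] this[of t s] that show ?thesis by (cases "s \<le> t") (auto simp: abs_minus_commute)
  qed
  then have "(D 0)-lipschitz_on {0<..} lam" by (intro lipschitz_onI D_nonneg) (auto simp: dist_real_def)
  then show ?thesis by (rule lipschitz_on_continuous_on)
qed

text \<open>Ellipticity is demanded at every point of space; the default value 0 off the half-space
  is trivially monotone.\<close>

definition Fop :: "real ^ 'n \<Rightarrow> real \<Rightarrow> real ^ 'n \<Rightarrow> real ^ 'n ^ 'n \<Rightarrow> real"
  where "Fop x r q X = (if x \<in> \<Omega> then - (D (norm x) * eta (norm q) + sup_op (p x) X) else 0)"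

lemma Fop_elliptic: "degenerate_elliptic Fop"
  using p1 sup_op_mono by (auto simp: degenerate_elliptic_def Fop_def)

lemma Fop_bound:
  assumes x: "x \<in> \<Omega>" and PN: "pos_neg_parts X P N"
  shows "ereal (- Fop x 0 q X) \<le> Phi k p (norm x) (norm q) + p_Lam k p (x $ k) * ereal (trace P)
      - p_lam k p (x $ k) * ereal (trace N)"
proof -
  have xk: "0 < x $ k" using x by (rule half_pos)
  have t: "0 \<le> trace P" "0 \<le> trace N"
    using psd_qf_le_trace[of P 0] psd_qf_le_trace[of N 0] PN by (auto simp: pos_neg_parts_def)
  have "sup_op (p x) X \<le> max 1 (p x - 1) * trace P - min 1 (p x - 1) * trace N"
    using sup_op_parts[OF PN] p1 x by blast
  also have "\<dots> \<le> Lam (x $ k) * trace P - lam (x $ k) * trace N"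
    using lam_le[OF x order_refl] Lam_ge[OF x order_refl] t by (intro diff_mono mult_right_mono)
  finally have "- Fop x 0 q X \<le> D (norm x) * eta (norm q) + (Lam (x $ k) * trace P - lam (x $ k) * trace N)"
    using x by (simp add: Fop_def)
  then show ?thesis using xk by (simp add: Phi_eq Lam_eq lam_eq)
qed

lemma Fop_viscosity:
  assumes sub: "px_subharmonic \<Omega> p u"
  shows "viscosity_subsolution Fop \<Omega> u"
  unfolding viscosity_subsolution_def
proof (intro conjI allI impI)
  show "usc_on \<Omega> u" using sub by (simp add: px_subharmonic_def)
  fix \<phi> x0
  assume a: "C_on 2 \<Omega> \<phi> \<and> x0 \<in> \<Omega> \<and> (\<forall>\<^sub>F x in at x0 within \<Omega>. u x - \<phi> x \<le> u x0 - \<phi> x0)"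
  show "Fop x0 (u x0) (grad \<phi> x0) (hess \<phi> x0) \<le> 0"
  proof (rule ccontr)
    assume n: "\<not> Fop x0 (u x0) (grad \<phi> x0) (hess \<phi> x0) \<le> 0"
    have x0: "x0 \<in> \<Omega>" using a by simp
    define F0 where "F0 = D (norm x0) * eta (norm (grad \<phi> x0))"
    define S where "S = - (F0 + sup_op (p x0) (hess \<phi> x0))"
    have S: "S > 0" using n x0 by (simp add: S_def F0_def Fop_def)
    show False
    proof (rule viscosity_core[OF open_half x0 pC _ sub _ _ S])
      show "norm (grad p x0) * eta (norm (grad \<phi> x0)) \<le> F0"
        unfolding F0_def by (intro mult_right_mono grad_le_D x0 eta_nonneg) auto
      show "trace (hess \<phi> x0) + (p x0 - 2) * (e \<bullet> (hess \<phi> x0 *v e)) \<le> - S - F0" if "norm e \<le> 1" for e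
        using sup_op_ge[OF that, of "hess \<phi> x0" "p x0"] by (simp add: S_def)
    qed (use a p1 in auto)
  qed
qed

lemma Phi_nonneg: "0 \<le> t \<Longrightarrow> 0 \<le> s \<Longrightarrow> 0 \<le> Phi k p t s"
  by (simp add: Phi_eq D_nonneg eta_nonneg)

text \<open>Near 0 the integrand is at least 1 / (D' s (- ln s)), with antiderivative - ln(- ln s) /
  D', which tends to minus infinity at 0.\<close>

lemma osgood:
  assumes \<epsilon>: "\<epsilon> > 0" and t: "t \<ge> 0"
  shows "(\<integral>\<^sup>+ s\<in>{0<..<\<epsilon>}. 1 / e2ennreal (Phi k p t s) \<partial>lborel) = \<infinity>"
proof -
  \<comment> \<open>\<open>D t\<close> may be 0, where the integrand is infinite by convention; a
    positive upper bound of \<open>D t\<close> gives one antiderivative for both cases.\<close>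
  define D' where "D' = D t + 1"
  have D': "D' > 0" "D t \<le> D'" using D_nonneg[of t] by (auto simp: D'_def)
  define b where "b = min (\<epsilon> / 2) (1/2)"
  have b: "0 < b" "b < \<epsilon>" "b < 1" using \<epsilon> by (auto simp: b_def)
  define f where "f s = 1 / (D' * (s * - ln s))" for s :: real
  have fm: "f \<in> borel_measurable borel" unfolding f_def by measurable
  let ?I = "\<integral>\<^sup>+ s\<in>{0<..<\<epsilon>}. 1 / e2ennreal (Phi k p t s) \<partial>lborel"
  have low: "ennreal ((ln (- ln a) - ln (- ln b)) / D') \<le> ?I" if a: "0 < a" "a \<le> b" for a
  proof -
    have "(\<integral>\<^sup>+ s. ennreal (f s) * indicator {a..b} s \<partial>lborel) = ennreal ((- ln (- ln b) / D') - (- ln (- ln a) / D'))"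
    proof (rule nn_integral_FTC_Icc[OF fm _ _ a(2)])
      fix s assume "s \<in> {a..b}"
      then have s: "a \<le> s" "s \<le> b" by auto
      then have s': "0 < s" "s < 1" "ln s < 0" using a b by auto
      show "((\<lambda>s. - ln (- ln s) / D') has_real_derivative f s) (at s)"
        using s' D' by (auto intro!: derivative_eq_intros simp: f_def field_simps)
      show "0 \<le> f s" using s' D' unfolding f_def by (intro divide_nonneg_pos mult_pos_pos) auto
    qed
    also have "(- ln (- ln b) / D') - (- ln (- ln a) / D') = (ln (- ln a) - ln (- ln b)) / D'"
      by (simp add: diff_divide_distrib)
    finally have eq: "ennreal ((ln (- ln a) - ln (- ln b)) / D') = (\<integral>\<^sup>+ s. ennreal (f s) * indicator {a..b} s \<partial>lborel)" by simp
    show ?thesis unfolding eq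
    proof (rule nn_integral_mono)
      fix s :: real
      show "ennreal (f s) * indicator {a..b} s \<le> 1 / e2ennreal (Phi k p t s) * indicator {0<..<\<epsilon>} s"
      proof (cases "s \<in> {a..b}")
        case True
        then have s: "0 < s" "s < 1" "s < \<epsilon>" "ln s < 0" using a b by auto
        have es: "eta s = s * - ln s" "eta s > 0" using s mult_pos_neg[of s "ln s"] by (auto simp: eta_def)
        have ph: "e2ennreal (Phi k p t s) = ennreal (D t * eta s)" by (simp only: Phi_eq[OF t] e2ennreal_ereal)
        have f_eq: "f s = 1 / (D' * eta s)" by (simp add: f_def es(1))
        have "ennreal (f s) \<le> 1 / ennreal (D t * eta s)"
        proof (cases "D t = 0")
          case True
          then show ?thesis by (simp add: divide_ennreal_def)
        next
          case False
          then have D0: "0 < D t" using D_nonneg[of t] by simp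
          then have Dp: "0 < D t * eta s" using es(2) by simp
          have "f s \<le> 1 / (D t * eta s)"
            unfolding f_eq using D' D0 es(2) by (intro divide_left_mono mult_right_mono mult_pos_pos) auto
          then show ?thesis using divide_ennreal[OF zero_le_one Dp] by (simp add: ennreal_leI)
        qed
        then show ?thesis using True s unfolding ph by simp
      qed simp
    qed
  qed
  show ?thesis
  proof (rule ccontr)
    assume "?I \<noteq> \<infinity>"
    then obtain m where m: "?I = ennreal m" "m \<ge> 0" by (cases ?I) auto
    define c where "c = ln (- ln b)"
    \<comment> \<open>Chosen so that a = exp(- exp n) satisfies ln(- ln a) = n and the lower bound
      (n - c) / D' exceeds the supposed value m; the absolute value of c only ensures a <=
      b.\<close>
    define n where "n = \<bar>c\<bar> + D' * (m + 1) + c"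
    define a where "a = exp (- exp n)"
    have lb: "- ln b > 0" using b by simp
    have "n \<ge> c" using D' m by (simp add: n_def)
    then have "exp n \<ge> - ln b" using lb by (simp add: c_def) (metis exp_le_cancel_iff exp_ln lb minus_le_iff)
    then have "a \<le> exp (ln b)" unfolding a_def by (subst exp_le_cancel_iff) linarith
    then have a: "0 < a" "a \<le> b" using b by (auto simp: a_def)
    have "ln (- ln a) = n" by (simp add: a_def)
    then have "ennreal ((n - c) / D') \<le> ennreal m" using low[OF a] m by (simp add: c_def)
    then have "(n - c) / D' \<le> m" using m by (simp add: ennreal_le_iff)
    moreover have "m + 1 \<le> (n - c) / D'" using D' by (simp add: n_def field_simps)
    ultimately show False by linarith
  qed
qed

end

section \<open>Radial barriers\<close>

lemma C_on_2I:
  fixes v :: "real^'n::finite \<Rightarrow> real"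
  assumes op: "open S" and G: "\<And>x. x \<in> S \<Longrightarrow> (v has_derivative (\<lambda>h. G x \<bullet> h)) (at x)"
    and H: "\<And>x i. x \<in> S \<Longrightarrow> ((\<lambda>x. G x $ i) has_derivative (\<lambda>h. H x $ i \<bullet> h)) (at x)"
    and c: "\<And>i j. continuous_on S (\<lambda>x. H x $ i $ j)"
  shows "C_on 2 S v" "x \<in> S \<Longrightarrow> grad v x = G x" "x \<in> S \<Longrightarrow> hess v x = H x"
proof -
  have g: "grad v x = G x" if "x \<in> S" for x by (rule grad_eq[OF G[OF that]])
  then show "x \<in> S \<Longrightarrow> grad v x = G x" .
  have p1: "partial i v y = G y $ i" if "y \<in> S" for i y using g[OF that] grad_nth[of v y i] by simp
  have d2: "(partial i v has_derivative (\<lambda>h. H x $ i \<bullet> h)) (at x)" if "x \<in> S" for x i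
    by (rule has_derivative_transform_within_open[OF H[OF that] op that]) (simp add: p1)
  have p2: "partial j (partial i v) x = H x $ i $ j" if "x \<in> S" for x i j
    by (simp add: partial_eq[OF d2[OF that]] inner_axis)
  then show "x \<in> S \<Longrightarrow> hess v x = H x" by (simp add: hess_def vec_eq_iff)
  have "continuous_on S (partial j (partial i v))" for i j
    by (rule continuous_on_eq[OF c[of i j]]) (simp add: p2)
  moreover have "v differentiable (at x)" if "x \<in> S" for x
    using G[OF that] by (rule differentiableI)
  moreover have "partial i v differentiable (at x)" if "x \<in> S" for x i
    using d2[OF that] by (rule differentiableI)
  ultimately show "C_on 2 S v" by (simp add: numeral_2_eq_2)
qed

lemma usc_attains_sup:
  fixes w :: "'a::topological_space \<Rightarrow> real"
  assumes C: "compact C" "C \<noteq> {}" "C \<subseteq> S" and o: "\<And>a. open {x \<in> S. w x < a}"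
  obtains x where "x \<in> C" "\<And>y. y \<in> C \<Longrightarrow> w y \<le> w x"
proof -
  have "\<exists>x\<in>C. \<forall>y\<in>C. w y \<le> w x"
  proof (rule ccontr)
    assume "\<not> ?thesis"
    then have n: "\<forall>x\<in>C. \<exists>y\<in>C. w x < w y" by (auto simp: not_le)
    then have "C \<subseteq> (\<Union>y\<in>C. {x \<in> S. w x < w y})" using C(3) by blast
    then obtain F where F: "F \<subseteq> C" "finite F" "C \<subseteq> (\<Union>y\<in>F. {x \<in> S. w x < w y})"
      using compactE_image[OF C(1), of C "\<lambda>y. {x \<in> S. w x < w y}"] o by blast
    have "F \<noteq> {}" using F C by blast
    then have "Max (w ` F) \<in> w ` F" using F by (intro Max_in) auto
    then obtain z where z: "z \<in> F" "w z = Max (w ` F)" by auto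
    then obtain y where "y \<in> F" "w z < w y" using F by blast
    moreover have "w y \<le> Max (w ` F)" if "y \<in> F" for y using F that by simp
    ultimately show False using z by fastforce
  qed
  then show ?thesis using that by blast
qed

lemma usc_diff_open:
  assumes op: "open S" and u: "usc_on S u" and v: "continuous_on S v"
  shows "open {x \<in> S. u x - v x < a}"
proof -
  have "{x \<in> S. u x - v x < a} = (\<Union>q. {x \<in> S. u x < q} \<inter> (S \<inter> v -` {q - a<..}))"
  proof (intro equalityI subsetI)
    fix x assume x: "x \<in> {x \<in> S. u x - v x < a}"
    then obtain q where "u x < q" "q < v x + a" using dense[of "u x" "v x + a"] by auto
    then show "x \<in> (\<Union>q. {x \<in> S. u x < q} \<inter> (S \<inter> v -` {q - a<..}))" using x by auto
  qed auto
  also have "open \<dots>"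
    by (intro open_UN open_Int ballI usc_open[OF op u] continuous_open_preimage[OF v op]) auto
  finally show ?thesis .
qed

lemma indef:
  fixes f :: "real \<Rightarrow> real"
  assumes f: "continuous_on {0..} f"
  shows indef_deriv: "0 < t \<Longrightarrow> ((\<lambda>x. integral {0..x} f) has_real_derivative f t) (at t)"
    and indef_cont: "continuous_on {0..} (\<lambda>x. integral {0..x} f)"
proof -
  show d: "((\<lambda>x. integral {0..x} f) has_real_derivative f t) (at t)" if t: "0 < t" for t
  proof -
    have "((\<lambda>x. integral {0..x} f) has_real_derivative f t) (at t within {0..t+1})"
      using t by (intro integral_has_real_derivative continuous_on_subset[OF f]) auto
    moreover have "at t within {0..t+1} = at t" using t by (intro at_within_interior) simp
    ultimately show ?thesis by simp
  qed
  have c1: "continuous_on {0..1} (\<lambda>x. integral {0..x} f)"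
    by (intro indefinite_integral_continuous_1 integrable_continuous_real continuous_on_subset[OF f]) auto
  show "continuous_on {0..} (\<lambda>x. integral {0..x} f)"
    unfolding continuous_on_def
  proof
    fix t :: real assume "t \<in> {0..}"
    then consider "t = 0" | "t > 0" by fastforce
    then show "((\<lambda>x. integral {0..x} f) \<longlongrightarrow> integral {0..t} f) (at t within {0..})"
    proof cases
      case 1
      have "((\<lambda>x. integral {0..x} f) \<longlongrightarrow> integral {0..0} f) (at 0 within {0..1})"
        using c1 unfolding continuous_on_def by (rule bspec) simp
      moreover have "at (0::real) within {0..1} = at 0 within {0..}"
        by (rule at_within_nhd[of _ "{-1<..<1}"]) auto
      ultimately show ?thesis using 1 by simp
    next
      case 2
      show ?thesis using DERIV_isCont[OF d[OF 2]] unfolding isCont_def by (rule tendsto_within_subset) simp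
    qed
  qed
qed

context px_setting
begin

text \<open>At 0 the infimum defining \<open>p_lam\<close> runs over the empty set and is infinite.
  \<open>lx\<close> replaces it by the right limit, which for the antimonotone \<open>lam\<close> is
  a supremum, so that \<open>bq\<close> is continuous on the closed half-line.\<close>

definition "lam0 = (SUP s\<in>{0<..}. lam s)"
definition "lx s = (if s \<le> 0 then lam0 else lam s)"
definition "bq s = D s / lx s"

abbreviation "I \<equiv> Dp_int k p"

lemma lam_bdd: "bdd_above (lam ` {0<..})" by (rule bdd_aboveI[of _ 1]) (auto intro: lam_le1)

lemma lam_le_lam0: "0 < s \<Longrightarrow> lam s \<le> lam0" unfolding lam0_def by (rule cSUP_upper[OF _ lam_bdd]) simp

lemma lam0_le: "0 < t \<Longrightarrow> lam0 \<le> lam t + D 0 * t"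
  unfolding lam0_def
proof (rule cSUP_least)
  fix s :: real assume t: "0 < t" and "s \<in> {0<..}"
  then have s: "0 < s" by simp
  show "lam s \<le> lam t + D 0 * t"
  proof (cases "s \<le> t")
    case True
    have "D 0 * (t - s) \<le> D 0 * t" using s D_nonneg by (intro mult_left_mono) auto
    then show ?thesis using lam_lipschitz[OF s True] by linarith
  next
    case False
    then have "lam s \<le> lam t" using lam_antimono[OF t, of s] by simp
    then show ?thesis using D_nonneg[of 0] t mult_nonneg_nonneg[of "D 0" t] by linarith
  qed
qed simp

lemma lx_pos: "0 < lx s"
  using lam_pos[of s] lam_pos[of 1] lam_le_lam0[of 1] by (auto simp: lx_def)

lemma lx_cont: "continuous_on {0..} lx"
proof -
  have *: "\<bar>lx s - lx t\<bar> \<le> D 0 * (t - s)" if "0 \<le> s" "s \<le> t" for s t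
  proof (cases "s = 0")
    case True
    then show ?thesis using lam0_le[of t] lam_le_lam0[of t] that by (cases "t = 0") (auto simp: lx_def)
  next
    case False
    then show ?thesis using lam_lipschitz[of s t] lam_antimono[of s t] that by (auto simp: lx_def)
  qed
  have "\<bar>lx s - lx t\<bar> \<le> D 0 * \<bar>s - t\<bar>" if "0 \<le> s" "0 \<le> t" for s t
    using *[of s t] *[of t s] that by (cases "s \<le> t") (auto simp: abs_minus_commute)
  then have "(D 0)-lipschitz_on {0..} lx" by (intro lipschitz_onI D_nonneg) (auto simp: dist_real_def)
  then show ?thesis by (rule lipschitz_on_continuous_on)
qed

lemma bq_cont: "continuous_on {0..} bq"
  unfolding bq_def[abs_def] using lx_pos by (intro continuous_intros D_cont lx_cont) (auto simp: less_imp_neq[symmetric])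

lemma bq_eq: "0 < s \<Longrightarrow> bq s = D s / lam s" by (simp add: bq_def lx_def)

text \<open>The two integrands may differ at 0 only, a null set.\<close>

lemma I_eq: "I t = integral {0..t} bq"
  unfolding Dp_int_def
proof (rule integral_spike[of "{0}"])
  fix s assume "s \<in> {0..t} - {0}"
  then have "0 < s" by simp
  then show "bq s = real_of_ereal (Dp_norm k p s / p_lam k p s)"
    using lam_pos[of s] by (simp add: bq_eq Dp_eq lam_eq)
qed simp

lemma I_deriv: "0 < t \<Longrightarrow> (I has_real_derivative D t / lam t) (at t)"
  using indef_deriv[OF bq_cont, of t] by (simp add: I_eq[abs_def] bq_eq)

lemma I_0: "I 0 = 0" by (simp add: I_eq)

lemma I_cont: "continuous_on {0..} I"
  using indef_cont[OF bq_cont] by (simp add: I_eq[abs_def])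

lemma deriv_pos_mono:
  fixes f :: "real \<Rightarrow> real"
  assumes ab: "0 \<le> a" "a \<le> b" and c: "continuous_on {0..} f"
    and d: "\<And>t. 0 < t \<Longrightarrow> (f has_real_derivative f' t) (at t)" and n: "\<And>t. a < t \<Longrightarrow> t < b \<Longrightarrow> l \<le> f' t"
  shows "l * (b - a) \<le> f b - f a"
proof (cases "a = b")
  case False
  have ab': "a < b" using False ab by simp
  have "continuous_on {a..b} f" by (rule continuous_on_subset[OF c]) (use ab in auto)
  moreover have "f differentiable (at x)" if "a < x" "x < b" for x
    using d[of x] that ab real_differentiable_def by auto
  ultimately obtain l' z where z: "a < z" "z < b" "(f has_real_derivative l') (at z)" "f b - f a = (b - a) * l'"
    using MVT[OF ab'] by blast
  have "l' = f' z" using DERIV_unique[OF z(3) d[of z]] z ab by simp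
  with z have z: "a < z" "z < b" "f b - f a = (b - a) * f' z" by auto
  have "l * (b - a) \<le> f' z * (b - a)" using n[OF z(1,2)] ab by (intro mult_right_mono) auto
  then show ?thesis using z(3) by (simp add: mult.commute)
qed simp

lemma I_mono: "0 \<le> s \<Longrightarrow> s \<le> t \<Longrightarrow> I s \<le> I t"
  using deriv_pos_mono[OF _ _ I_cont I_deriv, of s t 0] D_nonneg lam_pos by (force intro: divide_nonneg_pos)

lemma I_nonneg: "0 \<le> t \<Longrightarrow> 0 \<le> I t" using I_mono[of 0 t] I_0 by simp

lemma I_pos:
  assumes "0 < t" and Dp: "\<And>s. 0 < s \<Longrightarrow> 0 < D s"
  shows "0 < I t"
proof -
  have "D t * (t - 0) \<le> I t - I 0"
  proof (rule deriv_pos_mono[OF _ _ I_cont I_deriv])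
    fix s assume s: "0 < s" "s < t"
    have "D t \<le> D s" using D_antimono s by simp
    also have "\<dots> = D s / 1" by simp
    also have "\<dots> \<le> D s / lam s" using s lam_le1[of s] lam_pos[of s] D_nonneg by (intro divide_left_mono) auto
    finally show "D t \<le> D s / lam s" .
  qed (use assms in auto)
  moreover have "0 < D t * t" using assms by simp
  ultimately show ?thesis using I_0 by simp
qed

lemma f_nu_eq: "0 < \<nu> \<Longrightarrow> \<nu> \<le> 1 \<Longrightarrow> f_nu k p \<nu> t = exp (ln \<nu> * exp (I t))"
  by (simp add: f_nu_def powr_def mult.commute)

lemma f_nu_cont: "0 < \<nu> \<Longrightarrow> continuous_on {0..} (f_nu k p \<nu>)"
  unfolding f_nu_def[abs_def] by (cases "\<nu> \<le> 1") (auto intro!: continuous_intros I_cont)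

end

text \<open>For \<nu> <= 1 the logarithm of \<open>E\<close> stays nonpositive, so that |ln E| = -
  W. \<open>Dpos\<close> will come from the hypothesis on \<gamma>, whose left-hand side is infinite
  where \<open>Dp_norm\<close> vanishes.\<close>

locale barrier = px_setting k p for k :: "'n::finite" and p +
  fixes \<nu> \<delta> :: real
  assumes nu: "0 < \<nu>" "\<nu> \<le> 1" and del: "0 < \<delta>" and Dpos: "\<And>s. 0 < s \<Longrightarrow> 0 < D s"
begin

text \<open>The solution of W' = (D / lam) (W - \<delta>) with W(0) = ln \<nu>. For \<delta> = 0 it
  is the logarithm of \<open>f_nu\<close>.\<close>

definition "W s = \<delta> + exp (I s) * (ln \<nu> - \<delta>)"
definition "E s = exp (W s)"
definition "Vb s = integral {0..s} E"

lemma W_le: "0 \<le> s \<Longrightarrow> W s \<le> 0"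
proof -
  assume s: "0 \<le> s"
  have l: "ln \<nu> \<le> 0" using nu by simp
  then have "exp (I s) * (ln \<nu> - \<delta>) \<le> 1 * (ln \<nu> - \<delta>)"
    using I_nonneg[OF s] del by (intro mult_right_mono_neg) auto
  then show ?thesis using l by (simp add: W_def)
qed

lemma W_deriv: "0 < s \<Longrightarrow> (W has_real_derivative D s / lam s * (W s - \<delta>)) (at s)"
  unfolding W_def[abs_def] by (auto intro!: derivative_eq_intros I_deriv)

lemma W_cont: "continuous_on {0..} W" unfolding W_def[abs_def] by (intro continuous_intros I_cont)

lemma W_antimono: "0 \<le> s \<Longrightarrow> s \<le> t \<Longrightarrow> W t \<le> W s"
proof -
  assume st: "0 \<le> s" "s \<le> t"
  have "ln \<nu> \<le> 0" using nu by simp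
  then have "exp (I t) * (ln \<nu> - \<delta>) \<le> exp (I s) * (ln \<nu> - \<delta>)" using I_mono[OF st] del by (intro mult_right_mono_neg) auto
  then show ?thesis by (simp add: W_def)
qed

lemma E_pos: "0 < E s" by (simp add: E_def)
lemma E_antimono: "0 \<le> s \<Longrightarrow> s \<le> t \<Longrightarrow> E t \<le> E s" using W_antimono by (simp add: E_def)
lemma E_deriv: "0 < s \<Longrightarrow> (E has_real_derivative E s * (D s / lam s * (W s - \<delta>))) (at s)"
  unfolding E_def[abs_def] by (auto intro!: derivative_eq_intros W_deriv)
lemma E_cont: "continuous_on {0..} E" unfolding E_def[abs_def] by (intro continuous_intros W_cont)

text \<open>The strict inequality rests on \<open>I s > 0\<close> and \<delta> > 0. It is what turns
  u >= \<open>u_check\<close> at one point into a contradiction later.\<close>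

lemma E_less: "0 < s \<Longrightarrow> E s < f_nu k p \<nu> s"
proof -
  assume s: "0 < s"
  have "1 < exp (I s)" using I_pos[OF s Dpos] by simp
  then have "\<delta> < exp (I s) * \<delta>" using del by simp
  then show ?thesis unfolding f_nu_eq[OF nu] E_def by (simp add: W_def algebra_simps)
qed

lemmas Vb_deriv = indef_deriv[OF E_cont, folded Vb_def] and Vb_cont = indef_cont[OF E_cont, folded Vb_def]

lemma Vb_0: "Vb 0 = 0" by (simp add: Vb_def)

lemma Vb_incr: "0 \<le> s \<Longrightarrow> s \<le> t \<Longrightarrow> E t * (t - s) \<le> Vb t - Vb s"
  by (rule deriv_pos_mono[OF _ _ Vb_cont Vb_deriv]) (auto intro: E_antimono)

lemma Vb_mono: "0 \<le> s \<Longrightarrow> s \<le> t \<Longrightarrow> Vb s \<le> Vb t"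
proof -
  assume st: "0 \<le> s" "s \<le> t"
  have "0 \<le> E t * (t - s)" using st by (intro mult_nonneg_nonneg less_imp_le[OF E_pos]) simp
  then show ?thesis using Vb_incr[OF st] by linarith
qed

lemma Vb_nonneg: "0 \<le> s \<Longrightarrow> 0 \<le> Vb s" using Vb_mono[of 0 s] Vb_0 by simp

lemma Vb_less: "0 < t \<Longrightarrow> Vb t < integral {0..t} (f_nu k p \<nu>)"
proof -
  assume t: "0 < t"
  let ?g = "\<lambda>x. integral {0..x} (f_nu k p \<nu>) - Vb x"
  have fc: "continuous_on {0..} (f_nu k p \<nu>)" by (rule f_nu_cont[OF nu(1)])
  have gc: "continuous_on {0..t} ?g"
    by (rule continuous_on_subset[of "{0..}"]) (auto intro!: continuous_intros indef_cont[OF fc] Vb_cont)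
  have gd: "(?g has_real_derivative (f_nu k p \<nu> x - E x)) (at x)" if "0 < x" for x
    by (intro DERIV_diff indef_deriv[OF fc] Vb_deriv that)
  have "?g 0 < ?g t"
  proof (rule DERIV_pos_imp_increasing_open[OF t _ gc])
    fix x assume x: "0 < x" "x < t"
    show "\<exists>y. (?g has_real_derivative y) (at x) \<and> 0 < y"
      using gd[OF x(1)] E_less[OF x(1)] by (intro exI[of _ "f_nu k p \<nu> x - E x"]) simp
  qed
  then show ?thesis by (simp add: Vb_0)
qed

end

text \<open>\<open>g\<close> stands for \<gamma>(R). \<open>gam\<close> is the strictness budget:
  relative to \<open>E\<close>, the spheres of radius above \<open>g\<close> contribute at most the
  left side, and the slack from \<delta> is at least the right side.\<close>

locale barrier_domain = barrier k p \<nu> \<delta> for k :: "'n::finite" and p \<nu> \<delta> +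
  fixes g R :: real
  assumes g: "0 < g" and R: "0 < R"
    and gam: "real CARD('n) * Lam R / g < D R * \<delta>"
begin

definition "z x = x + axis k g"
definition "rho x = norm (z x) - g"
definition "v x = Vb (rho x)"

lemma z_k: "z x $ k = x $ k + g" by (simp add: z_def axis_def)

text \<open>Together with \<open>rho_le\<close>: as \<open>lam\<close> and \<open>D\<close> are
  antimonotone, both may be replaced by their values at \<open>rho x\<close>, which reduces the
  supersolution property to a differential inequality in one variable.\<close>

lemma rho_ge: "x $ k \<le> rho x"
  using nth_le_norm[of "z x"] z_k[of x] by (simp add: rho_def)

lemma rho_le: "rho x \<le> norm x"
  using norm_triangle_ineq[of x "axis k g"] g by (simp add: rho_def z_def norm_axis_real)

lemma z_pos: "x \<in> \<Omega> \<Longrightarrow> g < norm (z x)"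
  using rho_ge[of x] half_pos[of x] by (simp add: rho_def)

lemma rho_pos: "x \<in> \<Omega> \<Longrightarrow> 0 < rho x" using z_pos by (simp add: rho_def)

definition "E' s = E s * (D s / lam s * (W s - \<delta>))"
definition "G x = (E (rho x) / norm (z x)) *\<^sub>R z x"
text \<open>The Hessian of a radial function: eigenvalue \<open>E'\<close> in the direction of
  \<open>z x\<close> and \<open>E\<close> divided by the radius on the orthogonal
  complement.\<close>

definition "H x = (\<chi> i j. E' (rho x) * z x $ i * z x $ j / (norm (z x))\<^sup>2
   + E (rho x) * ((if i = j then 1 else 0) / norm (z x) - z x $ i * z x $ j / (norm (z x))^3))"

lemma z_deriv: "(z has_derivative (\<lambda>h. h)) (at x)"
  unfolding z_def[abs_def] by (auto intro!: derivative_eq_intros)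

lemma nz_deriv:
  assumes x: "x \<in> \<Omega>"
  shows "((\<lambda>x. norm (z x)) has_derivative (\<lambda>h. z x \<bullet> h / norm (z x))) (at x)"
proof -
  have "z x \<noteq> 0" using z_pos[OF x] g by auto
  from has_derivative_compose[OF z_deriv has_derivative_norm[OF this]]
  show ?thesis by (simp add: sgn_div_norm inner_commute divide_inverse mult.commute)
qed

lemma rho_deriv:
  assumes x: "x \<in> \<Omega>"
  shows "(rho has_derivative (\<lambda>h. z x \<bullet> h / norm (z x))) (at x)"
  unfolding rho_def[abs_def] using has_derivative_diff[OF nz_deriv[OF x] has_derivative_const] by simp

lemma v_deriv:
  assumes x: "x \<in> \<Omega>"
  shows "(v has_derivative (\<lambda>h. G x \<bullet> h)) (at x)"
proof -
  have "(v has_derivative (\<lambda>h. E (rho x) * (z x \<bullet> h / norm (z x)))) (at x)"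
    unfolding v_def[abs_def]
    by (rule has_derivative_compose[OF rho_deriv[OF x] Vb_deriv[OF rho_pos[OF x], unfolded has_field_derivative_def]])
  then show ?thesis by (simp add: G_def)
qed

lemma G_deriv:
  assumes x: "x \<in> \<Omega>"
  shows "((\<lambda>x. G x $ i) has_derivative (\<lambda>h. H x $ i \<bullet> h)) (at x)"
proof -
  have nz: "norm (z x) \<noteq> 0" using z_pos[OF x] g by auto
  have E1: "((\<lambda>x. E (rho x)) has_derivative (\<lambda>h. E' (rho x) * (z x \<bullet> h / norm (z x)))) (at x)"
    unfolding E'_def
    by (rule has_derivative_compose[OF rho_deriv[OF x] E_deriv[OF rho_pos[OF x], unfolded has_field_derivative_def]])
  have z1: "((\<lambda>x. z x $ i) has_derivative (\<lambda>h. h $ i)) (at x)"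
    by (rule bounded_linear.has_derivative[OF bounded_linear_vec_nth z_deriv])
  have "((\<lambda>x. E (rho x) * z x $ i / norm (z x)) has_derivative
     (\<lambda>h. ((E (rho x) * h $ i + E' (rho x) * (z x \<bullet> h / norm (z x)) * z x $ i) * norm (z x)
         - (E (rho x) * z x $ i) * (z x \<bullet> h / norm (z x))) / (norm (z x) * norm (z x)))) (at x)"
    by (rule has_derivative_divide'[OF has_derivative_mult[OF E1 z1] nz_deriv[OF x] nz])
  moreover have "(\<lambda>h. ((E (rho x) * h $ i + E' (rho x) * (z x \<bullet> h / norm (z x)) * z x $ i) * norm (z x)
         - (E (rho x) * z x $ i) * (z x \<bullet> h / norm (z x))) / (norm (z x) * norm (z x))) = (\<lambda>h. H x $ i \<bullet> h)"
  proof
    fix h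
    let ?n = "norm (z x)"
    have "H x $ i \<bullet> h = (\<Sum>j\<in>UNIV. E' (rho x) * z x $ i / ?n\<^sup>2 * (z x $ j * h $ j)
        + (E (rho x) / ?n * (if i = j then h $ j else 0) - E (rho x) * z x $ i / ?n^3 * (z x $ j * h $ j)))"
      unfolding inner_vec_def H_def by (intro sum.cong refl) (simp add: algebra_simps)
    also have "\<dots> = E' (rho x) * z x $ i / ?n\<^sup>2 * (z x \<bullet> h) + (E (rho x) / ?n * h $ i - E (rho x) * z x $ i / ?n^3 * (z x \<bullet> h))"
      unfolding sum.distrib sum_subtractf sum_distrib_left[symmetric] by (simp add: inner_vec_def)
    also have "\<dots> = ((E (rho x) * h $ i + E' (rho x) * (z x \<bullet> h / ?n) * z x $ i) * ?n
         - (E (rho x) * z x $ i) * (z x \<bullet> h / ?n)) / (?n * ?n)"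
      using nz by (simp add: field_simps power2_eq_square power3_eq_cube)
    finally show "((E (rho x) * h $ i + E' (rho x) * (z x \<bullet> h / ?n) * z x $ i) * ?n
         - (E (rho x) * z x $ i) * (z x \<bullet> h / ?n)) / (?n * ?n) = H x $ i \<bullet> h" by simp
  qed
  ultimately show ?thesis by (simp add: G_def)
qed

lemma rho_cont: "continuous_on S rho" unfolding rho_def[abs_def] z_def by (intro continuous_intros)
lemma z_cont: "continuous_on S z" unfolding z_def[abs_def] by (intro continuous_intros)

lemma H_cont: "continuous_on \<Omega> (\<lambda>x. H x $ i $ j)"
proof -
  have nz: "norm (z x) \<noteq> 0" if "x \<in> \<Omega>" for x using z_pos[OF that] g by auto
  have r: "rho ` \<Omega> \<subseteq> {0<..}" using rho_pos by auto
  have lc: "continuous_on {0<..} (\<lambda>s. D s / lam s)"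
    using lam_pos by (intro continuous_intros lam_cont continuous_on_subset[OF D_cont]) (auto simp: less_imp_neq[symmetric])
  have E'c: "continuous_on {0<..} E'" unfolding E'_def[abs_def]
    by (intro continuous_intros lc continuous_on_subset[OF E_cont] continuous_on_subset[OF W_cont]) auto
  have e1: "continuous_on \<Omega> (\<lambda>x. E' (rho x))" by (rule continuous_on_compose2[OF E'c rho_cont r])
  have e2: "continuous_on \<Omega> (\<lambda>x. E (rho x))" by (rule continuous_on_compose2[OF E_cont rho_cont]) (use r in force)
  show ?thesis unfolding H_def vec_lambda_beta
    by (intro continuous_intros e1 e2 z_cont) (use nz in auto)
qed

lemma v_C2: "C_on 2 \<Omega> v"
  by (rule C_on_2I(1)[OF open_half v_deriv G_deriv H_cont])

lemma v_grad: "x \<in> \<Omega> \<Longrightarrow> grad v x = G x"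
  by (rule C_on_2I(2)[OF open_half v_deriv G_deriv H_cont])

lemma v_hess: "x \<in> \<Omega> \<Longrightarrow> hess v x = H x"
  by (rule C_on_2I(3)[OF open_half v_deriv G_deriv H_cont])

text \<open>Since W <= 0, the first order term is at most - D E W, while the radial part contributes
  at most \<open>lam\<close> E' = E D (W - \<delta>). The sum is - E D \<delta>, which outweighs the
  tangential part by \<open>gam\<close>.\<close>

lemma supersolution:
  assumes x: "x \<in> \<Omega>" and r: "rho x < R"
  shows "Fop x t (grad v x) (hess v x) > 0"
proof -
  let ?n = "norm (z x)" and ?r = "rho x"
  have n: "0 < ?n" "g < ?n" using z_pos[OF x] g by auto
  have r0: "0 < ?r" by (rule rho_pos[OF x])
  have E0: "0 < E ?r" by (rule E_pos)
  have W0: "W ?r \<le> 0" using W_le r0 by simp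
  have px: "1 < p x" using p1 x by blast
  have lm: "lam ?r \<le> min 1 (p x - 1)" by (rule lam_le[OF x rho_ge])
  have l0: "0 < lam ?r" by (rule lam_pos[OF r0])
  have LM: "max 1 (p x - 1) \<le> Lam R" using rho_ge[of x] r by (intro Lam_ge[OF x]) simp
  have E'0: "E' ?r \<le> 0" unfolding E'_def using E0 l0 D_nonneg W0 del
    by (intro mult_nonneg_nonpos divide_nonneg_pos) (auto intro: less_imp_le)
  have G1: "norm (grad v x) = E ?r" using n E0 by (simp add: v_grad[OF x] G_def)
  have zz: "(\<Sum>i\<in>UNIV. z x $ i * z x $ i) = ?n\<^sup>2" unfolding power2_norm_eq_inner by (simp add: inner_vec_def)
  have tr: "trace (hess v x) = E' ?r + E ?r * (real CARD('n) - 1) / ?n"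
  proof -
    have "trace (hess v x) = (\<Sum>i\<in>UNIV. (E' ?r / ?n\<^sup>2) * (z x $ i * z x $ i) + (E ?r / ?n - (E ?r / ?n^3) * (z x $ i * z x $ i)))"
      unfolding trace_def v_hess[OF x] H_def by (intro sum.cong refl) (simp add: algebra_simps)
    also have "\<dots> = E' ?r / ?n\<^sup>2 * ?n\<^sup>2 + (real CARD('n) * (E ?r / ?n) - E ?r / ?n^3 * ?n\<^sup>2)"
      by (simp only: sum.distrib sum_subtractf sum_distrib_left[symmetric] zz sum_constant)
    also have "\<dots> = E' ?r + E ?r * (real CARD('n) - 1) / ?n"
      using n by (simp add: field_simps power2_eq_square power3_eq_cube)
    finally show ?thesis .
  qed
  have main: "trace (hess v x) + (p x - 2) * (e \<bullet> (hess v x *v e)) \<le> E' ?r * lam ?r + E ?r * (real CARD('n) * Lam R / g)"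
    if e: "norm e \<le> 1" for e
  proof -
    \<comment> \<open>The squared radial component of \<open>e\<close>, which lies between 0 and
      |e|^2; the rest of |e|^2 is tangential.\<close>
    define a where "a = (z x \<bullet> e)\<^sup>2 / ?n\<^sup>2"
    have qf: "e \<bullet> (hess v x *v e) = E' ?r * a + E ?r * ((norm e)\<^sup>2 - a) / ?n"
    proof -
      have "e \<bullet> (hess v x *v e) = (\<Sum>i\<in>UNIV. \<Sum>j\<in>UNIV. (E' ?r / ?n\<^sup>2) * ((z x $ i * e $ i) * (z x $ j * e $ j))
          + ((if i = j then (E ?r / ?n) * (e $ i * e $ j) else 0) - (E ?r / ?n^3) * ((z x $ i * e $ i) * (z x $ j * e $ j))))"
        unfolding qf_sum v_hess[OF x] H_def by (intro sum.cong refl) (simp add: algebra_simps)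
      also have "\<dots> = (E' ?r / ?n\<^sup>2) * ((z x \<bullet> e) * (z x \<bullet> e)) + ((E ?r / ?n) * (e \<bullet> e) - (E ?r / ?n^3) * ((z x \<bullet> e) * (z x \<bullet> e)))"
      proof -
        have d: "(\<Sum>i\<in>UNIV. \<Sum>j\<in>UNIV. if i = j then (E ?r / ?n) * (e $ i * e $ j) else 0) = (E ?r / ?n) * (e \<bullet> e)"
          by (simp add: inner_vec_def sum_distrib_left)
        have q: "(\<Sum>i\<in>UNIV. \<Sum>j\<in>UNIV. c * ((z x $ i * e $ i) * (z x $ j * e $ j))) = c * ((z x \<bullet> e) * (z x \<bullet> e))" for c
          unfolding inner_vec_def sum_distrib_left[symmetric] sum_distrib_right[symmetric] by simp
        show ?thesis unfolding sum.distrib sum_subtractf d q by simp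
      qed
      also have "\<dots> = E' ?r * a + E ?r * ((norm e)\<^sup>2 - a) / ?n"
        using n by (simp add: a_def power2_norm_eq_inner[symmetric] field_simps power2_eq_square power3_eq_cube)
      finally show ?thesis .
    qed
    have e2: "(norm e)\<^sup>2 \<le> 1" using e by (simp add: abs_square_le_1)
    have "(z x \<bullet> e)\<^sup>2 \<le> ?n\<^sup>2 * (norm e)\<^sup>2"
      using Cauchy_Schwarz_ineq[of "z x" e] by (simp add: power2_norm_eq_inner)
    then have a: "0 \<le> a" "a \<le> (norm e)\<^sup>2" using n by (auto simp: a_def divide_le_eq mult.commute)
    \<comment> \<open>\<open>E'\<close> is nonpositive, so its coefficient needs a lower bound; it
      lies between 1 and p - 1.\<close>
    have A1: "E' ?r * (1 + (p x - 2) * a) \<le> E' ?r * lam ?r"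
    proof (rule mult_left_mono_neg[OF _ E'0])
      show "lam ?r \<le> 1 + (p x - 2) * a"
      proof (cases "p x \<ge> 2")
        case True
        then have "0 \<le> (p x - 2) * a" using a by (intro mult_nonneg_nonneg) auto
        moreover have "lam ?r \<le> 1" using lm by simp
        ultimately show ?thesis by linarith
      next
        case False
        then have "(p x - 2) * 1 \<le> (p x - 2) * a" using a e2 by (intro mult_left_mono_neg) auto
        moreover have "lam ?r \<le> 1 + (p x - 2) * 1" using lm by simp
        ultimately show ?thesis by (meson add_left_mono order_trans)
      qed
    qed
    let ?b = "(norm e)\<^sup>2 - a"
    have b: "0 \<le> ?b" "?b \<le> 1" using a e2 by auto
    \<comment> \<open>The n - 1 tangential directions and the tangential share of \<open>e\<close>
      cost at most \<open>Lam R\<close> each.\<close>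
    have B1: "(real CARD('n) - 1) + (p x - 2) * ?b \<le> real CARD('n) * Lam R"
    proof -
      have n1: "1 \<le> real CARD('n)" by simp
      have L1: "1 \<le> Lam R" "p x - 1 \<le> Lam R" using LM by auto
      have "(p x - 2) * ?b \<le> Lam R"
      proof (cases "p x \<ge> 2")
        case True
        then have "(p x - 2) * ?b \<le> (p x - 2) * 1" using b by (intro mult_left_mono) auto
        then show ?thesis using L1 by simp
      next
        case False
        then have "(p x - 2) * ?b \<le> 0" using b by (intro mult_nonpos_nonneg) auto
        then show ?thesis using L1 by simp
      qed
      moreover have "(real CARD('n) - 1) * 1 \<le> (real CARD('n) - 1) * Lam R" using n1 L1 by (intro mult_left_mono) auto
      ultimately show ?thesis by (simp add: algebra_simps)
    qed
    have "E ?r / ?n * ((real CARD('n) - 1) + (p x - 2) * ?b) \<le> E ?r / ?n * (real CARD('n) * Lam R)"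
      using B1 E0 n by (intro mult_left_mono) auto
    also have "\<dots> \<le> E ?r / g * (real CARD('n) * Lam R)"
      using n g E0 Lam_pos[OF R] by (intro mult_right_mono divide_left_mono) auto
    finally have "E ?r / ?n * ((real CARD('n) - 1) + (p x - 2) * ?b) \<le> E ?r * (real CARD('n) * Lam R / g)" by simp
    moreover have "trace (hess v x) + (p x - 2) * (e \<bullet> (hess v x *v e))
      = E' ?r * (1 + (p x - 2) * a) + E ?r / ?n * ((real CARD('n) - 1) + (p x - 2) * ?b)"
      unfolding tr qf by (simp add: algebra_simps add_divide_distrib diff_divide_distrib)
    ultimately show ?thesis using A1 by linarith
  qed
  have "sup_op (p x) (hess v x) \<le> E' ?r * lam ?r + E ?r * (real CARD('n) * Lam R / g)" by (rule sup_op_le[OF main])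
  also have "E' ?r * lam ?r = E ?r * (D ?r * (W ?r - \<delta>))" using l0 by (simp add: E'_def)
  finally have S: "sup_op (p x) (hess v x) \<le> E ?r * (D ?r * (W ?r - \<delta>) + real CARD('n) * Lam R / g)" by (simp add: algebra_simps)
  have et: "eta (E ?r) = E ?r * - W ?r" using W0 by (simp add: eta_def E_def)
  have "D (norm x) * eta (E ?r) \<le> D ?r * eta (E ?r)"
    using D_antimono[of ?r "norm x"] rho_le[of x] r0 E0 by (intro mult_right_mono eta_nonneg) auto
  then have P: "D (norm x) * eta (E ?r) \<le> E ?r * (D ?r * - W ?r)" by (simp add: et mult.left_commute)
  have "D (norm x) * eta (E ?r) + sup_op (p x) (hess v x) \<le> E ?r * (real CARD('n) * Lam R / g - D ?r * \<delta>)"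
    using P S by (simp add: algebra_simps)
  also have "\<dots> < 0"
  proof (rule mult_pos_neg[OF E0])
    have "D R * \<delta> \<le> D ?r * \<delta>" using D_antimono[of ?r R] r r0 del by (intro mult_right_mono) auto
    then show "real CARD('n) * Lam R / g - D ?r * \<delta> < 0" using gam by linarith
  qed
  finally show ?thesis using x G1 by (simp add: Fop_def)
qed

end

section \<open>Comparison and growth\<close>

lemma axis_plus: "axis k a + axis k b = axis k (a + b :: real)"
  by (simp add: vec_eq_iff axis_def)

context px_setting
begin

lemma Dom_eq:
  assumes "0 < \<gamma> R" "0 < R"
  shows "Dom k \<gamma> R = {x \<in> \<Omega>. norm (x + axis k (\<gamma> R)) < R + \<gamma> R}"
proof -
  have e: "(\<Sum>i\<in>UNIV - {k}. (x $ i)\<^sup>2) + (x $ k + \<gamma> R)\<^sup>2 = (norm (x + axis k (\<gamma> R)))\<^sup>2" for x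
  proof -
    have "(norm (x + axis k (\<gamma> R)))\<^sup>2 = (\<Sum>i\<in>UNIV. ((x + axis k (\<gamma> R)) $ i)\<^sup>2)"
      unfolding power2_norm_eq_inner by (simp add: inner_vec_def power2_eq_square)
    also have "\<dots> = ((x + axis k (\<gamma> R)) $ k)\<^sup>2 + (\<Sum>i\<in>UNIV - {k}. ((x + axis k (\<gamma> R)) $ i)\<^sup>2)"
      by (rule sum.remove) auto
    also have "(\<Sum>i\<in>UNIV - {k}. ((x + axis k (\<gamma> R)) $ i)\<^sup>2) = (\<Sum>i\<in>UNIV - {k}. (x $ i)\<^sup>2)"
      by (intro sum.cong refl) (auto simp: axis_def)
    finally show ?thesis by (simp add: axis_def)
  qed
  have "a\<^sup>2 < b\<^sup>2 \<longleftrightarrow> a < b" if "0 \<le> a" "0 \<le> b" for a b :: real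
    using that by (metis power2_less_imp_less power_strict_mono zero_less_numeral)
  then show ?thesis unfolding Dom_def e using assms by auto
qed

lemma frontier_half: "frontier \<Omega> = {x. x $ k = 0}"
proof -
  have "\<Omega> = {x. axis k 1 \<bullet> x > 0}" by (auto simp: half_space_def inner_axis')
  moreover have "axis k (1::real) \<noteq> 0" by (simp add: axis_eq_0_iff)
  ultimately show ?thesis using frontier_halfspace_gt[of "axis k (1::real)" 0] by (simp add: inner_axis')
qed

lemma closure_Dom:
  assumes "0 < \<gamma> R" "0 < R" and y: "y \<in> closure (Dom k \<gamma> R)"
  shows "norm (y + axis k (\<gamma> R)) \<le> R + \<gamma> R" "0 \<le> y $ k"
proof -
  let ?C = "{y. norm (y + axis k (\<gamma> R)) \<le> R + \<gamma> R} \<inter> {y. 0 \<le> y $ k}"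
  have "closed ?C" by (intro closed_Int closed_Collect_le continuous_intros)
  moreover have "Dom k \<gamma> R \<subseteq> ?C" unfolding Dom_eq[of \<gamma> R, OF assms(1,2)] by (auto simp: half_space_def)
  ultimately have "closure (Dom k \<gamma> R) \<subseteq> ?C" by (intro closure_minimal)
  then show "norm (y + axis k (\<gamma> R)) \<le> R + \<gamma> R" "0 \<le> y $ k" using y by auto
qed

end

context barrier_domain
begin

definition "Dm = {x \<in> \<Omega>. rho x < R}"

lemma Dm_open: "open Dm"
proof -
  have "Dm = \<Omega> \<inter> {x. rho x < R}" by (auto simp: Dm_def)
  then show ?thesis by (simp add: open_half open_Int open_Collect_less rho_cont)
qed

lemma Dm_closure: "x \<in> closure Dm \<Longrightarrow> rho x \<le> R \<and> 0 \<le> x $ k"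
proof -
  have "closed ({x. rho x \<le> R} \<inter> {x. 0 \<le> x $ k})" by (intro closed_Int closed_Collect_le rho_cont continuous_intros)
  moreover have "Dm \<subseteq> {x. rho x \<le> R} \<inter> {x. 0 \<le> x $ k}" by (auto simp: Dm_def half_space_def)
  ultimately have "closure Dm \<subseteq> {x. rho x \<le> R} \<inter> {x. 0 \<le> x $ k}" by (intro closure_minimal)
  then show "x \<in> closure Dm \<Longrightarrow> rho x \<le> R \<and> 0 \<le> x $ k" by auto
qed

lemma Dm_bounded: "bounded (closure Dm)"
proof -
  have "closure Dm \<subseteq> cball (- axis k g) (R + g)"
  proof
    fix x assume "x \<in> closure Dm"
    then have "rho x \<le> R" using Dm_closure by blast
    then show "x \<in> cball (- axis k g) (R + g)"
      by (simp add: rho_def z_def dist_norm norm_minus_commute[of "- axis k g" x])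
  qed
  then show ?thesis using bounded_subset[OF bounded_cball] by blast
qed

lemma v_cont: "continuous_on \<Omega> v"
  using v_deriv by (auto intro!: continuous_at_imp_continuous_on has_derivative_continuous)

text \<open>At an interior maximum of u - v the function \<open>v\<close> is itself an admissible
  test function, which \<open>supersolution\<close> excludes. The constant \<open>K\<close> shifts
  the barrier without affecting its derivatives, so one lemma serves both comparisons in
  \<open>growth\<close>.\<close>

lemma compare:
  assumes vs: "viscosity_subsolution Fop \<Omega> u"
    and bd: "\<forall>y\<in>frontier \<Omega>. Limsup (at y within \<Omega>) (\<lambda>x. ereal (u x)) \<le> 0"
    and K: "0 \<le> K" and fr: "\<And>y. y \<in> frontier Dm \<Longrightarrow> y \<in> \<Omega> \<Longrightarrow> u y \<le> Vb R + K"
    and x1: "x1 \<in> Dm"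
  shows "u x1 \<le> v x1 + K"
proof (rule ccontr)
  assume n: "\<not> u x1 \<le> v x1 + K"
  define a where "a = u x1 - v x1"
  have a: "a > K" "a > 0" using n K by (auto simp: a_def)
  let ?w = "\<lambda>x. u x - v x"
  have usc: "usc_on \<Omega> u" using vs by (simp add: viscosity_subsolution_def)
  have wo: "open {x \<in> \<Omega>. ?w x < c}" for c by (rule usc_diff_open[OF open_half usc v_cont])
  \<comment> \<open>On the boundary of the half-space only an upper limit of \<open>u\<close> is
    known. It is at most 0 and v >= 0 inside, so each such point has a neighbourhood with u - v < a.
    Removing all such open sets leaves a compact subset of the half-space on which the maximum is
    attained.\<close>
  define N where "N = \<Union>{N. open N \<and> (\<forall>y\<in>N \<inter> \<Omega>. ?w y < a)}"
  have No: "open N" unfolding N_def by (intro open_Union) auto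
  define C where "C = closure Dm \<inter> - N"
  have C_sub: "x \<in> \<Omega> \<and> a \<le> ?w x" if "x \<in> C" for x
  proof -
    have xc: "x \<in> closure Dm" and xN: "x \<notin> N" using that by (auto simp: C_def)
    have "x \<in> \<Omega>"
    proof (rule ccontr)
      assume "x \<notin> \<Omega>"
      then have "x $ k = 0" using Dm_closure[OF xc] by (simp add: half_space_def)
      then have "Limsup (at x within \<Omega>) (\<lambda>x. ereal (u x)) \<le> 0" using bd by (simp add: frontier_half)
      then have "Limsup (at x within \<Omega>) (\<lambda>x. ereal (u x)) < ereal a" using a(2) le_less_trans by fastforce
      from Limsup_lessD[OF this] obtain S where S: "open S" "x \<in> S" "\<And>y. y \<in> S \<Longrightarrow> y \<noteq> x \<Longrightarrow> y \<in> \<Omega> \<Longrightarrow> u y < a"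
        by (auto simp: eventually_at_topological)
      have "\<forall>y\<in>S \<inter> \<Omega>. ?w y < a"
      proof
        fix y assume y: "y \<in> S \<inter> \<Omega>"
        then have "u y < a" using S(3) \<open>x \<notin> \<Omega>\<close> by blast
        moreover have "0 \<le> v y" unfolding v_def using rho_pos[of y] y by (intro Vb_nonneg) simp
        ultimately show "?w y < a" by simp
      qed
      then have "x \<in> N" unfolding N_def using S by blast
      then show False using xN by simp
    qed
    moreover have "a \<le> ?w x"
    proof (rule ccontr)
      assume "\<not> a \<le> ?w x"
      then have "x \<in> {x \<in> \<Omega>. ?w x < a}" using \<open>x \<in> \<Omega>\<close> by simp
      then have "x \<in> N" unfolding N_def using wo[of a] by blast
      then show False using xN by simp
    qed
    ultimately show ?thesis by simp
  qed
  have x1C: "x1 \<in> C"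
  proof -
    have "x1 \<notin> N"
    proof
      assume "x1 \<in> N"
      then obtain S where "x1 \<in> S" "\<forall>y\<in>S \<inter> \<Omega>. ?w y < a" unfolding N_def by blast
      then show False using x1 by (auto simp: a_def Dm_def)
    qed
    then show ?thesis using x1 closure_subset[of Dm] by (auto simp: C_def)
  qed
  have "compact C" unfolding C_def compact_eq_bounded_closed using No
    by (auto intro: bounded_subset[OF Dm_bounded] closed_Int closed_Compl)
  then obtain x2 where x2: "x2 \<in> C" "\<And>y. y \<in> C \<Longrightarrow> ?w y \<le> ?w x2"
    using usc_attains_sup[of C \<Omega> ?w] x1C C_sub wo by blast
  have x2o: "x2 \<in> \<Omega>" "a \<le> ?w x2" using C_sub[OF x2(1)] by auto
  have x2D: "x2 \<in> Dm"
  proof (rule ccontr)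
    assume nD: "x2 \<notin> Dm"
    have xc: "x2 \<in> closure Dm" using x2(1) by (simp add: C_def)
    then have "x2 \<in> frontier Dm" using nD Dm_open by (simp add: frontier_def interior_open)
    then have "u x2 \<le> Vb R + K" using fr x2o by blast
    moreover have "rho x2 = R" using Dm_closure[OF xc] nD x2o by (auto simp: Dm_def)
    ultimately show False using x2o(2) a by (simp add: v_def)
  qed
  have "\<forall>\<^sub>F x in at x2 within \<Omega>. u x - v x \<le> u x2 - v x2"
    unfolding eventually_at_topological
  proof (intro exI[of _ Dm] conjI ballI impI)
    fix y assume y: "y \<in> Dm"
    show "u y - v y \<le> u x2 - v x2"
    proof (cases "y \<in> C")
      case True then show ?thesis by (rule x2(2))
    next
      case False
      then have "y \<in> N" using y closure_subset[of Dm] by (auto simp: C_def)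
      then have "?w y < a" unfolding N_def using y by (auto simp: Dm_def)
      then show ?thesis using x2o by simp
    qed
  qed (use Dm_open x2D in auto)
  then have "Fop x2 (u x2) (grad v x2) (hess v x2) \<le> 0"
    using vs v_C2 x2o(1) by (auto simp: viscosity_subsolution_def)
  moreover have "Fop x2 (u x2) (grad v x2) (hess v x2) > 0"
    using x2D by (intro supersolution) (auto simp: Dm_def)
  ultimately show False by simp
qed

end

context px_setting
begin

text \<open>In \<open>C\<close> the product n c bounds the curvature in units of D(R) exp(-I(R)),
  and the summand 1 makes the inequality strict. As \<open>C\<close> does not depend on R, the lower
  bounds survive the limit.\<close>

lemma growth:
  assumes sub: "px_subharmonic \<Omega> p u"
    and bd: "\<forall>y\<in>frontier \<Omega>. Limsup (at y within \<Omega>) (\<lambda>x. ereal (u x)) \<le> 0"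
    and \<gamma>: "\<forall>R>0. 0 < \<gamma> R" "mono_on {0<..} \<gamma>"
    and c: "c > 0" "\<forall>R>0. p_Lam k p R / Dp_norm k p R * ereal (exp (Dp_int k p R)) \<le> ereal (c * \<gamma> R)"
    and \<nu>: "0 < \<nu>" "\<nu> \<le> 1" and t: "t > 0" "u (axis k t) \<ge> u_check k p \<nu> (axis k t)" and tR: "t < R"
  defines "C \<equiv> real CARD('n) * c + 1"
  shows "ereal (exp (- C) * f_nu k p \<nu> R) \<le> M_deriv k \<gamma> u R"
    and "ereal (exp (- C) * f_nu k p \<nu> R * R) \<le> M_max k \<gamma> u R"
proof -
  have R0: "0 < R" using t tR by simp
  \<comment> \<open>If D(s) were 0, the quotient in the hypothesis on \<gamma> would be infinite;
    this is where positivity of D comes from.\<close>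
  have gcond: "0 < D s" "Lam s / \<gamma> s \<le> c * D s * exp (- I s)" if s: "0 < s" for s
  proof -
    have L: "0 < Lam s" by (rule Lam_pos[OF s])
    have b: "ereal (Lam s) / ereal (D s) * ereal (exp (I s)) \<le> ereal (c * \<gamma> s)"
      using c(2) s by (simp add: Lam_eq Dp_eq)
    have "D s \<noteq> 0"
    proof
      assume "D s = 0"
      then have "ereal (Lam s) / ereal (D s) = \<infinity>" using L by (simp add: divide_ereal_def)
      then show False using b by simp
    qed
    then show d: "0 < D s" using D_nonneg[of s] by simp
    then have "Lam s / D s * exp (I s) \<le> c * \<gamma> s" using b by simp
    then have "Lam s * exp (I s) \<le> c * \<gamma> s * D s" using d by (simp add: field_simps)
    then have "Lam s * exp (I s) * exp (- I s) \<le> c * \<gamma> s * D s * exp (- I s)" by (intro mult_right_mono) auto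
    then have "Lam s \<le> c * \<gamma> s * D s * exp (- I s)" by (simp add: mult.assoc exp_add[symmetric])
    then show "Lam s / \<gamma> s \<le> c * D s * exp (- I s)" using \<gamma>(1) s by (simp add: divide_le_eq mult_ac)
  qed
  \<comment> \<open>The factor exp(-I(R)) matches the curvature bound and is cancelled by exp(I(R))
    in W(R), so that \<open>E R\<close> loses only exp(-C).\<close>
  define \<delta> where "\<delta> = C * exp (- I R)"
  have C0: "C > 0" using c by (simp add: C_def add_nonneg_pos)
  interpret barrier_domain k p \<nu> \<delta> "\<gamma> R" R
  proof
    show "0 < \<delta>" using C0 by (simp add: \<delta>_def)
    have "real CARD('n) * (Lam R / \<gamma> R) \<le> real CARD('n) * (c * D R * exp (- I R))"
      by (intro mult_left_mono gcond R0) simp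
    also have "\<dots> < D R * \<delta>" using gcond(1)[OF R0] by (simp add: \<delta>_def C_def algebra_simps)
    finally show "real CARD('n) * Lam R / \<gamma> R < D R * \<delta>" by simp
  qed (use \<nu> gcond(1) \<gamma>(1) R0 in auto)
  have vs: "viscosity_subsolution Fop \<Omega> u" by (rule Fop_viscosity[OF sub])
  have E_low: "exp (- C) * f_nu k p \<nu> R \<le> E R"
  proof -
    have "exp (I R) * \<delta> = C" by (simp add: \<delta>_def exp_add[symmetric] mult.left_commute)
    then have "- C + ln \<nu> * exp (I R) \<le> W R" using del by (simp add: W_def algebra_simps)
    then show ?thesis unfolding f_nu_eq[OF \<nu>] E_def by (simp add: exp_add[symmetric])
  qed
  have Dm_eq: "Dom k \<gamma> R = Dm"
    unfolding Dom_eq[of \<gamma> R, OF g R0] Dm_def by (auto simp: rho_def z_def)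
  have M_ge: "ereal (u y) \<le> M_max k \<gamma> u R" if "y \<in> frontier Dm" "y \<in> \<Omega>" for y
    unfolding M_max_def Dm_eq using that by (intro SUP_upper2[of y]) (auto simp: ext_closure_def)
  \<comment> \<open>Otherwise comparison with \<open>K = 0\<close> gives u <= V at the given point
    of the axis, while V lies strictly below \<open>u_check\<close> there.\<close>
  have M_gt: "ereal (Vb R) < M_max k \<gamma> u R"
  proof (rule ccontr)
    assume "\<not> ereal (Vb R) < M_max k \<gamma> u R"
    then have M: "M_max k \<gamma> u R \<le> ereal (Vb R)" by simp
    have fr: "u y \<le> Vb R + 0" if "y \<in> frontier Dm" "y \<in> \<Omega>" for y
      using order_trans[OF M_ge[OF that] M] by simp
    have rt: "rho (axis k t) = t" using t g by (simp add: rho_def z_def axis_plus norm_axis_real)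
    have "axis k t \<in> Dm" using t tR by (simp add: Dm_def axis_half rt)
    from compare[OF vs bd order_refl fr this] have "u (axis k t) \<le> Vb t" by (simp add: v_def rt)
    also have "\<dots> < u_check k p \<nu> (axis k t)" using Vb_less[OF t(1)] by (simp add: u_check_def axis_def)
    finally show False using t(2) by simp
  qed
  have VR: "E R * R \<le> Vb R" using Vb_incr[of 0 R] R0 by (simp add: Vb_0)
  show "ereal (exp (- C) * f_nu k p \<nu> R * R) \<le> M_max k \<gamma> u R"
  proof -
    have "exp (- C) * f_nu k p \<nu> R * R \<le> E R * R" using E_low R0 by (intro mult_right_mono) auto
    then have "ereal (exp (- C) * f_nu k p \<nu> R * R) \<le> ereal (Vb R)" using VR by simp
    then show ?thesis using M_gt by (meson less_imp_le order_trans)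
  qed
  show "ereal (exp (- C) * f_nu k p \<nu> R) \<le> M_deriv k \<gamma> u R"
    unfolding M_deriv_def
  proof (rule Liminf_bounded)
    have "\<forall>\<^sub>F h in at_right 0. h \<in> {0<..<R}" by (rule eventually_at_right_real[OF R0])
    then show "\<forall>\<^sub>F h in at_right 0. ereal (exp (- C) * f_nu k p \<nu> R) \<le> (M_max k \<gamma> u R - M_max k \<gamma> u (R - h)) / ereal h"
    proof eventually_elim
      case (elim h)
      then have h: "0 < h" "h < R" by auto
      show ?case
      proof (cases "M_max k \<gamma> u R")
        \<comment> \<open>For extended reals infinity minus infinity is infinity, so the quotient is
          infinite whatever M(R - h) is.\<close>
        case PInf
        then show ?thesis using h by simp
      next
        case MInf
        then show ?thesis using M_gt by simp
      next
        case (real m)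
        define K where "K = m - Vb R"
        have K: "0 \<le> K" using M_gt by (simp add: K_def real)
        have fr: "u y \<le> Vb R + K" if "y \<in> frontier Dm" "y \<in> \<Omega>" for y
          using M_ge[OF that] by (simp add: K_def real)
        have R': "0 < R - h" "0 < \<gamma> (R - h)" using h \<gamma>(1) by auto
        \<comment> \<open>Monotonicity of \<gamma> handles the change of domain: by the triangle
          inequality the closure of the domain for R - h, built with \<gamma>(R - h), lies in
          \<open>rho\<close> <= R - h, where \<open>rho\<close> is built with \<gamma>(R). The
          barrier for R can thus be used on it.\<close>
        have gm: "\<gamma> (R - h) \<le> \<gamma> R" using \<gamma>(2) h R' R0 by (intro mono_onD[OF \<gamma>(2)]) auto
        have "M_max k \<gamma> u (R - h) \<le> ereal (Vb (R - h) + K)"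
          unfolding M_max_def
        proof (rule SUP_least)
          fix y assume "y \<in> frontier (Dom k \<gamma> (R - h))"
          then have yc: "y \<in> closure (Dom k \<gamma> (R - h))" by (simp add: frontier_def)
          note cD = closure_Dom[of \<gamma> "R - h", OF R'(2,1) yc]
          show "ext_closure k u y \<le> ereal (Vb (R - h) + K)"
          proof (cases "y \<in> \<Omega>")
            case False
            then have "y $ k = 0" using cD(2) by (simp add: half_space_def)
            then have "ext_closure k u y \<le> 0" using bd False by (simp add: ext_closure_def frontier_half)
            moreover have "0 \<le> Vb (R - h) + K" using K Vb_nonneg[of "R - h"] R' by simp
            ultimately show ?thesis by (meson ereal_less_eq(5) order_trans)
          next
            case True
            have "z y = (y + axis k (\<gamma> (R - h))) + axis k (\<gamma> R - \<gamma> (R - h))"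
              by (simp add: z_def axis_plus add.assoc)
            then have "norm (z y) \<le> norm (y + axis k (\<gamma> (R - h))) + (\<gamma> R - \<gamma> (R - h))"
              using norm_triangle_ineq[of "y + axis k (\<gamma> (R - h))" "axis k (\<gamma> R - \<gamma> (R - h))"] gm by (simp add: norm_axis_real)
            then have ry: "rho y \<le> R - h" using cD(1) by (simp add: rho_def)
            then have "y \<in> Dm" using True h by (simp add: Dm_def)
            from compare[OF vs bd K fr this] have "u y \<le> Vb (rho y) + K" by (simp add: v_def)
            also have "\<dots> \<le> Vb (R - h) + K" using Vb_mono[OF less_imp_le[OF rho_pos[OF True]] ry] by simp
            finally show ?thesis using True by (simp add: ext_closure_def)
          qed
        qed
        then have "ereal m - ereal (Vb (R - h) + K) \<le> M_max k \<gamma> u R - M_max k \<gamma> u (R - h)"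
          unfolding real by (intro ereal_minus_mono) auto
        moreover have "E R * h \<le> m - (Vb (R - h) + K)" using Vb_incr[of "R - h" R] h by (simp add: K_def)
        ultimately have "ereal (E R * h) \<le> M_max k \<gamma> u R - M_max k \<gamma> u (R - h)"
          by (metis ereal_less_eq(3) ereal_minus(1) order_trans)
        then have "ereal (E R * h) / ereal h \<le> (M_max k \<gamma> u R - M_max k \<gamma> u (R - h)) / ereal h"
          using h by (intro ereal_divide_right_mono) auto
        moreover have "ereal (E R * h) / ereal h = ereal (E R)" using h by simp
        ultimately show ?thesis using E_low by (metis ereal_less_eq(3) order_trans)
      qed
    qed
  qed
qed

end

theorem theorem3:
  fixes k :: "'n::finite"
    and p u :: "real ^ 'n \<Rightarrow> real"
  assumes "C_on 1 (half_space k) p"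
    and "\<forall>x\<in>half_space k. 1 < p x"
    and "\<forall>t>0. 0 < p_lam k p t \<and> p_lam k p t < \<infinity>"
    and "\<forall>t>0. 0 < p_Lam k p t \<and> p_Lam k p t < \<infinity>"
    and "\<forall>t\<ge>0. \<forall>s\<ge>0. \<bar>Phi k p t s\<bar> \<noteq> \<infinity>"
    and "continuous_on ({0..} \<times> {0..}) (\<lambda>(t, s). Phi k p t s)"
    and "px_subharmonic (half_space k) p u"
    and "\<forall>y\<in>frontier (half_space k). Limsup (at y within half_space k) (\<lambda>x. ereal (u x)) \<le> 0"
  shows "(\<exists>F :: real ^ 'n \<Rightarrow> real \<Rightarrow> real ^ 'n \<Rightarrow> real ^ 'n ^ 'n \<Rightarrow> real.
            degenerate_elliptic F \<and>
            viscosity_subsolution F (half_space k) u \<and>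
            (\<forall>x\<in>half_space k. \<forall>q X P N. sym_mat X \<and> pos_neg_parts X P N \<longrightarrow>
               ereal (- F x 0 q X) \<le>
                 Phi k p (norm x) (norm q) + p_Lam k p (x $ k) * ereal (trace P)
                   - p_lam k p (x $ k) * ereal (trace N)))
       \<and> (\<forall>t\<ge>0. \<forall>s\<ge>0. 0 \<le> Phi k p t s)
       \<and> (\<forall>\<epsilon>>0. \<forall>t>0. (\<integral>\<^sup>+ s\<in>{0<..<\<epsilon>}. 1 / e2ennreal (Phi k p t s) \<partial>lborel) = \<infinity>)
       \<and> (\<forall>\<gamma> :: real \<Rightarrow> real.
            (\<forall>R>0. 0 < \<gamma> R) \<and> mono_on {0<..} \<gamma> \<and>
            (\<exists>c>0. \<forall>R>0. p_Lam k p R / Dp_norm k p R * ereal (exp (Dp_int k p R)) \<le> ereal (c * \<gamma> R))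
            \<longrightarrow>
            (\<forall>\<nu>. 0 < \<nu> \<and> \<nu> \<le> 1 \<and> (\<exists>t>0. u (axis k t) \<ge> u_check k p \<nu> (axis k t)) \<longrightarrow>
               Liminf at_top (\<lambda>R. M_deriv k \<gamma> u R / ereal (\<nu> powr exp (Dp_int k p R))) > 0) \<and>
            (\<forall>\<nu>>1. (\<exists>t>0. u (axis k t) \<ge> u_check k p \<nu> (axis k t)) \<longrightarrow>
               Liminf at_top (\<lambda>R. M_max k \<gamma> u R / ereal R) > 0))"
proof -
  interpret px_setting k p by standard (fact assms)+
  show ?thesis
  proof (intro conjI allI impI)
    show "\<exists>F :: real ^ 'n \<Rightarrow> real \<Rightarrow> real ^ 'n \<Rightarrow> real ^ 'n ^ 'n \<Rightarrow> real.
            degenerate_elliptic F \<and>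
            viscosity_subsolution F (half_space k) u \<and>
            (\<forall>x\<in>half_space k. \<forall>q X P N. sym_mat X \<and> pos_neg_parts X P N \<longrightarrow>
               ereal (- F x 0 q X) \<le>
                 Phi k p (norm x) (norm q) + p_Lam k p (x $ k) * ereal (trace P)
                   - p_lam k p (x $ k) * ereal (trace N))"
      using Fop_elliptic Fop_viscosity[OF assms(7)] Fop_bound by (intro exI[of _ Fop] conjI) blast+
  next
    fix t s :: real assume "0 \<le> t" "0 \<le> s"
    then show "0 \<le> Phi k p t s" by (rule Phi_nonneg)
  next
    fix \<epsilon> t :: real assume "0 < \<epsilon>" "0 < t"
    then show "(\<integral>\<^sup>+ s\<in>{0<..<\<epsilon>}. 1 / e2ennreal (Phi k p t s) \<partial>lborel) = \<infinity>" by (intro osgood) auto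
  next
    fix \<gamma> :: "real \<Rightarrow> real" and \<nu> :: real
    assume g: "(\<forall>R>0. 0 < \<gamma> R) \<and> mono_on {0<..} \<gamma> \<and>
            (\<exists>c>0. \<forall>R>0. p_Lam k p R / Dp_norm k p R * ereal (exp (Dp_int k p R)) \<le> ereal (c * \<gamma> R))"
      and n: "0 < \<nu> \<and> \<nu> \<le> 1 \<and> (\<exists>t>0. u (axis k t) \<ge> u_check k p \<nu> (axis k t))"
    obtain c where c: "c > 0" "\<forall>R>0. p_Lam k p R / Dp_norm k p R * ereal (exp (Dp_int k p R)) \<le> ereal (c * \<gamma> R)"
      using g by blast
    obtain t where t: "t > 0" "u (axis k t) \<ge> u_check k p \<nu> (axis k t)" using n by blast
    \<comment> \<open>The constant exp(-C) of \<open>growth\<close>, the same for all R > t.\<close>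
    define a where "a = exp (- (real CARD('n) * c + 1))"
    have "\<forall>\<^sub>F R in at_top. ereal a \<le> M_deriv k \<gamma> u R / ereal (\<nu> powr exp (Dp_int k p R))"
      using eventually_gt_at_top[of t]
    proof eventually_elim
      case (elim R)
      have f: "f_nu k p \<nu> R = \<nu> powr exp (Dp_int k p R)" "0 < \<nu> powr exp (Dp_int k p R)"
        using n by (auto simp: f_nu_def)
      have "ereal (a * f_nu k p \<nu> R) \<le> M_deriv k \<gamma> u R"
        unfolding a_def using g n c t elim by (intro growth(1)[OF assms(7,8)]) auto
      then have "ereal (a * f_nu k p \<nu> R) / ereal (f_nu k p \<nu> R) \<le> M_deriv k \<gamma> u R / ereal (f_nu k p \<nu> R)"
        using f by (intro ereal_divide_right_mono) auto
      then show ?case using f by simp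
    qed
    then have "ereal a \<le> Liminf at_top (\<lambda>R. M_deriv k \<gamma> u R / ereal (\<nu> powr exp (Dp_int k p R)))"
      by (rule Liminf_bounded)
    moreover have "0 < ereal a" by (simp add: a_def)
    ultimately show "0 < Liminf at_top (\<lambda>R. M_deriv k \<gamma> u R / ereal (\<nu> powr exp (Dp_int k p R)))"
      by (rule less_le_trans[rotated])
  next
    fix \<gamma> :: "real \<Rightarrow> real" and \<nu> :: real
    assume g: "(\<forall>R>0. 0 < \<gamma> R) \<and> mono_on {0<..} \<gamma> \<and>
            (\<exists>c>0. \<forall>R>0. p_Lam k p R / Dp_norm k p R * ereal (exp (Dp_int k p R)) \<le> ereal (c * \<gamma> R))"
      and n: "1 < \<nu>" "\<exists>t>0. u (axis k t) \<ge> u_check k p \<nu> (axis k t)"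
    obtain c where c: "c > 0" "\<forall>R>0. p_Lam k p R / Dp_norm k p R * ereal (exp (Dp_int k p R)) \<le> ereal (c * \<gamma> R)"
      using g by blast
    obtain t where t: "t > 0" "u (axis k t) \<ge> u_check k p \<nu> (axis k t)" using n by blast
    \<comment> \<open>Reduction to \<nu> = 1: powers of a number above 1 with positive exponent are
      at least 1, the value of \<open>f_nu\<close> for \<nu> = 1. With \<open>f_nu\<close> equal to
      1 the bound on M(R) is linear in R.\<close>
    have "u_check k p 1 (axis k t) \<le> u_check k p \<nu> (axis k t)"
      unfolding u_check_def
    proof (rule integral_le)
      show "f_nu k p 1 integrable_on {0..axis k t $ k}" "f_nu k p \<nu> integrable_on {0..axis k t $ k}"
        using n by (intro integrable_continuous_real continuous_on_subset[OF f_nu_cont]; auto)+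
      fix s
      show "f_nu k p 1 s \<le> f_nu k p \<nu> s" using n by (simp add: f_nu_def ge_one_powr_ge_zero)
    qed
    then have t1: "u (axis k t) \<ge> u_check k p 1 (axis k t)" using t(2) by simp
    define a where "a = exp (- (real CARD('n) * c + 1))"
    have "\<forall>\<^sub>F R in at_top. ereal a \<le> M_max k \<gamma> u R / ereal R"
      using eventually_gt_at_top[of t]
    proof eventually_elim
      case (elim R)
      have R: "0 < R" using elim t by simp
      have "ereal (a * f_nu k p 1 R * R) \<le> M_max k \<gamma> u R"
        unfolding a_def using g c t t1 elim by (intro growth(2)[OF assms(7,8)]) auto
      then have "ereal (a * R) / ereal R \<le> M_max k \<gamma> u R / ereal R"
        using R by (intro ereal_divide_right_mono) (auto simp: f_nu_def)
      then show ?case using R by simp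
    qed
    then have "ereal a \<le> Liminf at_top (\<lambda>R. M_max k \<gamma> u R / ereal R)"
      by (rule Liminf_bounded)
    moreover have "0 < ereal a" by (simp add: a_def)
    ultimately show "0 < Liminf at_top (\<lambda>R. M_max k \<gamma> u R / ereal R)"
      by (rule less_le_trans[rotated])
  qed
qed

end
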